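(* Let $K$ be a field, $R=K[x_1,\ldots,x_n]$, and let $I_{c,\mathcal{F}}\subseteq R$ be the ideal of a linear star configuration of height $c$ on $\mathcal{F}$. Then any set $\mathcal{H}\subseteq\mathcal{F}$ of cardinality $s\le n$ that is not a regular sequence generates a prime ideal $\mathfrak{q}\in NLT(I_{c,\mathcal{F}})\setminus\{(x_1,\ldots,x_n)\}$. Moreover, if $c=2$, the minimal elements of $NLT(I_{2,\mathcal{F}})$ that are not maximal ideals of $R$ are all of this form (i.e. each is generated by a subset of $\mathcal{F}$ of cardinality at most $n$ that is not a regular sequence). If instead $c\ge3$, then $NLT(I_{c,\mathcal{F}})=\{\mathfrak{p}\in\operatorname{Spec}(R) : |\mathcal{F}\cap\mathfrak{p}|>c\}$.
   Context: For a set $\mathcal{F}=\{F_1,\ldots,F_t\}$ of homogeneous polynomials in $R$ and $1\le c\le\min\{n,t\}$, let $I_{c,\mathcal{F}}=\bigcap_{1\le i_1<\cdots<i_c\le t}(F_{i_1},\ldots,F_{i_c})$. It is called the ideal of the star configuration of height $c$ on $\mathcal{F}$ if every subset of $\mathcal{F}$ of cardinality $c+1$ is a regular sequence; it is a linear star configuration if moreover all $F_i$ are homogeneous of degree one. An ideal $I=(g_1,\ldots,g_\mu)$ of a Noetherian ring $A$ is of linear type if the kernel of the $A$-algebra map $A[T_1,\ldots,T_\mu]\to A[I\tau]\subseteq A[\tau]$, $T_i\mapsto g_i\tau$, is generated by elements homogeneous of degree one in the $T_i$. The non-linear type locus is $NLT(I_{c,\mathcal{F}})=\{\mathfrak{p}\in\operatorname{Spec}(R)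 : (I_{c,\mathcal{F}})_{\mathfrak{p}}\text{ is not of linear type}\}$.
   Formalization: The first assertion is stated for c ≥ 2 (for c = 1 the ideal is principal and NLT is empty, so it fails for F={x,y,x+y} in K[x,y,z]), and when c = t the set F itself is required to be a regular sequence (otherwise F={x,2x}, c=n=2, char K≠2, is a counterexample). *)

theory Defs
  imports
    "HOL-Algebra.Algebra"
    "HOL-Algebra.Algebraic_Closure_Type"
    "HOL-Library.Poly_Mapping"
    "HOL-Computational_Algebra.Polynomial"
    "HOL-Computational_Algebra.Fraction_Field"
begin

text \<open>
  All rings are subrings of type-class rings, presented as \<^verbatim>\<open>HOL-Algebra\<close> records so that
  the library notions of ideal, prime ideal, maximal ideal, generated ideal and kernel apply.
\<close>

definition subring_of :: "'a::comm_ring_1 set \<Rightarrow> 'a ring" where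
  "subring_of A = ring_of_type_algebra\<lparr>carrier := A\<rparr>"

text \<open>
  Polynomials in countably many variables: finitely supported maps from exponent vectors
  (finitely supported maps \<^typ>\<open>nat \<Rightarrow>\<^sub>0 nat\<close>) to coefficients.
  \<open>mpolys A n\<close> is \<open>A[X\<^sub>0, \<dots>, X\<^sub>n\<^sub>-\<^sub>1]\<close>, for a subring \<open>A\<close> of the coefficient type.
\<close>

type_synonym 'a mpoly = "(nat \<Rightarrow>\<^sub>0 nat) \<Rightarrow>\<^sub>0 'a"

definition mpolys :: "'a::comm_ring_1 set \<Rightarrow> nat \<Rightarrow> 'a mpoly set" where
  "mpolys A n = {P. (\<forall>m. Poly_Mapping.lookup P m \<in> A) \<and>
                   (\<forall>m\<in>Poly_Mapping.keys P. Poly_Mapping.keys m \<subseteq> {..<n})}"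

abbreviation mpoly_ring :: "'a::comm_ring_1 set \<Rightarrow> nat \<Rightarrow> 'a mpoly ring" where
  "mpoly_ring A n \<equiv> subring_of (mpolys A n)"

definition mvar :: "nat \<Rightarrow> 'a::comm_ring_1 mpoly" where
  "mvar i = Poly_Mapping.single (Poly_Mapping.single i 1) 1"

text \<open>The zero polynomial is homogeneous of every degree.\<close>

definition homogeneous :: "nat \<Rightarrow> 'a::zero mpoly \<Rightarrow> bool" where
  "homogeneous d P \<longleftrightarrow>
     (\<forall>m\<in>Poly_Mapping.keys P. (\<Sum>i\<in>Poly_Mapping.keys m. Poly_Mapping.lookup m i) = d)"

text \<open>
  The second conjunct says that the \<open>i\<close>-th element is a nonzerodivisor modulo the ideal
  generated by its predecessors. The empty sequence is regular in a nonzero ring.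
\<close>

definition regular_sequence :: "('a, 'b) ring_scheme \<Rightarrow> 'a list \<Rightarrow> bool" where
  "regular_sequence R fs \<longleftrightarrow>
     set fs \<subseteq> carrier R \<and>
     (\<forall>i<length fs. \<forall>a\<in>carrier R.
        a \<otimes>\<^bsub>R\<^esub> fs ! i \<in> Idl\<^bsub>R\<^esub> (set (take i fs)) \<longrightarrow> a \<in> Idl\<^bsub>R\<^esub> (set (take i fs))) \<and>
     Idl\<^bsub>R\<^esub> (set fs) \<noteq> carrier R"

text \<open>
  For homogeneous polynomials of positive degree regularity does not depend on the order, so
  it is a property of the set.
\<close>

definition is_regular_sequence_set :: "('a, 'b) ring_scheme \<Rightarrow> 'a set \<Rightarrow> bool" where
  "is_regular_sequence_set R S \<longleftrightarrow>
     (\<exists>fs. distinct fs \<and> set fs = S \<and> regular_sequence R fs)"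

definition star_ideal :: "nat \<Rightarrow> nat \<Rightarrow> 'k::field mpoly set \<Rightarrow> 'k mpoly set" where
  "star_ideal n c F = (\<Inter>S\<in>{S. S \<subseteq> F \<and> card S = c}. Idl\<^bsub>mpoly_ring UNIV n\<^esub> S)"

text \<open>
  The cardinality \<open>min (c + 1) (card F)\<close> differs from \<open>c + 1\<close> only if \<open>card F = c\<close>: there are then
  no subsets of cardinality \<open>c + 1\<close>, and \<open>F\<close> itself is required to be a regular sequence (without
  this, \<open>star_ideal n c F\<close> would be generated by \<open>c\<close> arbitrary forms and could fail to have
  height \<open>c\<close>).
\<close>

definition star_configuration :: "nat \<Rightarrow> nat \<Rightarrow> 'k::field mpoly set \<Rightarrow> bool" where
  "star_configuration n c F \<longleftrightarrow>
     finite F \<and> 1 \<le> c \<and> c \<le> min n (card F) \<and>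
     F \<subseteq> mpolys UNIV n \<and> (\<forall>f\<in>F. \<exists>d. homogeneous d f) \<and>
     (\<forall>S\<subseteq>F. card S = min (c + 1) (card F) \<longrightarrow>
        is_regular_sequence_set (mpoly_ring UNIV n) S)"

definition linear_star_configuration :: "nat \<Rightarrow> nat \<Rightarrow> 'k::field mpoly set \<Rightarrow> bool" where
  "linear_star_configuration n c F \<longleftrightarrow> star_configuration n c F \<and> (\<forall>f\<in>F. homogeneous 1 f)"

text \<open>
  For a list \<open>g\<^sub>0, \<dots>, g\<^sub>\<mu>\<^sub>-\<^sub>1\<close> in \<open>A\<close>, \<open>rees_map\<close> is the \<open>A\<close>-algebra map
  \<open>A[T\<^sub>0, \<dots>, T\<^sub>\<mu>\<^sub>-\<^sub>1] \<rightarrow> A[\<tau>]\<close>, \<open>T\<^sub>i \<mapsto> g\<^sub>i \<tau>\<close>, where \<open>[:0, g:]\<close> is \<open>g \<tau>\<close>. Its image is the Rees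
  algebra; restricting the codomain to the image does not change the kernel.
\<close>

definition rees_map :: "'a::comm_ring_1 list \<Rightarrow> 'a mpoly \<Rightarrow> 'a poly" where
  "rees_map gs P =
     (\<Sum>m\<in>Poly_Mapping.keys P.
        smult (Poly_Mapping.lookup P m)
          (\<Prod>i\<in>Poly_Mapping.keys m. [:0, gs ! i:] ^ Poly_Mapping.lookup m i))"

definition rees_kernel :: "'a::comm_ring_1 set \<Rightarrow> 'a list \<Rightarrow> 'a mpoly set" where
  "rees_kernel A gs = a_kernel (mpoly_ring A (length gs)) ring_of_type_algebra (rees_map gs)"

definition linear_type :: "'a::comm_ring_1 set \<Rightarrow> 'a set \<Rightarrow> bool" where
  "linear_type A I \<longleftrightarrow>
     (\<exists>gs. set gs \<subseteq> A \<and> I = Idl\<^bsub>subring_of A\<^esub> (set gs) \<and>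
        (\<exists>L \<subseteq> {P \<in> mpolys A (length gs). homogeneous 1 P}.
           rees_kernel A gs = Idl\<^bsub>mpoly_ring A (length gs)\<^esub> L))"

text \<open>
  For a subring \<open>D\<close> of an integral domain, a prime ideal \<open>p\<close> of \<open>D\<close> and an ideal \<open>M\<close> of \<open>D\<close>
  (possibly \<open>M = D\<close>), this is \<open>M\<^sub>p\<close> inside the field of fractions; \<open>localize D p D\<close> is the local
  ring \<open>D\<^sub>p\<close>.
\<close>

definition localize :: "'a::idom set \<Rightarrow> 'a set \<Rightarrow> 'a set \<Rightarrow> 'a fract set" where
  "localize D p M = {Fract a b | a b. a \<in> M \<and> b \<in> D - p}"

definition Spec :: "('a, 'b) ring_scheme \<Rightarrow> 'a set set" where
  "Spec R = {p. primeideal p R}"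

definition NLT :: "'a::idom set \<Rightarrow> 'a set \<Rightarrow> 'a set set" where
  "NLT D I = {p \<in> Spec (subring_of D). \<not> linear_type (localize D p D) (localize D p I)}"

end

theory Submission
  imports Defs
begin

text \<open>
  Localizing at \<open>p\<close> replaces \<open>F\<close> by \<open>G = F \<inter> p\<close>, and the ideal of the star configuration of height \<open>c\<close>
  on \<open>G\<close> is generated by the products of \<open>|G| + 1 - c\<close> elements of \<open>G\<close>. The coefficients of all linear
  relations between these products lie in \<open>p\<close>, so linear type fails as soon as the products satisfy
  a polynomial relation that has a coefficient outside \<open>p\<close>. For \<open>c \<ge> 3\<close> and \<open>|G| > c\<close> this is an
  exchange relation between four products; for \<open>c = 2\<close> it comes from a linear dependency of \<open>G\<close>.
  In the remaining cases the localized ideal is the unit ideal, or it is generated by the regular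
  sequence \<open>G\<close>, or \<open>c = 2\<close> and \<open>G\<close> is independent; there the evident linear relations generate all
  others, by induction on \<open>|G|\<close>. For \<open>c = 2\<close>, \<open>F \<inter> p\<close> is thus dependent for every \<open>p\<close> in the locus,
  and a circuit in it generates a smaller element of the locus unless it spans all linear forms.
\<close>

section \<open>Subrings and evaluation of polynomials\<close>

text \<open>Linear type is asserted for some system of generators, so its failure has to be shown
  for all systems at once. Here minimality enters: if no linear relation between the products has a
  coefficient outside \<open>p\<close>, then passing to other generators and back is the identity
  modulo \<open>p\<close>. Linear type would therefore force the value of every polynomial relation,
  at every point of the local ring, into the maximal ideal; a single point with unit value refutes
  it. For the positive cases one system suffices. An induction on the number of forms would
  naturally pass to quotient rings; instead, congruences modulo ideals \<open>Q B\<close> are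
  carried along inside one ring. The essential property of the forms is that each can be cancelled
  modulo the ideal generated by any of the others. It holds because linear forms generate prime
  ideals, which contain no linear form outside the span of the generators. The bound
  \<open>c \<ge> 3\<close> comes from the exchange relation: each of its four products uses two of
  four elements and omits the other two, while a product omits exactly \<open>c - 1\<close>
  elements.\<close>

lemma subring_of_simps [simp]:
  "carrier (subring_of A) = A"
  "\<one>\<^bsub>subring_of A\<^esub> = 1" "\<zero>\<^bsub>subring_of A\<^esub> = 0"
  "a \<otimes>\<^bsub>subring_of A\<^esub> b = a * b" "a \<oplus>\<^bsub>subring_of A\<^esub> b = a + b"
  by (simp_all add: subring_of_def ring_of_type_algebra_def)

locale type_subring =
  fixes A :: "'a::comm_ring_1 set"
  assumes one_mem [simp]: "1 \<in> A"
    and add_mem [simp]: "a \<in> A \<Longrightarrow> b \<in> A \<Longrightarrow> a + b \<in> A"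
    and mult_mem [simp]: "a \<in> A \<Longrightarrow> b \<in> A \<Longrightarrow> a * b \<in> A"
    and uminus_mem [simp]: "a \<in> A \<Longrightarrow> - a \<in> A"
begin

lemma zero_mem [simp]: "0 \<in> A"
  using add_mem[OF one_mem uminus_mem[OF one_mem]] by simp

lemma diff_mem [simp]: "a \<in> A \<Longrightarrow> b \<in> A \<Longrightarrow> a - b \<in> A"
  using add_mem[of a "- b"] by simp

lemma sum_mem [simp]: "(\<And>i. i \<in> S \<Longrightarrow> f i \<in> A) \<Longrightarrow> sum f S \<in> A"
  by (induction S rule: infinite_finite_induct) auto

lemma prod_mem [simp]: "(\<And>i. i \<in> S \<Longrightarrow> f i \<in> A) \<Longrightarrow> prod f S \<in> A"
  by (induction S rule: infinite_finite_induct) auto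

lemma power_mem [simp]: "a \<in> A \<Longrightarrow> a ^ k \<in> A"
  by (induction k) auto

lemma cring: "cring (subring_of A)"
proof (rule cringI)
  show "abelian_group (subring_of A)"
  proof (rule abelian_groupI)
    fix x assume "x \<in> carrier (subring_of A)"
    then show "\<exists>y\<in>carrier (subring_of A). y \<oplus>\<^bsub>subring_of A\<^esub> x = \<zero>\<^bsub>subring_of A\<^esub>"
      by (intro bexI[of _ "- x"]) auto
  qed (auto simp: algebra_simps)
  show "comm_monoid (subring_of A)"
    by (rule comm_monoidI) (auto simp: algebra_simps)
qed (auto simp: algebra_simps)

lemma ring: "ring (subring_of A)"
  by (rule cring.axioms(1)[OF cring])

lemma ideal_iff:
  "ideal I (subring_of A) \<longleftrightarrow>
     I \<subseteq> A \<and> 0 \<in> I \<and> (\<forall>a\<in>I. \<forall>b\<in>I. a + b \<in> I) \<and> (\<forall>a\<in>A. \<forall>b\<in>I. a * b \<in> I)" (is "_ \<longleftrightarrow> ?rhs")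
proof
  assume I: "ideal I (subring_of A)"
  interpret ideal I "subring_of A" by fact
  show ?rhs
    using a_subset additive_subgroup.zero_closed[OF additive_subgroup_axioms]
      additive_subgroup.a_closed[OF additive_subgroup_axioms] I_l_closed
    by simp
next
  assume r: ?rhs
  have neg: "- a \<in> I" if "a \<in> I" for a
  proof -
    have "(-1) * a \<in> I"
      using r that uminus_mem[OF one_mem] by blast
    then show ?thesis by simp
  qed
  have inv: "inv\<^bsub>add_monoid (subring_of A)\<^esub> a = - a" if "a \<in> A" for a
  proof -
    interpret cring "subring_of A" by (rule cring)
    have "\<ominus>\<^bsub>subring_of A\<^esub> a = - a"
      by (rule minus_equality) (use that in auto)
    then show ?thesis by (simp add: a_inv_def)
  qed
  show "ideal I (subring_of A)"
  proof (rule idealI[OF ring])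
    show "subgroup I (add_monoid (subring_of A))"
    proof (rule group.subgroupI)
      show "Group.group (add_monoid (subring_of A))"
        using ring abelian_group.a_group ring.is_abelian_group by blast
    qed (use r neg inv in \<open>auto simp: subset_iff\<close>)
    fix a x assume "a \<in> I" "x \<in> carrier (subring_of A)"
    then show "x \<otimes>\<^bsub>subring_of A\<^esub> a \<in> I" "a \<otimes>\<^bsub>subring_of A\<^esub> x \<in> I"
      using r by (simp_all add: mult.commute[of a])
  qed
qed

lemma idealD:
  assumes "ideal I (subring_of A)"
  shows "I \<subseteq> A" "0 \<in> I" "a \<in> I \<Longrightarrow> b \<in> I \<Longrightarrow> a + b \<in> I" "a \<in> A \<Longrightarrow> b \<in> I \<Longrightarrow> a * b \<in> I"
    "a \<in> A \<Longrightarrow> b \<in> I \<Longrightarrow> b * a \<in> I" "a \<in> I \<Longrightarrow> - a \<in> I" "a \<in> I \<Longrightarrow> b \<in> I \<Longrightarrow> a - b \<in> I"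
proof -
  show 1: "I \<subseteq> A" "0 \<in> I" "\<And>a b. a \<in> I \<Longrightarrow> b \<in> I \<Longrightarrow> a + b \<in> I"
    "\<And>a b. a \<in> A \<Longrightarrow> b \<in> I \<Longrightarrow> a * b \<in> I"
    using assms[unfolded ideal_iff] by simp_all
  show "a \<in> A \<Longrightarrow> b \<in> I \<Longrightarrow> b * a \<in> I"
    by (subst mult.commute) (rule 1(4))
  have neg: "- a \<in> I" if "a \<in> I" for a
    using 1(4)[OF uminus_mem[OF one_mem] that] by simp
  then show "a \<in> I \<Longrightarrow> - a \<in> I" .
  show "a - b \<in> I" if "a \<in> I" "b \<in> I"
    using 1(3)[OF that(1) neg[OF that(2)]] by simp
qed

lemma ideal_sum:
  assumes "ideal I (subring_of A)" "\<And>i. i \<in> S \<Longrightarrow> f i \<in> I"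
  shows "sum f S \<in> I"
  using assms(2) by (induction S rule: infinite_finite_induct) (auto intro: idealD[OF assms(1)])

text \<open>Used modulo primes that contain all products but one, where a vanishing sum isolates a
  single term.\<close>

lemma ideal_sum_diff:
  assumes I: "ideal I (subring_of A)" and "finite S" "s \<in> S"
    and "sum f S \<in> I" "\<And>i. i \<in> S \<Longrightarrow> i \<noteq> s \<Longrightarrow> f i \<in> I"
  shows "f s \<in> I"
proof -
  have "f s = sum f S - sum f (S - {s})"
    using assms(2,3) by (simp add: sum.remove)
  also have "\<dots> \<in> I"
    by (intro idealD(7)[OF I] assms(4) ideal_sum[OF I]) (use assms(5) in auto)
  finally show ?thesis .
qed

lemma ideal_eq_iff_one_mem: "ideal I (subring_of A) \<Longrightarrow> I = A \<longleftrightarrow> 1 \<in> I"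
  using idealD(1,5)[of I] by (metis mult_1 one_mem subset_antisym subsetI)

lemma primeideal_iff:
  "primeideal I (subring_of A) \<longleftrightarrow>
     ideal I (subring_of A) \<and> 1 \<notin> I \<and> (\<forall>a\<in>A. \<forall>b\<in>A. a * b \<in> I \<longrightarrow> a \<in> I \<or> b \<in> I)"
proof
  assume "primeideal I (subring_of A)"
  then interpret primeideal I "subring_of A" .
  show "ideal I (subring_of A) \<and> 1 \<notin> I \<and> (\<forall>a\<in>A. \<forall>b\<in>A. a * b \<in> I \<longrightarrow> a \<in> I \<or> b \<in> I)"
    using is_ideal I_notcarr I_prime ideal_eq_iff_one_mem[OF is_ideal] by auto
next
  assume r: "ideal I (subring_of A) \<and> 1 \<notin> I \<and> (\<forall>a\<in>A. \<forall>b\<in>A. a * b \<in> I \<longrightarrow> a \<in> I \<or> b \<in> I)"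
  show "primeideal I (subring_of A)"
    by (rule primeidealI) (use r cring ideal_eq_iff_one_mem in auto)
qed

lemma Idl_ideal: "S \<subseteq> A \<Longrightarrow> ideal (Idl\<^bsub>subring_of A\<^esub> S) (subring_of A)"
  using ring.genideal_ideal[OF ring] by simp

lemma Idl_incl: "S \<subseteq> A \<Longrightarrow> s \<in> S \<Longrightarrow> s \<in> Idl\<^bsub>subring_of A\<^esub> S"
  using ring.genideal_self[OF ring] by auto

lemma Idl_minimal: "ideal I (subring_of A) \<Longrightarrow> S \<subseteq> I \<Longrightarrow> Idl\<^bsub>subring_of A\<^esub> S \<subseteq> I"
  using ring.genideal_minimal[OF ring] by simp

lemma Idl_mono: "T \<subseteq> A \<Longrightarrow> S \<subseteq> T \<Longrightarrow> Idl\<^bsub>subring_of A\<^esub> S \<subseteq> Idl\<^bsub>subring_of A\<^esub> T"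
  by (intro Idl_minimal Idl_ideal) (auto intro: Idl_incl)

lemma Idl_empty: "Idl\<^bsub>subring_of A\<^esub> {} = {0}"
proof
  show "Idl\<^bsub>subring_of A\<^esub> {} \<subseteq> {0}"
    by (intro Idl_minimal) (auto simp: ideal_iff)
  show "{0} \<subseteq> Idl\<^bsub>subring_of A\<^esub> {}"
    using idealD(2)[OF Idl_ideal[of "{}"]] by simp
qed

lemma Idl_image_eq:
  assumes "finite J" "\<And>j. j \<in> J \<Longrightarrow> h j \<in> A"
  shows "Idl\<^bsub>subring_of A\<^esub> (h ` J) = {\<Sum>j\<in>J. a j * h j | a. \<forall>j\<in>J. a j \<in> A}" (is "_ = ?I")
proof
  have "ideal ?I (subring_of A)"
    unfolding ideal_iff
  proof (intro conjI ballI)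
    show "?I \<subseteq> A" using assms(2) by auto
    show "0 \<in> ?I" by (auto intro!: exI[of _ "\<lambda>_. 0"])
    fix x y assume "x \<in> ?I" "y \<in> ?I"
    then obtain a b where "x = (\<Sum>j\<in>J. a j * h j)" "\<forall>j\<in>J. a j \<in> A" "y = (\<Sum>j\<in>J. b j * h j)" "\<forall>j\<in>J. b j \<in> A"
      by auto
    then show "x + y \<in> ?I"
      by (auto intro!: exI[of _ "\<lambda>j. a j + b j"] simp: sum.distrib algebra_simps)
  next
    fix c y assume "c \<in> A" "y \<in> ?I"
    then obtain b where "y = (\<Sum>j\<in>J. b j * h j)" "\<forall>j\<in>J. b j \<in> A"
      by auto
    then show "c * y \<in> ?I" using \<open>c \<in> A\<close>
      by (auto intro!: exI[of _ "\<lambda>j. c * b j"] simp: sum_distrib_left algebra_simps)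
  qed
  moreover have "h ` J \<subseteq> ?I"
  proof (intro image_subsetI)
    fix j assume j: "j \<in> J"
    have "h j = (\<Sum>i\<in>J. (if i = j then 1 else 0) * h i)"
      using j \<open>finite J\<close> by (simp add: if_distrib[of "\<lambda>c. c * _"] cong: if_cong)
    then show "h j \<in> ?I"
      by (force intro: exI[of _ "\<lambda>i. if i = j then 1 else 0"])
  qed
  ultimately show "Idl\<^bsub>subring_of A\<^esub> (h ` J) \<subseteq> ?I" by (rule Idl_minimal)
  have hJ: "h ` J \<subseteq> A" using assms(2) by auto
  note I = Idl_ideal[OF hJ]
  show "?I \<subseteq> Idl\<^bsub>subring_of A\<^esub> (h ` J)"
    by (clarify, intro ideal_sum[OF I] idealD(4)[OF I]) (auto intro: Idl_incl[OF hJ])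
qed

lemma Idl_insertE:
  assumes "S \<subseteq> A" "g \<in> A" "f \<in> Idl\<^bsub>subring_of A\<^esub> (insert g S)"
  obtains a where "a \<in> A" "f - g * a \<in> Idl\<^bsub>subring_of A\<^esub> S"
proof -
  let ?I = "{f \<in> A. \<exists>a\<in>A. f - g * a \<in> Idl\<^bsub>subring_of A\<^esub> S}"
  note S = Idl_ideal[OF assms(1)]
  have "ideal ?I (subring_of A)"
    unfolding ideal_iff
  proof (intro conjI ballI)
    show "0 \<in> ?I" using idealD(2)[OF S] by (auto intro!: bexI[of _ 0])
    fix x y assume "x \<in> ?I" "y \<in> ?I"
    then obtain a b where ab: "x \<in> A" "y \<in> A" "a \<in> A" "b \<in> A"
      "x - g * a \<in> Idl\<^bsub>subring_of A\<^esub> S" "y - g * b \<in> Idl\<^bsub>subring_of A\<^esub> S" by auto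
    from idealD(3)[OF S ab(5,6)] have "(x + y) - g * (a + b) \<in> Idl\<^bsub>subring_of A\<^esub> S"
      by (simp add: algebra_simps)
    then show "x + y \<in> ?I" using ab by (auto intro!: bexI[of _ "a + b"])
  next
    fix c y assume "c \<in> A" "y \<in> ?I"
    then obtain b where ab: "y \<in> A" "b \<in> A" "y - g * b \<in> Idl\<^bsub>subring_of A\<^esub> S" by auto
    from idealD(4)[OF S \<open>c \<in> A\<close> ab(3)] have "(c * y) - g * (c * b) \<in> Idl\<^bsub>subring_of A\<^esub> S"
      by (simp add: algebra_simps)
    then show "c * y \<in> ?I" using ab \<open>c \<in> A\<close> by (auto intro!: bexI[of _ "c * b"])
  qed auto
  moreover have "insert g S \<subseteq> ?I"
    using assms(1,2) idealD(2)[OF S] Idl_incl[OF assms(1)] 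
    by (auto intro: bexI[of _ 1] bexI[of _ 0])
  ultimately have "Idl\<^bsub>subring_of A\<^esub> (insert g S) \<subseteq> ?I" by (rule Idl_minimal)
  then show thesis using assms(3) that by blast
qed

end

section \<open>Ring homomorphisms and their kernels\<close>

locale rhom =
  fixes \<phi> :: "'a::comm_ring_1 \<Rightarrow> 'b::comm_ring_1"
  assumes one [simp]: "\<phi> 1 = 1"
    and add [simp]: "\<phi> (a + b) = \<phi> a + \<phi> b"
    and mult [simp]: "\<phi> (a * b) = \<phi> a * \<phi> b"
begin

lemma zero [simp]: "\<phi> 0 = 0"
  using add[of 0 0] by simp

lemma uminus [simp]: "\<phi> (- a) = - \<phi> a"
  using add[of a "- a"] by (simp add: add_eq_0_iff)

lemma diff [simp]: "\<phi> (a - b) = \<phi> a - \<phi> b"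
  using add[of a "- b"] by simp

lemma sum: "\<phi> (sum f S) = (\<Sum>i\<in>S. \<phi> (f i))"
  by (induction S rule: infinite_finite_induct) auto

lemma prod: "\<phi> (prod f S) = (\<Prod>i\<in>S. \<phi> (f i))"
  by (induction S rule: infinite_finite_induct) auto

lemma power: "\<phi> (a ^ k) = \<phi> a ^ k"
  by (induction k) auto

lemma kernel_ideal:
  assumes "type_subring A"
  shows "ideal {a \<in> A. \<phi> a = 0} (subring_of A)"
  using assms by (simp add: type_subring.ideal_iff type_subring.add_mem type_subring.mult_mem type_subring.zero_mem)

end

lemma rhom_id: "rhom (\<lambda>x. x)" by standard auto

lemma rhom_comp: "rhom f \<Longrightarrow> rhom g \<Longrightarrow> rhom (\<lambda>x. f (g x))"
  by (simp add: rhom_def)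

section \<open>Evaluation of polynomials\<close>

definition const :: "'a::comm_ring_1 \<Rightarrow> 'a mpoly" where
  "const a = Poly_Mapping.single 0 a"

text \<open>With \<open>\<phi>\<close> the inclusion of constants into the polynomials in \<tau>
  this is the Rees map, with \<open>\<phi> = const\<close> a substitution of variables, with the
  identity the value at a point.\<close>

definition geval :: "('a::comm_ring_1 \<Rightarrow> 'b::comm_ring_1) \<Rightarrow> (nat \<Rightarrow> 'b) \<Rightarrow> 'a mpoly \<Rightarrow> 'b" where
  "geval \<phi> x P = (\<Sum>m\<in>Poly_Mapping.keys P. \<phi> (Poly_Mapping.lookup P m) *
     (\<Prod>i\<in>Poly_Mapping.keys m. x i ^ Poly_Mapping.lookup m i))"

lemma rhom_const: "rhom const"
  by standard (auto simp: const_def single_add mult_single)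

lemma mpoly_monomials: "P = (\<Sum>m\<in>Poly_Mapping.keys P. Poly_Mapping.single m (Poly_Mapping.lookup P m))"
  by (rule poly_mapping_eqI)
    (auto simp: lookup_sum lookup_single when_def in_keys_iff)

lemma mpoly_add_induct:
  assumes "\<And>m a. Q (Poly_Mapping.single m a)" "\<And>P P'. Q P \<Longrightarrow> Q P' \<Longrightarrow> Q (P + P')"
  shows "Q (P :: 'a::comm_ring_1 mpoly)"
proof -
  have "finite S \<Longrightarrow> Q (\<Sum>m\<in>S. Poly_Mapping.single m (Poly_Mapping.lookup P m))" for S
    by (induction S rule: finite_induct) (use assms(1)[of 0 0] in \<open>auto intro: assms\<close>)
  from this[of "Poly_Mapping.keys P"] show ?thesis
    using mpoly_monomials[of P] by simp
qed

lemma monomial_value_add: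
  fixes x :: "nat \<Rightarrow> 'b::comm_ring_1"
  shows "(\<Prod>i\<in>Poly_Mapping.keys (m + m'). x i ^ Poly_Mapping.lookup (m + m') i) =
    (\<Prod>i\<in>Poly_Mapping.keys m. x i ^ Poly_Mapping.lookup m i) *
    (\<Prod>i\<in>Poly_Mapping.keys m'. x i ^ Poly_Mapping.lookup m' i)"
proof -
  let ?S = "Poly_Mapping.keys m \<union> Poly_Mapping.keys m'"
  have *: "(\<Prod>i\<in>Poly_Mapping.keys n. x i ^ Poly_Mapping.lookup n i) = (\<Prod>i\<in>?S. x i ^ Poly_Mapping.lookup n i)"
    if "Poly_Mapping.keys n \<subseteq> ?S" for n
    by (rule prod.mono_neutral_left) (use that in \<open>auto simp: in_keys_iff\<close>)
  show ?thesis
    by (subst (1 2 3) *) (use keys_add[of m m'] in \<open>auto simp: prod.distrib[symmetric] lookup_add power_add\<close>)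
qed

context rhom
begin

lemma geval_superset:
  "finite S \<Longrightarrow> Poly_Mapping.keys P \<subseteq> S \<Longrightarrow> geval \<phi> x P = (\<Sum>m\<in>S. \<phi> (Poly_Mapping.lookup P m) *
     (\<Prod>i\<in>Poly_Mapping.keys m. x i ^ Poly_Mapping.lookup m i))"
  unfolding geval_def by (rule sum.mono_neutral_left) (auto simp: in_keys_iff)

lemma geval_single:
  "geval \<phi> x (Poly_Mapping.single m a) = \<phi> a * (\<Prod>i\<in>Poly_Mapping.keys m. x i ^ Poly_Mapping.lookup m i)"
  by (subst geval_superset[of "{m}"]) auto

lemma geval_const [simp]: "geval \<phi> x (const a) = \<phi> a"
  by (simp add: const_def geval_single)

lemma geval_mvar [simp]: "geval \<phi> x (mvar i) = x i"
  by (simp add: mvar_def geval_single)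

lemma geval_add: "geval \<phi> x (P + Q) = geval \<phi> x P + geval \<phi> x Q"
proof -
  let ?S = "Poly_Mapping.keys P \<union> Poly_Mapping.keys Q"
  show ?thesis
    by (subst (1 2 3) geval_superset[of ?S])
      (use keys_add[of P Q] in \<open>auto simp: lookup_add sum.distrib distrib_right\<close>)
qed

lemma geval_mult: "geval \<phi> x (P * Q) = geval \<phi> x P * geval \<phi> x Q"
proof (induction P rule: mpoly_add_induct)
  case (1 m a)
  show ?case
  proof (induction Q rule: mpoly_add_induct)
    case (1 m' a')
    show ?case
      by (simp only: mult_single geval_single monomial_value_add mult mult_ac)
  qed (simp add: geval_add distrib_left)
qed (simp add: geval_add distrib_right)

lemma rhom_geval: "rhom (geval \<phi> x)"
proof
  show "geval \<phi> x 1 = 1"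
    using geval_const[of x 1] by (simp add: const_def)
qed (auto simp: geval_add geval_mult)

lemma comp_geval:
  assumes "rhom \<psi>"
  shows "\<psi> (geval \<phi> x P) = geval (\<lambda>a. \<psi> (\<phi> a)) (\<lambda>i. \<psi> (x i)) P"
  unfolding geval_def by (simp add: rhom.sum[OF assms] rhom.mult[OF assms] rhom.prod[OF assms] rhom.power[OF assms])

end

lemma rhom_pconst: "rhom (\<lambda>a. [:a:])"
  by standard auto

lemma rees_map_eq_geval: "rees_map gs = geval (\<lambda>a. [:a:]) (\<lambda>i. [:0, gs ! i:])"
  by (rule ext) (simp add: rees_map_def geval_def)

lemma single_eq_const_prod:
  "Poly_Mapping.single m a = const a * (\<Prod>i\<in>Poly_Mapping.keys m. mvar i ^ Poly_Mapping.lookup m i)"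
proof -
  have 1: "mvar i ^ k = Poly_Mapping.single (Poly_Mapping.single i k) (1::'a)" for i k
    by (induction k) (auto simp: mvar_def mult_single single_add[symmetric])
  have 2: "(\<Prod>i\<in>S. Poly_Mapping.single (e i) (1::'a)) = Poly_Mapping.single (sum e S) 1"
    if "finite S" for S and e :: "nat \<Rightarrow> nat \<Rightarrow>\<^sub>0 nat"
    using that by (induction S rule: finite_induct) (auto simp: mult_single)
  have 3: "m = (\<Sum>i\<in>Poly_Mapping.keys m. Poly_Mapping.single i (Poly_Mapping.lookup m i))"
    by (rule poly_mapping_eqI) (auto simp: lookup_sum lookup_single when_def in_keys_iff)
  have "(\<Prod>i\<in>Poly_Mapping.keys m. mvar i ^ Poly_Mapping.lookup m i) = Poly_Mapping.single m (1::'a)"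
    unfolding 1 by (subst 2) (use 3 in auto)
  then show ?thesis by (simp add: const_def mult_single)
qed

lemma type_subring_UNIV [simp]: "type_subring UNIV"
  by standard auto

context type_subring
begin

lemma single_mem_mpolys:
  "a \<in> A \<Longrightarrow> Poly_Mapping.keys m \<subseteq> {..<n} \<Longrightarrow> Poly_Mapping.single m a \<in> mpolys A n"
  by (auto simp: mpolys_def lookup_single when_def)

lemma type_subring_mpolys: "type_subring (mpolys A n)"
proof
  show "1 \<in> mpolys A n"
    using single_mem_mpolys[of 1 0 n] by simp
  fix P Q assume P: "P \<in> mpolys A n" and Q: "Q \<in> mpolys A n"
  show "P + Q \<in> mpolys A n"
    using P Q keys_add[of P Q] by (fastforce simp: mpolys_def lookup_add)
  show "- P \<in> mpolys A n"
    using P by (auto simp: mpolys_def in_keys_iff)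
  have add: "(\<Sum>k\<in>K. f k) \<in> mpolys A n" if "\<And>k. k \<in> K \<Longrightarrow> f k \<in> mpolys A n" for K and f :: "'k \<Rightarrow> _"
    using that
  proof (induction K rule: infinite_finite_induct)
    case (insert k K)
    then have "f k \<in> mpolys A n" "sum f K \<in> mpolys A n" by auto
    then show ?case using insert(1,2) keys_add[of "f k" "sum f K"] by (fastforce simp: mpolys_def lookup_add)
  qed (auto simp: mpolys_def)
  have "P * Q = (\<Sum>m\<in>Poly_Mapping.keys P. \<Sum>m'\<in>Poly_Mapping.keys Q.
      Poly_Mapping.single (m + m') (Poly_Mapping.lookup P m * Poly_Mapping.lookup Q m'))"
    by (subst mpoly_monomials[of P], subst mpoly_monomials[of Q]) (simp add: sum_product mult_single)
  also have "\<dots> \<in> mpolys A n"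
    using P Q by (intro add single_mem_mpolys) (auto simp: mpolys_def dest!: subsetD[OF keys_add])
  finally show "P * Q \<in> mpolys A n" .
qed

lemma const_mem_mpolys [simp]: "a \<in> A \<Longrightarrow> const a \<in> mpolys A n"
  unfolding const_def by (rule single_mem_mpolys) auto

lemma mvar_mem_mpolys [simp]: "i < n \<Longrightarrow> mvar i \<in> mpolys A n"
  unfolding mvar_def by (rule single_mem_mpolys) auto

text \<open>Constants and variables generate the polynomial ring, so closure properties and
  congruences need to be checked on these only.\<close>

lemma mpolys_induct [consumes 1, case_names const mvar add mult]:
  assumes "P \<in> mpolys A n" "\<And>a. a \<in> A \<Longrightarrow> Q (const a)" "\<And>i. i < n \<Longrightarrow> Q (mvar i)"
    "\<And>P P'. P \<in> mpolys A n \<Longrightarrow> P' \<in> mpolys A n \<Longrightarrow> Q P \<Longrightarrow> Q P' \<Longrightarrow> Q (P + P')"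
    "\<And>P P'. P \<in> mpolys A n \<Longrightarrow> P' \<in> mpolys A n \<Longrightarrow> Q P \<Longrightarrow> Q P' \<Longrightarrow> Q (P * P')"
  shows "Q P"
proof -
  interpret M: type_subring "mpolys A n" by (rule type_subring_mpolys)
  have const1: "const 1 = (1 :: 'a mpoly)" "const 0 = (0 :: 'a mpoly)" by (auto simp: const_def)
  have Q01: "Q 1" "Q 0" using assms(2)[of 1] assms(2)[of 0] by (simp_all add: const1)
  have pow: "Q (mvar i ^ k)" if "i < n" for i k
    using that Q01(1) assms(3,5) by (induction k) auto
  have prd: "Q (\<Prod>i\<in>S. mvar i ^ e i)" if "S \<subseteq> {..<n}" for S e
    using finite_subset[OF that finite_lessThan] that
    by (induction S rule: finite_induct) (auto intro!: assms(5) pow Q01 M.prod_mem M.power_mem)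
  have mono: "Q (Poly_Mapping.single m a)" if "a \<in> A" "Poly_Mapping.keys m \<subseteq> {..<n}" for m a
    unfolding single_eq_const_prod using that by (intro assms(5) prd assms(2)) (auto intro!: M.prod_mem M.power_mem)
  have "Q (\<Sum>m\<in>S. Poly_Mapping.single m (Poly_Mapping.lookup P m))" if "S \<subseteq> Poly_Mapping.keys P" for S
    using finite_subset[OF that finite_keys] that
  proof (induction S rule: finite_induct)
    case (insert m S)
    have "Poly_Mapping.lookup P m \<in> A" "Poly_Mapping.keys m \<subseteq> {..<n}"
      "\<forall>m\<in>S. Poly_Mapping.lookup P m \<in> A \<and> Poly_Mapping.keys m \<subseteq> {..<n}"
      using assms(1) insert by (auto simp: mpolys_def)
    then show ?case
      using insert by (auto intro!: assms(4) mono M.sum_mem single_mem_mpolys)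
  qed (simp add: Q01)
  from this[of "Poly_Mapping.keys P"] show ?thesis using mpoly_monomials[of P] by simp
qed

lemma geval_mem:
  assumes "type_subring B" "rhom \<phi>" "P \<in> mpolys A n" "\<And>a. a \<in> A \<Longrightarrow> \<phi> a \<in> B" "\<And>i. i < n \<Longrightarrow> x i \<in> B"
  shows "geval \<phi> x P \<in> B"
  using assms(3)
  by (induction rule: mpolys_induct)
    (simp_all add: assms(4,5) rhom.geval_const[OF assms(2)] rhom.geval_mvar[OF assms(2)]
      rhom.geval_add[OF assms(2)] rhom.geval_mult[OF assms(2)]
      type_subring.add_mem[OF assms(1)] type_subring.mult_mem[OF assms(1)])

end

section \<open>Linear forms\<close>

lemma homogeneous_add: "homogeneous d P \<Longrightarrow> homogeneous d Q \<Longrightarrow> homogeneous d (P + Q)"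
  using keys_add[of P Q] by (auto simp: homogeneous_def)

lemma homogeneous_uminus: "homogeneous d (P :: 'a::comm_ring_1 mpoly) \<Longrightarrow> homogeneous d (- P)"
  by (auto simp: homogeneous_def in_keys_iff)

lemma homogeneous_sum: "(\<And>i. i \<in> S \<Longrightarrow> homogeneous d (f i)) \<Longrightarrow> homogeneous d (sum f S)"
proof (induction S rule: infinite_finite_induct)
  case (insert i S)
  then show ?case using homogeneous_add[of d "f i" "sum f S"] by simp
qed (auto simp: homogeneous_def)

lemma const_mult_mvar: "const a * mvar i = Poly_Mapping.single (Poly_Mapping.single i 1) a"
  by (simp add: const_def mvar_def mult_single)

lemma homogeneous_const_mult_mvar: "homogeneous 1 (const a * mvar i)"
  by (simp add: const_mult_mvar homogeneous_def)

lemma exponent_of_degree_1: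
  assumes "(\<Sum>i\<in>Poly_Mapping.keys m. Poly_Mapping.lookup m i) = (1::nat)"
  shows "\<exists>i. m = Poly_Mapping.single i 1"
proof -
  from assms obtain i where i: "i \<in> Poly_Mapping.keys m"
    by fastforce
  have "Poly_Mapping.lookup m i + (\<Sum>j\<in>Poly_Mapping.keys m - {i}. Poly_Mapping.lookup m j) = 1"
    using assms i by (simp add: sum.remove[symmetric])
  moreover have "Poly_Mapping.lookup m i > 0"
    using i by (simp add: in_keys_iff)
  ultimately have "Poly_Mapping.lookup m i = 1"
    and "(\<Sum>j\<in>Poly_Mapping.keys m - {i}. Poly_Mapping.lookup m j) = 0"
    by linarith+
  then have "Poly_Mapping.lookup m j = (if j = i then 1 else 0)" for j
    by (auto simp: in_keys_iff)
  then have "m = Poly_Mapping.single i 1"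
    by (intro poly_mapping_eqI) (auto simp: lookup_single when_def)
  then show ?thesis ..
qed

lemma linear_form_expansion:
  assumes "P \<in> mpolys A n" "homogeneous 1 P"
  shows "P = (\<Sum>i<n. const (Poly_Mapping.lookup P (Poly_Mapping.single i 1)) * mvar i)" (is "_ = ?R")
proof (rule poly_mapping_eqI)
  fix m
  have R: "Poly_Mapping.lookup ?R m =
      (\<Sum>i<n. if Poly_Mapping.single i 1 = m then Poly_Mapping.lookup P m else 0)"
    unfolding const_mult_mvar lookup_sum lookup_single when_def by (rule sum.cong) auto
  show "Poly_Mapping.lookup P m = Poly_Mapping.lookup ?R m"
  proof (cases "m \<in> Poly_Mapping.keys P")
    case True
    then obtain i where m: "m = Poly_Mapping.single i 1"
      using assms(2) exponent_of_degree_1 by (auto simp: homogeneous_def)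
    have "i < n" using True assms(1) m by (auto simp: mpolys_def)
    have "(Poly_Mapping.single j (1::nat) = m) = (j = i)" for j
      unfolding m by (metis keys_single one_neq_zero singleton_inject)
    then show ?thesis using \<open>i < n\<close> unfolding R by simp
  next
    case False
    then show ?thesis unfolding R by (simp add: in_keys_iff sum.neutral)
  qed
qed

section \<open>The vector space of linear forms\<close>

definition linear_forms :: "nat \<Rightarrow> 'k::field mpoly set" where
  "linear_forms n = {f \<in> mpolys UNIV n. homogeneous 1 f}"

interpretation mp: type_subring "mpolys UNIV n" for n
  by (rule type_subring.type_subring_mpolys) simp

interpretation rc: rhom const by (rule rhom_const)

lemma const_mem [simp]: "const a \<in> mpolys UNIV n"
  by (rule type_subring.const_mem_mpolys) auto

lemma mvar_mem [simp]: "i < n \<Longrightarrow> mvar i \<in> mpolys UNIV n"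
  by (rule type_subring.mvar_mem_mpolys) auto

text \<open>Scalars act through constant polynomials on all polynomials, so that span, dependence
  and exchange arguments apply to linear forms.\<close>

global_interpretation vs: vector_space "\<lambda>(a::'k::field) (P::'k mpoly). const a * P"
  defines vspan = vs.span and vdependent = vs.dependent
  by standard (auto simp: algebra_simps)

lemma linear_forms_subset: "linear_forms n \<subseteq> mpolys UNIV n"
  by (auto simp: linear_forms_def)

lemma linear_form_eq:
  "f \<in> linear_forms n \<Longrightarrow>
     f = (\<Sum>i<n. const (Poly_Mapping.lookup f (Poly_Mapping.single i 1)) * mvar i)"
  using linear_form_expansion by (auto simp: linear_forms_def)

lemma linear_formsI: "(\<Sum>i<n. const (a i) * mvar i) \<in> linear_forms n"
  unfolding linear_forms_def
  by (intro CollectI conjI mp.sum_mem mp.mult_mem homogeneous_sum homogeneous_const_mult_mvar) auto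

lemma linear_forms_eq: "linear_forms n = {\<Sum>i<n. const (a i) * mvar i | a. True}"
  using linear_formsI by (auto dest: linear_form_eq)

lemma subspace_linear_forms: "vs.subspace (linear_forms n)"
proof (rule vs.subspaceI)
  show "0 \<in> linear_forms n" using linear_formsI[of "\<lambda>_. 0" n] by simp
  fix f g :: "'a mpoly" assume "f \<in> linear_forms n" "g \<in> linear_forms n"
  then obtain a b where "f = (\<Sum>i<n. const (a i) * mvar i)" "g = (\<Sum>i<n. const (b i) * mvar i)"
    unfolding linear_forms_eq by blast
  then have "f + g = (\<Sum>i<n. const (a i + b i) * mvar i)"
    by (simp add: sum.distrib algebra_simps)
  then show "f + g \<in> linear_forms n" using linear_formsI by metis
next
  fix c and f :: "'a mpoly" assume "f \<in> linear_forms n"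
  then obtain a where "f = (\<Sum>i<n. const (a i) * mvar i)"
    by (auto simp: linear_forms_eq)
  then have "const c * f = (\<Sum>i<n. const (c * a i) * mvar i)"
    by (simp add: sum_distrib_left algebra_simps)
  then show "const c * f \<in> linear_forms n" using linear_formsI by metis
qed

lemma mvar_linear_form: "i < n \<Longrightarrow> mvar i \<in> linear_forms n"
  using linear_formsI[of "\<lambda>j. if j = i then 1 else 0" n] by (simp add: if_distrib[of const] if_distrib[of "\<lambda>c. c * _"] cong: if_cong)

lemma linear_forms_span_mvars: "linear_forms n \<subseteq> vspan (mvar ` {..<n})"
proof
  fix f :: "'a mpoly" assume "f \<in> linear_forms n"
  then show "f \<in> vspan (mvar ` {..<n})"
    by (subst linear_form_eq) (auto intro: vs.span_sum vs.span_scale vs.span_base)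
qed

lemma span_subset_Idl:
  assumes "S \<subseteq> mpolys UNIV n"
  shows "vspan S \<subseteq> Idl\<^bsub>mpoly_ring UNIV n\<^esub> S"
proof (rule vs.span_minimal)
  note I = mp.Idl_ideal[OF assms]
  show "vs.subspace (Idl\<^bsub>mpoly_ring UNIV n\<^esub> S)"
    by (rule vs.subspaceI) (auto intro: mp.idealD(2,3,4)[OF I])
qed (auto intro: mp.Idl_incl[OF assms])

text \<open>Solve \<open>s = 0\<close> for a variable \<open>mvar k\<close> that occurs in
  \<open>s\<close> and substitute the solution. Two error estimates are kept: a multiple of
  \<open>s\<close> for polynomials, to control ideals, and a scalar multiple of \<open>s\<close> for
  linear forms, to control spans.\<close>

lemma linear_substitution:
  fixes s :: "'k::field mpoly"
  assumes s: "s \<in> linear_forms n" "s \<noteq> 0"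
  obtains \<sigma> where "rhom \<sigma>" "\<And>f. f \<in> mpolys UNIV n \<Longrightarrow> \<exists>g\<in>mpolys UNIV n. f - \<sigma> f = s * g"
    "\<And>f. f \<in> linear_forms n \<Longrightarrow> \<exists>b. f - \<sigma> f = const b * s" "\<sigma> s = 0"
proof -
  define co where "co f k = Poly_Mapping.lookup f (Poly_Mapping.single k 1)" for f :: "'k mpoly" and k :: nat
  have "\<exists>k<n. co s k \<noteq> 0"
  proof (rule ccontr)
    assume "\<not> (\<exists>k<n. co s k \<noteq> 0)"
    then have "s = 0" using linear_form_eq[OF s(1)] by (simp add: co_def)
    then show False using s(2) by simp
  qed
  then obtain k where k: "k < n" "co s k \<noteq> 0" by blast
  define x where "x i = (if i = k then mvar k - const (1 / co s k) * s else mvar i)" for i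
  let ?\<sigma> = "geval const x"
  interpret \<sigma>: rhom ?\<sigma> by (rule rc.rhom_geval)
  have lin: "f - ?\<sigma> f = const (co f k / co s k) * s" if "f \<in> linear_forms n" for f
  proof -
    have f: "f = (\<Sum>i<n. const (co f i) * mvar i)"
      using linear_form_eq[OF that] by (simp add: co_def)
    have "f - ?\<sigma> f = (\<Sum>i<n. const (co f i) * (mvar i - x i))"
      by (subst (1 2) f) (simp add: \<sigma>.sum sum_subtractf algebra_simps)
    also have "\<dots> = (\<Sum>i<n. if i = k then const (co f i) * (const (1 / co s k) * s) else 0)"
      by (intro sum.cong) (auto simp: x_def)
    also have "\<dots> = const (co f k / co s k) * s"
      using k(1) by (simp flip: rc.mult mult.assoc)
    finally show ?thesis .
  qed
  have "f \<in> mpolys UNIV n \<Longrightarrow> \<exists>g\<in>mpolys UNIV n. f - ?\<sigma> f = s * g" for f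
  proof (induction rule: type_subring.mpolys_induct[OF type_subring_UNIV, consumes 1, case_names const mvar add mult])
    case (const a) then show ?case by (auto intro: bexI[of _ 0])
  next
    case (mvar i)
    then show ?case
      using lin[OF mvar_linear_form[OF mvar]] by (auto intro!: bexI[of _ "const (co (mvar i) k / co s k)"] simp: mult.commute)
  next
    case (add P P')
    then obtain g g' where "g\<in>mpolys UNIV n" "P - ?\<sigma> P = s * g" "g'\<in>mpolys UNIV n" "P' - ?\<sigma> P' = s * g'"
      by auto
    then show ?case by (auto intro!: bexI[of _ "g + g'"] simp: algebra_simps)
  next
    case (mult P P')
    then obtain g g' where g: "g\<in>mpolys UNIV n" "P - ?\<sigma> P = s * g" "g'\<in>mpolys UNIV n" "P' - ?\<sigma> P' = s * g'"
      by auto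
    have "P * P' - ?\<sigma> P * ?\<sigma> P' = (P - ?\<sigma> P) * P' + (P' - ?\<sigma> P') * P - (P - ?\<sigma> P) * (P' - ?\<sigma> P')"
      by (simp add: algebra_simps)
    also have "\<dots> = s * (g * P' + g' * P - g * s * g')"
      unfolding g by (simp add: algebra_simps)
    moreover have "s \<in> mpolys UNIV n" using s linear_forms_subset by blast
    ultimately show ?case using g(1,3) mult(1,2)
      by (auto intro!: bexI[of _ "g * P' + g' * P - g * s * g'"])
  qed
  moreover have "?\<sigma> s = 0"
    using lin[OF s(1)] k by simp
  ultimately show thesis
    using that[of ?\<sigma>] \<sigma>.rhom_axioms lin by blast
qed

text \<open>
  \<open>\<theta>\<close> extends a linear projection with kernel \<open>vspan S\<close> to an endomorphism of the polynomial ring;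
  the kernel of \<open>\<theta>\<close> is then the ideal generated by \<open>S\<close>.
\<close>

lemma exists_retraction:
  fixes S :: "'k::field mpoly set"
  assumes "finite S" "S \<subseteq> linear_forms n"
  shows "\<exists>\<theta>. rhom \<theta> \<and> (\<forall>f\<in>mpolys UNIV n. \<theta> f \<in> mpolys UNIV n \<and> f - \<theta> f \<in> Idl\<^bsub>mpoly_ring UNIV n\<^esub> S) \<and>
    (\<forall>f\<in>linear_forms n. \<theta> f \<in> linear_forms n \<and> f - \<theta> f \<in> vspan S) \<and> (\<forall>s\<in>S. \<theta> s = 0)"
  using assms
proof (induction S rule: finite_induct)
  case empty
  show ?case
    by (intro exI[of _ "\<lambda>x. x"]) (auto simp: rhom_id vs.span_zero mp.Idl_empty)
next
  case (insert s S)
  then obtain \<theta> where \<theta>: "rhom \<theta>" "\<And>f. f \<in> mpolys UNIV n \<Longrightarrow> \<theta> f \<in> mpolys UNIV n"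
    "\<And>f. f \<in> mpolys UNIV n \<Longrightarrow> f - \<theta> f \<in> Idl\<^bsub>mpoly_ring UNIV n\<^esub> S"
    "\<And>f. f \<in> linear_forms n \<Longrightarrow> \<theta> f \<in> linear_forms n"
    "\<And>f. f \<in> linear_forms n \<Longrightarrow> f - \<theta> f \<in> vspan S" "\<And>s. s \<in> S \<Longrightarrow> \<theta> s = 0"
    by auto
  interpret \<theta>: rhom \<theta> by fact
  have s: "s \<in> linear_forms n" "s \<in> mpolys UNIV n" and S: "insert s S \<subseteq> mpolys UNIV n"
    using insert.prems linear_forms_subset by auto
  have mono: "Idl\<^bsub>mpoly_ring UNIV n\<^esub> S \<subseteq> Idl\<^bsub>mpoly_ring UNIV n\<^esub> (insert s S)"
    by (rule mp.Idl_mono) (use S in auto)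
  have vmono: "vspan S \<subseteq> vspan (insert s S)"
    by (rule vs.span_mono) auto
  note I = mp.Idl_ideal[OF S]
  show ?case
  proof (cases "\<theta> s = 0")
    case True
    then show ?thesis using \<theta> mono vmono by (intro exI[of _ \<theta>]) auto
  next
    case False
    \<comment> \<open>The form to be eliminated is \<open>\<theta> s\<close> and not
      \<open>s\<close>: the substitution is applied after \<open>\<theta>\<close>, so the
      composition still kills \<open>S\<close> and now kills \<open>s\<close> as well.\<close>
    obtain \<sigma> where \<sigma>: "rhom \<sigma>" "\<And>f. f \<in> mpolys UNIV n \<Longrightarrow> \<exists>g\<in>mpolys UNIV n. f - \<sigma> f = \<theta> s * g"
      "\<And>f. f \<in> linear_forms n \<Longrightarrow> \<exists>b. f - \<sigma> f = const b * \<theta> s" "\<sigma> (\<theta> s) = 0"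
      by (rule linear_substitution[OF \<theta>(4)[OF s(1)] False]) blast
    interpret \<sigma>: rhom \<sigma> by fact
    have \<theta>s: "\<theta> s = s - (s - \<theta> s)" by simp
    have 1: "\<theta> s \<in> vspan (insert s S)"
      by (subst \<theta>s, rule vs.span_diff) (use \<theta>(5)[OF s(1)] vmono in \<open>auto intro: vs.span_base\<close>)
    have 2: "\<theta> s \<in> Idl\<^bsub>mpoly_ring UNIV n\<^esub> (insert s S)"
      using 1 span_subset_Idl[OF S] by blast
    show ?thesis
    proof (intro exI[of _ "\<lambda>f. \<sigma> (\<theta> f)"] conjI ballI)
      show "rhom (\<lambda>f. \<sigma> (\<theta> f))" using rhom_comp \<sigma>(1) \<theta>(1) by blast
    next
      fix f :: "'k mpoly" assume f: "f \<in> mpolys UNIV n"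
      obtain g where g: "g \<in> mpolys UNIV n" "\<theta> f - \<sigma> (\<theta> f) = \<theta> s * g"
        using \<sigma>(2)[OF \<theta>(2)[OF f]] by blast
      have eq: "\<sigma> (\<theta> f) = \<theta> f - \<theta> s * g" using g(2) by (simp add: algebra_simps)
      show "\<sigma> (\<theta> f) \<in> mpolys UNIV n"
        unfolding eq using \<theta>(2)[OF f] \<theta>(2)[OF s(2)] g(1) by simp
      have "f - \<sigma> (\<theta> f) = (f - \<theta> f) + \<theta> s * g" by (simp add: eq)
      also have "\<dots> \<in> Idl\<^bsub>mpoly_ring UNIV n\<^esub> (insert s S)"
        using \<theta>(3)[OF f] mono by (intro mp.idealD(3)[OF I] mp.idealD(5)[OF I] g 2) auto
      finally show "f - \<sigma> (\<theta> f) \<in> Idl\<^bsub>mpoly_ring UNIV n\<^esub> (insert s S)" .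
    next
      fix f :: "'k mpoly" assume f: "f \<in> linear_forms n"
      obtain b where g: "\<theta> f - \<sigma> (\<theta> f) = const b * \<theta> s"
        using \<sigma>(3)[OF \<theta>(4)[OF f]] by blast
      have eq: "\<sigma> (\<theta> f) = \<theta> f - const b * \<theta> s" using g by (simp add: algebra_simps)
      show "\<sigma> (\<theta> f) \<in> linear_forms n"
        unfolding eq by (intro vs.subspace_diff vs.subspace_scale subspace_linear_forms \<theta>(4) f s)
      have "f - \<sigma> (\<theta> f) = (f - \<theta> f) + const b * \<theta> s" by (simp add: eq)
      also have "\<dots> \<in> vspan (insert s S)"
        using \<theta>(5)[OF f] vmono by (intro vs.span_add vs.span_scale 1) auto
      finally show "f - \<sigma> (\<theta> f) \<in> vspan (insert s S)" .
    next
      fix t assume "t \<in> insert s S"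
      then show "\<sigma> (\<theta> t) = 0" using \<sigma>(4) \<theta>(6) by auto
    qed
  qed
qed

section \<open>Ideals generated by linear forms\<close>

lemma Idl_linear_forms_kernel:
  assumes "finite S" "S \<subseteq> linear_forms n"
  obtains \<theta> where "rhom \<theta>" "Idl\<^bsub>mpoly_ring UNIV n\<^esub> S = {f \<in> mpolys UNIV n. \<theta> f = 0}"
    "\<And>f. f \<in> linear_forms n \<Longrightarrow> f - \<theta> f \<in> vspan S"
proof -
  have S: "S \<subseteq> mpolys UNIV n" using assms linear_forms_subset by auto
  obtain \<theta> where \<theta>: "rhom \<theta>" "\<forall>f\<in>mpolys UNIV n. \<theta> f \<in> mpolys UNIV n \<and> f - \<theta> f \<in> Idl\<^bsub>mpoly_ring UNIV n\<^esub> S"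
    "\<forall>f\<in>linear_forms n. f - \<theta> f \<in> vspan S" "\<forall>s\<in>S. \<theta> s = 0"
    using exists_retraction[OF assms] by auto
  have "Idl\<^bsub>mpoly_ring UNIV n\<^esub> S \<subseteq> {f \<in> mpolys UNIV n. \<theta> f = 0}"
    by (intro mp.Idl_minimal rhom.kernel_ideal[OF \<theta>(1)]) (use S \<theta>(4) mp.type_subring_axioms in auto)
  moreover have "{f \<in> mpolys UNIV n. \<theta> f = 0} \<subseteq> Idl\<^bsub>mpoly_ring UNIV n\<^esub> S"
    using \<theta>(2) by force
  ultimately show thesis using \<theta> that[of \<theta>] by blast
qed

text \<open>The ideal is the kernel of a homomorphism into a domain. Independence of
  \<open>S\<close> is not assumed, so dependent sets of forms generate primes too.\<close>

lemma primeideal_Idl_linear_forms: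
  assumes "finite S" "S \<subseteq> linear_forms n"
  shows "primeideal (Idl\<^bsub>mpoly_ring UNIV n\<^esub> S) (mpoly_ring UNIV n)"
proof -
  obtain \<theta> where \<theta>: "rhom \<theta>" "Idl\<^bsub>mpoly_ring UNIV n\<^esub> S = {f \<in> mpolys UNIV n. \<theta> f = 0}"
    "\<And>f. f \<in> linear_forms n \<Longrightarrow> f - \<theta> f \<in> vspan S"
    by (rule Idl_linear_forms_kernel[OF assms]) blast
  have "ideal (Idl\<^bsub>mpoly_ring UNIV n\<^esub> S) (mpoly_ring UNIV n)"
    using assms linear_forms_subset by (intro mp.Idl_ideal) blast
  then show ?thesis
    unfolding mp.primeideal_iff unfolding \<theta>(2)
    by (simp add: rhom.one[OF \<theta>(1)] rhom.mult[OF \<theta>(1)])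
qed

text \<open>If \<open>\<theta> f = 0\<close>, then \<open>f = f - \<theta> f\<close> lies in the
  span. Membership of linear forms in these ideals thus becomes linear algebra.\<close>

lemma linear_form_in_Idl_iff:
  assumes "finite S" "S \<subseteq> linear_forms n" "f \<in> linear_forms n"
  shows "f \<in> Idl\<^bsub>mpoly_ring UNIV n\<^esub> S \<longleftrightarrow> f \<in> vspan S"
proof
  obtain \<theta> where \<theta>: "rhom \<theta>" "Idl\<^bsub>mpoly_ring UNIV n\<^esub> S = {f \<in> mpolys UNIV n. \<theta> f = 0}"
    "\<And>f. f \<in> linear_forms n \<Longrightarrow> f - \<theta> f \<in> vspan S"
    by (rule Idl_linear_forms_kernel[OF assms(1,2)]) blast
  assume "f \<in> Idl\<^bsub>mpoly_ring UNIV n\<^esub> S"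
  then show "f \<in> vspan S" using \<theta>(2) \<theta>(3)[OF assms(3)] by simp
next
  have "S \<subseteq> mpolys UNIV n" using assms linear_forms_subset by auto
  then show "f \<in> vspan S \<Longrightarrow> f \<in> Idl\<^bsub>mpoly_ring UNIV n\<^esub> S" using span_subset_Idl by blast
qed

text \<open>Together with primality this permits cancelling \<open>s\<close> modulo the ideal
  generated by \<open>V\<close>.\<close>

lemma independent_not_in_Idl:
  assumes "finite S" "S \<subseteq> linear_forms n" "\<not> vdependent S" "s \<in> S" "V \<subseteq> S" "s \<notin> V"
  shows "s \<notin> Idl\<^bsub>mpoly_ring UNIV n\<^esub> V"
proof
  assume "s \<in> Idl\<^bsub>mpoly_ring UNIV n\<^esub> V"
  then have "s \<in> vspan V"
    using linear_form_in_Idl_iff[of V n s] assms finite_subset[of V S] by blast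
  then have "s \<in> vspan (S - {s})"
    using vs.span_mono[of V "S - {s}"] assms by blast
  then show False using assms(3,4) vs.dependent_def by blast
qed

text \<open>If an element lay in the span of its predecessors, regularity applied to the multiplier
  \<open>1\<close> would put \<open>1\<close> into the ideal. Conversely, for independent forms the
  predecessors generate a prime ideal that does not contain the next form.\<close>

lemma regular_sequence_set_iff_independent:
  fixes S :: "'k::field mpoly set"
  assumes fin: "finite S" and S: "S \<subseteq> linear_forms n"
  shows "is_regular_sequence_set (mpoly_ring UNIV n) S \<longleftrightarrow> \<not> vdependent S"
proof
  assume "is_regular_sequence_set (mpoly_ring UNIV n) S"
  then obtain fs where fs: "distinct fs" "set fs = S" and reg: "regular_sequence (mpoly_ring UNIV n) fs"
    by (auto simp: is_regular_sequence_set_def)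
  have SD: "S \<subseteq> mpolys UNIV n" using S linear_forms_subset by blast
  have not_in: "fs ! i \<notin> vspan (set (take i fs))" if "i < length fs" for i
  proof
    assume "fs ! i \<in> vspan (set (take i fs))"
    moreover have sub: "set (take i fs) \<subseteq> S" using fs(2) set_take_subset by fast
    ultimately have "1 * fs ! i \<in> Idl\<^bsub>mpoly_ring UNIV n\<^esub> (set (take i fs))"
      using span_subset_Idl[of "set (take i fs)" n] SD by auto
    then have "1 \<in> Idl\<^bsub>mpoly_ring UNIV n\<^esub> (set (take i fs))"
      using reg that by (auto simp: regular_sequence_def)
    then have "1 \<in> Idl\<^bsub>mpoly_ring UNIV n\<^esub> S"
      using mp.Idl_mono[OF SD sub] by blast
    then have "Idl\<^bsub>mpoly_ring UNIV n\<^esub> S = mpolys UNIV n"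
      using mp.ideal_eq_iff_one_mem[OF mp.Idl_ideal[OF SD]] by blast
    then show False using reg fs(2) by (simp add: regular_sequence_def)
  qed
  have "i \<le> length fs \<Longrightarrow> \<not> vdependent (set (take i fs))" for i
  proof (induction i)
    case 0
    show ?case using vs.independent_empty by simp
  next
    case (Suc i)
    then have "\<not> vdependent (insert (fs ! i) (set (take i fs)))"
      using not_in[of i] by (intro vs.independent_insertI) auto
    then show ?case using Suc.prems by (simp add: take_Suc_conv_app_nth)
  qed
  from this[of "length fs"] show "\<not> vdependent S" using fs by simp
next
  assume ind: "\<not> vdependent S"
  obtain fs where fs: "set fs = S" "distinct fs" using finite_distinct_list[OF fin] by blast
  have "regular_sequence (mpoly_ring UNIV n) fs"
    unfolding regular_sequence_def
  proof (intro conjI allI impI ballI)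
    show "set fs \<subseteq> carrier (mpoly_ring UNIV n)" using fs S linear_forms_subset by auto
    show "Idl\<^bsub>mpoly_ring UNIV n\<^esub> (set fs) \<noteq> carrier (mpoly_ring UNIV n)"
      using primeideal_Idl_linear_forms[OF fin S] fs(1) primeideal.I_notcarr by blast
  next
    fix i a
    assume i: "i < length fs" and a: "a \<in> carrier (mpoly_ring UNIV n)"
      "a \<otimes>\<^bsub>mpoly_ring UNIV n\<^esub> fs ! i \<in> Idl\<^bsub>mpoly_ring UNIV n\<^esub> (set (take i fs))"
    have sub: "set (take i fs) \<subseteq> S" using fs(1) set_take_subset by fast
    have "fs ! i \<notin> set (take i fs)"
      using fs(2) i by (auto simp: in_set_conv_nth nth_eq_iff_index_eq)
    then have "fs ! i \<notin> Idl\<^bsub>mpoly_ring UNIV n\<^esub> (set (take i fs))"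
      using independent_not_in_Idl[OF fin S ind] sub fs(1) i nth_mem by blast
    moreover have "primeideal (Idl\<^bsub>mpoly_ring UNIV n\<^esub> (set (take i fs))) (mpoly_ring UNIV n)"
      using primeideal_Idl_linear_forms sub S by auto
    moreover have "fs ! i \<in> mpolys UNIV n"
      using fs(1) S i linear_forms_subset nth_mem by blast
    ultimately show "a \<in> Idl\<^bsub>mpoly_ring UNIV n\<^esub> (set (take i fs))"
      using a unfolding mp.primeideal_iff by auto
  qed
  then show "is_regular_sequence_set (mpoly_ring UNIV n) S"
    using fs by (auto simp: is_regular_sequence_set_def)
qed

section \<open>Dimension counts for linear forms\<close>

lemma independent_mvars: "\<not> vdependent (mvar ` {..<n} :: 'k::field mpoly set)"
proof
  assume "vdependent (mvar ` {..<n} :: 'k mpoly set)"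
  then obtain i where i: "i < n" "(mvar i :: 'k mpoly) \<in> vspan (mvar ` {..<n} - {mvar i})"
    by (auto simp: vs.dependent_def)
  \<comment> \<open>The coefficient of \<open>mvar i\<close> is a linear functional that vanishes on
    all the other variables.\<close>
  let ?e = "Poly_Mapping.single i (1::nat)"
  have "vspan (mvar ` {..<n} - {mvar i}) \<subseteq> {f :: 'k mpoly. Poly_Mapping.lookup f ?e = 0}"
  proof (rule vs.span_minimal)
    have "Poly_Mapping.lookup (const c * f) ?e = c * Poly_Mapping.lookup f ?e" for c and f :: "'k mpoly"
      by (simp add: const_def mult_map_scale_conv_mult[symmetric] Poly_Mapping.map.rep_eq when_def)
    then show "vs.subspace {f :: 'k mpoly. Poly_Mapping.lookup f ?e = 0}"
      by (intro vs.subspaceI) (auto simp: lookup_add)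
    show "mvar ` {..<n} - {mvar i} \<subseteq> {f :: 'k mpoly. Poly_Mapping.lookup f ?e = 0}"
      by (auto simp: mvar_def lookup_single when_def)
  qed
  then show False using i(2) by (auto simp: mvar_def)
qed

lemma card_mvars: "card (mvar ` {..<n} :: 'k::field mpoly set) = n"
  by (subst card_image) (auto simp: inj_on_def mvar_def inj_single[THEN inj_eq] dest!: arg_cong[of _ _ Poly_Mapping.keys])

lemma card_independent_le:
  assumes "S \<subseteq> linear_forms n" "\<not> vdependent S"
  shows "finite S" "card S \<le> n"
  using vs.independent_span_bound[of "mvar ` {..<n}" S] assms linear_forms_span_mvars[of n]
    card_mvars[of n, where ?'k = 'a]
  by auto

lemma card_spanning_gt:
  fixes S :: "'k::field mpoly set"
  assumes "finite S" "vdependent S" "mvar ` {..<n} \<subseteq> vspan S"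
  shows "n < card S"
proof -
  obtain s where s: "s \<in> S" "s \<in> vspan (S - {s})"
    using assms(2) by (auto simp: vs.dependent_def)
  then have "vspan S = vspan (S - {s})"
    using vs.span_redundant[of s "S - {s}"] by (simp add: insert_absorb)
  then have "n \<le> card (S - {s})"
    using vs.independent_span_bound[of "S - {s}" "mvar ` {..<n} :: 'k mpoly set"] assms independent_mvars card_mvars[of n, where ?'k = 'k]
    by auto
  also have "\<dots> < card S"
    using s(1) assms(1) by (rule card_Diff1_less[rotated])
  finally show ?thesis .
qed

text \<open>A variable outside the span would extend \<open>S\<close> to \<open>n + 1\<close>
  independent linear forms.\<close>

lemma mvars_in_span:
  assumes "S \<subseteq> linear_forms n" "\<not> vdependent S" "card S = n"
  shows "mvar ` {..<n} \<subseteq> vspan S"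
proof (rule ccontr)
  assume "\<not> ?thesis"
  then obtain i where i: "i < n" "mvar i \<notin> vspan S" by auto
  then have "\<not> vdependent (insert (mvar i) S)" by (intro vs.independent_insertI assms)
  then have "card (insert (mvar i) S) \<le> n"
    using card_independent_le[of "insert (mvar i) S" n] assms mvar_linear_form[OF i(1)] by auto
  moreover have "mvar i \<notin> S" using i(2) vs.span_base by blast
  ultimately show False using card_independent_le[OF assms(1,2)] assms(3) by simp
qed

section \<open>Relations between generators\<close>

context type_subring
begin

lemma geval_cong:
  assumes "rhom \<phi>" "P \<in> mpolys A n" "\<And>a. a \<in> A \<Longrightarrow> \<phi> a = \<psi> a" "rhom \<psi>" "\<And>i. i < n \<Longrightarrow> x i = y i"
  shows "geval \<phi> x P = geval \<psi> y P"
  using assms(2)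
  by (induction rule: mpolys_induct)
    (simp_all add: assms(3,5) rhom.geval_const[OF assms(1)] rhom.geval_mvar[OF assms(1)]
      rhom.geval_add[OF assms(1)] rhom.geval_mult[OF assms(1)] rhom.geval_const[OF assms(4)] rhom.geval_mvar[OF assms(4)]
      rhom.geval_add[OF assms(4)] rhom.geval_mult[OF assms(4)])

lemma geval_diff_mem:
  assumes M: "ideal M (subring_of A)" and P: "P \<in> mpolys A n"
    and x: "\<And>i. i < n \<Longrightarrow> x i \<in> A" and y: "\<And>i. i < n \<Longrightarrow> y i \<in> A"
    and d: "\<And>i. i < n \<Longrightarrow> x i - y i \<in> M"
  shows "geval (\<lambda>a. a) x P - geval (\<lambda>a. a) y P \<in> M"
  using P
proof (induction rule: mpolys_induct)
  case (add P P')
  then show ?case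
    using idealD(3)[OF M add(3,4)] by (simp add: rhom.geval_add[OF rhom_id] algebra_simps)
next
  case (mult P P')
  let ?a = "geval (\<lambda>a. a) x P" and ?b = "geval (\<lambda>a. a) y P"
    and ?a' = "geval (\<lambda>a. a) x P'" and ?b' = "geval (\<lambda>a. a) y P'"
  have "?a' \<in> A" "?b \<in> A"
    using mult(1,2) x y by (auto intro!: geval_mem[OF type_subring_axioms rhom_id])
  then have "?a' * (?a - ?b) + ?b * (?a' - ?b') \<in> M"
    using mult(3,4) by (intro idealD(3)[OF M] idealD(4)[OF M])
  then show ?case
    by (simp add: rhom.geval_mult[OF rhom_id] algebra_simps)
qed (simp_all add: rhom.geval_const[OF rhom_id] rhom.geval_mvar[OF rhom_id] idealD(2)[OF M] d)

text \<open>
  A presentation by other generators \<open>g\<close> is compared with \<open>h\<close> through \<open>h = c g\<close> and \<open>g = d h\<close>: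
  the relation \<open>P\<close> becomes a relation \<open>Q(U) = P(c U)\<close> on \<open>g\<close>, all linear relations on \<open>g\<close> lie in
  \<open>M\<close> at \<open>U = d t\<close>, and \<open>c d t\<close> agrees with \<open>t\<close> modulo \<open>M\<close>.
\<close>

lemma linear_type_relation:
  fixes h t :: "nat \<Rightarrow> 'a"
  assumes M: "ideal M (subring_of A)"
    and h: "\<And>j. j < m \<Longrightarrow> h j \<in> A"
    and syz: "\<And>\<alpha> j. (\<And>j. j < m \<Longrightarrow> \<alpha> j \<in> A) \<Longrightarrow> (\<Sum>j<m. \<alpha> j * h j) = 0 \<Longrightarrow> j < m \<Longrightarrow> \<alpha> j \<in> M"
    and lt: "linear_type A (Idl\<^bsub>subring_of A\<^esub> (h ` {..<m}))"
    and P: "P \<in> mpolys A m" "geval (\<lambda>a. [:a:]) (\<lambda>j. [:0, h j:]) P = 0"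
    and t: "\<And>j. j < m \<Longrightarrow> t j \<in> A"
  shows "geval (\<lambda>x. x) t P \<in> M"
proof -
  obtain gs L where gs: "set gs \<subseteq> A" "Idl\<^bsub>subring_of A\<^esub> (h ` {..<m}) = Idl\<^bsub>subring_of A\<^esub> (set gs)"
    and L: "L \<subseteq> {P \<in> mpolys A (length gs). homogeneous 1 P}"
    and ker: "rees_kernel A gs = Idl\<^bsub>mpoly_ring A (length gs)\<^esub> L"
    using lt by (auto simp: linear_type_def)
  define r where "r = length gs"
  interpret T: type_subring "mpolys A r" by (rule type_subring_mpolys)
  note ev_simps = rhom.geval_add[OF rhom_id] rhom.geval_mult[OF rhom_id] rhom.geval_const[OF rhom_id]
    rhom.geval_mvar[OF rhom_id]
  note ev_hom = rhom.rhom_geval[OF rhom_id]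
  have set_gs: "set gs = (!) gs ` {..<r}"
    by (auto simp: r_def set_conv_nth)
  have gsA: "gs ! i \<in> A" if "i < r" for i
    using gs(1) that by (auto simp: r_def)
  have hA: "h ` {..<m} \<subseteq> A" using h by auto
  have "\<exists>c. (\<forall>i<r. c i \<in> A) \<and> h j = (\<Sum>i<r. c i * gs ! i)" if "j < m" for j
  proof -
    have "h j \<in> Idl\<^bsub>subring_of A\<^esub> ((!) gs ` {..<r})"
      using Idl_incl[OF hA] gs(2) that set_gs by auto
    also have "\<dots> = {\<Sum>i<r. c i * gs ! i | c. \<forall>i\<in>{..<r}. c i \<in> A}"
      by (rule Idl_image_eq) (use gsA in auto)
    finally show ?thesis by blast
  qed
  then obtain c where c: "\<And>j i. j < m \<Longrightarrow> i < r \<Longrightarrow> c j i \<in> A" "\<And>j. j < m \<Longrightarrow> h j = (\<Sum>i<r. c j i * gs ! i)"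
    by metis
  have "\<exists>d. (\<forall>j<m. d j \<in> A) \<and> gs ! i = (\<Sum>j<m. d j * h j)" if "i < r" for i
  proof -
    have "gs ! i \<in> Idl\<^bsub>subring_of A\<^esub> (h ` {..<m})"
      using Idl_incl[OF gs(1)] gs(2) that by (auto simp: r_def)
    also have "\<dots> = {\<Sum>j<m. d j * h j | d. \<forall>j\<in>{..<m}. d j \<in> A}"
      by (rule Idl_image_eq) (use h in auto)
    finally show ?thesis by blast
  qed
  then obtain d where d: "\<And>i j. i < r \<Longrightarrow> j < m \<Longrightarrow> d i j \<in> A" "\<And>i. i < r \<Longrightarrow> gs ! i = (\<Sum>j<m. d i j * h j)"
    by metis
  define x where "x i = (\<Sum>j<m. d i j * t j)" for i
  have x: "x i \<in> A" if "i < r" for i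
    unfolding x_def by (intro sum_mem mult_mem d(1) t that) auto
  define l where "l j = (\<Sum>i<r. const (c j i) * mvar i)" for j
  define Q where "Q = geval const l P"
  have Q: "Q \<in> mpolys A r"
    unfolding Q_def l_def
    by (rule geval_mem[OF T.type_subring_axioms rhom_const P(1)]) (auto intro!: T.sum_mem T.mult_mem simp: c(1))
  interpret rs: rhom "rees_map gs"
    unfolding rees_map_eq_geval by (rule rhom.rhom_geval[OF rhom_pconst])
  have rees_const: "rees_map gs (const a) = [:a:]" and rees_mvar: "rees_map gs (mvar i) = [:0, gs ! i:]" for a i
    by (simp_all add: rees_map_eq_geval rhom.geval_const[OF rhom_pconst] rhom.geval_mvar[OF rhom_pconst])
  have pCons_sum: "(\<Sum>i\<in>I. [:a i:] * [:0, b i:]) = [:0, \<Sum>i\<in>I. a i * b i:]" for I and a b :: "nat \<Rightarrow> 'a"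
    by (induction I rule: infinite_finite_induct) auto
  have lin_rees: "rees_map gs (\<Sum>i<r. const (a i) * mvar i) = [:0, \<Sum>i<r. a i * gs ! i:]" for a
    by (simp only: rs.sum rs.mult rees_const rees_mvar pCons_sum)
  have "rees_map gs Q = geval (\<lambda>a. [:a:]) (\<lambda>j. rees_map gs (l j)) P"
    unfolding Q_def by (subst rhom.comp_geval[OF rhom_const rs.rhom_axioms]) (simp add: rees_const)
  also have "\<dots> = geval (\<lambda>a. [:a:]) (\<lambda>j. [:0, h j:]) P"
    by (rule geval_cong[OF rhom_pconst P(1) _ rhom_pconst]) (simp_all add: l_def lin_rees c(2))
  finally have "Q \<in> rees_kernel A gs"
    using Q P(2) by (simp add: rees_kernel_def a_kernel_def' r_def ring_of_type_algebra_def)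
  \<comment> \<open>The polynomials whose value at \<open>x\<close> lies in \<open>M\<close> form an
    ideal; to see that it contains the whole Rees kernel, only the linear generators
    \<open>L\<close> need to be checked.\<close>
  define I where "I = {P \<in> mpolys A r. geval (\<lambda>x. x) x P \<in> M}"
  have "ideal I (mpoly_ring A r)"
    unfolding T.ideal_iff
  proof (intro conjI ballI)
    fix P P' assume "P \<in> mpolys A r" "P' \<in> I"
    then show "P * P' \<in> I"
      unfolding I_def using x
      by (auto simp: ev_simps intro!: idealD(4)[OF M] geval_mem[OF type_subring_axioms rhom_id])
  qed (auto simp: I_def ev_simps rhom.zero[OF ev_hom] idealD(2,3)[OF M])
  moreover have "L \<subseteq> I"
  proof
    fix P assume P: "P \<in> L"
    then have PA: "P \<in> mpolys A r" "homogeneous 1 P" using L by (auto simp: r_def)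
    define a where "a i = Poly_Mapping.lookup P (Poly_Mapping.single i 1)" for i
    have aA: "a i \<in> A" for i using PA(1) by (auto simp: a_def mpolys_def)
    have Peq: "P = (\<Sum>i<r. const (a i) * mvar i)"
      unfolding a_def by (rule linear_form_expansion[OF PA])
    have "ideal (rees_kernel A gs) (mpoly_ring A r)"
      unfolding rees_kernel_def a_kernel_def'
      using rs.kernel_ideal[OF type_subring_mpolys, of r] by (simp add: r_def ring_of_type_algebra_def)
    have "P \<in> rees_kernel A gs"
      unfolding ker r_def[symmetric] using P L by (intro T.Idl_incl) (auto simp: r_def)
    then have "rees_map gs P = 0"
      by (simp add: rees_kernel_def a_kernel_def' ring_of_type_algebra_def)
    then have "(\<Sum>i<r. a i * gs ! i) = 0"
      unfolding Peq lin_rees by simp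
    also have "(\<Sum>i<r. a i * gs ! i) = (\<Sum>i<r. \<Sum>j<m. a i * d i j * h j)"
      by (intro sum.cong) (auto simp: d(2) sum_distrib_left mult.assoc)
    also have "\<dots> = (\<Sum>j<m. (\<Sum>i<r. a i * d i j) * h j)"
      by (subst sum.swap) (simp add: sum_distrib_right)
    finally have mem: "(\<Sum>i<r. a i * d i j) \<in> M" if "j < m" for j
      by (intro syz[where \<alpha> = "\<lambda>j. \<Sum>i<r. a i * d i j"]) (use that aA d(1) in \<open>auto intro!: sum_mem mult_mem\<close>)
    have "geval (\<lambda>x. x) x P = (\<Sum>i<r. a i * x i)"
      unfolding Peq by (simp add: rhom.sum[OF ev_hom] ev_simps)
    also have "\<dots> = (\<Sum>i<r. \<Sum>j<m. a i * d i j * t j)"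
      by (intro sum.cong) (auto simp: x_def sum_distrib_left mult.assoc)
    also have "\<dots> = (\<Sum>j<m. (\<Sum>i<r. a i * d i j) * t j)"
      by (subst sum.swap) (simp add: sum_distrib_right)
    also have "\<dots> \<in> M"
      by (intro ideal_sum[OF M] idealD(5)[OF M] mem t) auto
    finally show "P \<in> I" using PA(1) by (simp add: I_def)
  qed
  ultimately have "rees_kernel A gs \<subseteq> I"
    unfolding ker r_def[symmetric] by (rule T.Idl_minimal)
  then have "geval (\<lambda>x. x) x Q \<in> M"
    using \<open>Q \<in> rees_kernel A gs\<close> by (auto simp: I_def)
  also have "geval (\<lambda>x. x) x Q = geval (\<lambda>x. x) (\<lambda>j. \<Sum>i<r. c j i * x i) P"
    unfolding Q_def
    by (subst rhom.comp_geval[OF rhom_const ev_hom])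
      (simp add: l_def rhom.sum[OF ev_hom] ev_simps)
  finally have 1: "geval (\<lambda>x. x) (\<lambda>j. \<Sum>i<r. c j i * x i) P \<in> M" .
  have 2: "geval (\<lambda>x. x) (\<lambda>j. \<Sum>i<r. c j i * x i) P - geval (\<lambda>x. x) t P \<in> M"
  proof (rule geval_diff_mem[OF M P(1)])
    fix j assume j: "j < m"
    show "(\<Sum>i<r. c j i * x i) \<in> A" using c(1)[OF j] x by (auto intro!: sum_mem mult_mem)
    \<comment> \<open>Row \<open>j\<close> of the matrix \<open>c d\<close> minus the identity. It
      annihilates \<open>h\<close>, so its entries lie in \<open>M\<close> by the hypothesis on
      linear relations.\<close>
    define \<alpha> where "\<alpha> k = (\<Sum>i<r. c j i * d i k) - (if k = j then 1 else 0)" for k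
    have "(\<Sum>k<m. \<alpha> k * h k) = (\<Sum>k<m. (\<Sum>i<r. c j i * d i k) * h k) - (\<Sum>k<m. (if k = j then 1 else 0) * h k)"
      by (simp add: \<alpha>_def left_diff_distrib sum_subtractf)
    also have "(\<Sum>k<m. (\<Sum>i<r. c j i * d i k) * h k) = (\<Sum>i<r. c j i * (\<Sum>k<m. d i k * h k))"
      by (simp add: sum_distrib_right sum_distrib_left mult.assoc) (rule sum.swap)
    also have "\<dots> = (\<Sum>i<r. c j i * gs ! i)"
      by (intro sum.cong) (auto simp: d(2))
    also have "\<dots> = h j" using c(2)[OF j] by simp
    also have "(\<Sum>k<m. (if k = j then 1 else 0) * h k) = h j"
      using j by (simp add: if_distrib[of "\<lambda>c. c * _"] cong: if_cong)
    finally have "\<alpha> k \<in> M" if "k < m" for k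
      by (intro syz[where \<alpha> = \<alpha>]) (use that c(1)[OF j] d(1) in \<open>auto simp: \<alpha>_def intro!: sum_mem mult_mem diff_mem\<close>)
    then have "(\<Sum>k<m. \<alpha> k * t k) \<in> M"
      by (intro ideal_sum[OF M] idealD(5)[OF M] t) auto
    also have "(\<Sum>k<m. \<alpha> k * t k) = (\<Sum>k<m. (\<Sum>i<r. c j i * d i k) * t k) - (\<Sum>k<m. (if k = j then 1 else 0) * t k)"
      by (simp add: \<alpha>_def left_diff_distrib sum_subtractf)
    also have "(\<Sum>k<m. (\<Sum>i<r. c j i * d i k) * t k) = (\<Sum>i<r. c j i * x i)"
      by (simp add: x_def sum_distrib_right sum_distrib_left mult.assoc) (rule sum.swap)
    also have "(\<Sum>k<m. (if k = j then 1 else 0) * t k) = t j"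
      using j by (simp add: if_distrib[of "\<lambda>c. c * _"] cong: if_cong)
    finally show "(\<Sum>i<r. c j i * x i) - t j \<in> M" .
  qed (rule t)
  show ?thesis
    using idealD(7)[OF M 1 2] by simp
qed

text \<open>Homogeneous polynomials of degree \<open>d\<close> over \<open>A\<close> in the
  variables with index in \<open>U\<close>. The rules build them one variable at a time, so that
  degree and variables are tracked by rule induction without handling exponents.\<close>

inductive hpoly :: "nat set \<Rightarrow> nat \<Rightarrow> 'a mpoly \<Rightarrow> bool" for U where
  zero: "hpoly U d 0"
| const: "a \<in> A \<Longrightarrow> hpoly U 0 (const a)"
| var: "hpoly U d P \<Longrightarrow> i \<in> U \<Longrightarrow> hpoly U (Suc d) (mvar i * P)"
| add: "hpoly U d P \<Longrightarrow> hpoly U d P' \<Longrightarrow> hpoly U d (P + P')"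

lemma hpoly_mono: "hpoly U d P \<Longrightarrow> U \<subseteq> V \<Longrightarrow> hpoly V d P"
  by (induction rule: hpoly.induct) (auto intro: hpoly.intros)

lemma hpoly_const_mult: "hpoly U d P \<Longrightarrow> a \<in> A \<Longrightarrow> hpoly U d (const a * P)"
proof (induction rule: hpoly.induct)
  case (var d P i)
  then show ?case
    using hpoly.var[of U d "const a * P" i] by (simp only: mult.left_commute)
qed (auto intro: hpoly.intros simp: distrib_left simp flip: rc.mult)

lemma hpoly_mult: "hpoly U d P \<Longrightarrow> hpoly U e Q \<Longrightarrow> hpoly U (d + e) (P * Q)"
proof (induction rule: hpoly.induct)
  case (var d P i)
  then show ?case
    using hpoly.var[of U "d + e" "P * Q" i] by (simp add: mult.assoc)
next
  case (add d P P')
  then show ?case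
    using hpoly.add[of U "d + e" "P * Q" "P' * Q"] by (simp add: distrib_right)
qed (simp_all add: hpoly.zero hpoly_const_mult)

lemma hpoly_power: "i \<in> U \<Longrightarrow> hpoly U k (mvar i ^ k)"
  by (induction k) (use hpoly.const[of 1 U] in \<open>auto intro: hpoly.intros simp: rhom.one[OF rhom_const]\<close>)

lemma hpoly_0E: "hpoly U 0 P \<Longrightarrow> \<exists>a\<in>A. P = const a"
proof (induction "0 :: nat" P rule: hpoly.induct)
  case zero
  then show ?case by (auto intro!: bexI[of _ 0] simp: rhom.zero[OF rhom_const])
next
  case (add P P')
  then show ?case by (metis add_mem rhom.add[OF rhom_const])
qed auto

lemma hpoly_emptyE: "hpoly {} (Suc d) P \<Longrightarrow> P = 0"
  by (induction "Suc d" P rule: hpoly.induct) auto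

lemma hpoly_singletonE: "hpoly {u} d P \<Longrightarrow> \<exists>a\<in>A. P = const a * mvar u ^ d"
proof (induction rule: hpoly.induct)
  case (zero d)
  then show ?case by (auto intro!: bexI[of _ 0] simp: rhom.zero[OF rhom_const])
next
  case (add d P P')
  then obtain a b where "a \<in> A" "b \<in> A" "P = const a * mvar u ^ d" "P' = const b * mvar u ^ d" by auto
  then show ?case by (auto intro!: bexI[of _ "a + b"] simp: rhom.add[OF rhom_const] distrib_right)
qed (auto simp: mult.left_commute)

lemma hpoly_split:
  "hpoly (insert u U) (Suc d) P \<Longrightarrow>
     \<exists>P0 P1. hpoly U (Suc d) P0 \<and> hpoly (insert u U) d P1 \<and> P = P0 + mvar u * P1"
proof (induction "Suc d" P arbitrary: d rule: hpoly.induct)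
  case zero
  then show ?case by (intro exI[of _ 0]) (auto intro: hpoly.intros)
next
  case (var d P i)
  show ?case
  proof (cases "i = u")
    case True
    then show ?thesis using var by (intro exI[of _ 0] exI[of _ P]) (auto intro: hpoly.intros)
  next
    case False
    then have i: "i \<in> U" using var by auto
    show ?thesis
    proof (cases d)
      case 0
      then obtain a where "a \<in> A" "P = const a" using var(1) hpoly_0E by blast
      then show ?thesis
        using 0 i by (intro exI[of _ "mvar i * P"] exI[of _ 0]) (auto intro: hpoly.intros)
    next
      case (Suc e)
      then obtain P0 P1 where "hpoly U (Suc e) P0" "hpoly (insert u U) e P1" "P = P0 + mvar u * P1"
        using var(2) by blast
      then show ?thesis
        using i Suc hpoly.var[of U "Suc e" P0 i] hpoly.var[of "insert u U" e P1 i]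
        by (intro exI[of _ "mvar i * P0"] exI[of _ "mvar i * P1"]) (simp add: distrib_left mult.left_commute)
    qed
  qed
next
  case (add P P')
  then obtain P0 P1 P0' P1' where "hpoly U (Suc d) P0" "hpoly (insert u U) d P1" "P = P0 + mvar u * P1"
    "hpoly U (Suc d) P0'" "hpoly (insert u U) d P1'" "P' = P0' + mvar u * P1'"
    by blast
  then show ?case
    by (intro exI[of _ "P0 + P0'"] exI[of _ "P1 + P1'"]) (auto intro: hpoly.intros simp: algebra_simps)
qed

lemma hpoly_decomp:
  "hpoly (insert u U) d P \<Longrightarrow>
     \<exists>p. (\<forall>k\<le>d. hpoly U (d - k) (p k)) \<and> P = (\<Sum>k\<le>d. mvar u ^ k * p k)"
proof (induction d arbitrary: P)
  case 0
  then obtain a where "a \<in> A" "P = const a" using hpoly_0E by blast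
  then show ?case by (intro exI[of _ "\<lambda>_. P"]) (auto intro: hpoly.intros)
next
  case (Suc d)
  then obtain P0 P1 where 1: "hpoly U (Suc d) P0" "hpoly (insert u U) d P1" "P = P0 + mvar u * P1"
    using hpoly_split by blast
  then obtain p where p: "\<forall>k\<le>d. hpoly U (d - k) (p k)" "P1 = (\<Sum>k\<le>d. mvar u ^ k * p k)"
    using Suc by blast
  define q where "q k = (case k of 0 \<Rightarrow> P0 | Suc k \<Rightarrow> p k)" for k
  have "(\<Sum>k\<le>Suc d. mvar u ^ k * q k) = P"
    unfolding sum.atMost_Suc_shift 1(3) p(2) by (simp add: q_def sum_distrib_left mult.assoc)
  moreover have "\<forall>k\<le>Suc d. hpoly U (Suc d - k) (q k)"
    using p(1) 1(1) by (auto simp: q_def split: nat.splits)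
  ultimately show ?case by blast
qed

lemma hpoly_mem_mpolys: "hpoly U d P \<Longrightarrow> U \<subseteq> {..<n} \<Longrightarrow> P \<in> mpolys A n"
proof (induction rule: hpoly.induct)
  interpret T: type_subring "mpolys A n" by (rule type_subring_mpolys)
  { case zero then show ?case by simp }
  { case const then show ?case by simp }
  { case var then show ?case by auto }
  { case add then show ?case by simp }
qed

text \<open>Decomposition into homogeneous components. The family \<open>p\<close> is defined for
  all degrees and vanishes off \<open>S\<close>, so that two decompositions can be added over the
  union of their index sets.\<close>

lemma mpolys_graded:
  assumes "P \<in> mpolys A n"
  shows "\<exists>S p. finite S \<and> (\<forall>d. hpoly {..<n} d (p d)) \<and> (\<forall>d. d \<notin> S \<longrightarrow> p d = 0) \<and> P = (\<Sum>d\<in>S. p d)"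
    (is "?C P")
proof -
  have hC: "?C P" if "hpoly {..<n} d P" for d P
    using that by (intro exI[of _ "{d}"] exI[of _ "\<lambda>e. if e = d then P else 0"]) (auto intro: hpoly.intros)
  have addC: "?C (P + P')" if "?C P" "?C P'" for P P'
  proof -
    obtain S p S' p' where S: "finite S" "\<forall>d. hpoly {..<n} d (p d)" "\<forall>d. d \<notin> S \<longrightarrow> p d = 0" "P = (\<Sum>d\<in>S. p d)"
      "finite S'" "\<forall>d. hpoly {..<n} d (p' d)" "\<forall>d. d \<notin> S' \<longrightarrow> p' d = 0" "P' = (\<Sum>d\<in>S'. p' d)"
      using \<open>?C P\<close> \<open>?C P'\<close> by blast
    have "P = (\<Sum>d\<in>S \<union> S'. p d)" "P' = (\<Sum>d\<in>S \<union> S'. p' d)"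
      unfolding S(4,8) using S by (auto intro!: sum.mono_neutral_left)
    then show ?thesis
      using S by (intro exI[of _ "S \<union> S'"] exI[of _ "\<lambda>d. p d + p' d"]) (auto intro: hpoly.intros simp: sum.distrib)
  qed
  have sumC: "?C (sum f K)" if "\<And>k. k \<in> K \<Longrightarrow> ?C (f k)" for f :: "nat \<Rightarrow> _" and K
    using that
  proof (induction K rule: infinite_finite_induct)
    case (insert k K)
    have "?C (f k)" "?C (sum f K)"
      using insert.prems insert.IH by blast+
    then show ?case unfolding sum.insert[OF insert.hyps] by (rule addC)
  next
    case (infinite K)
    show ?case unfolding sum.infinite[OF infinite.hyps] by (rule hC[OF hpoly.zero])
  next
    case empty
    show ?case unfolding sum.empty by (rule hC[OF hpoly.zero])
  qed
  show ?thesis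
    using assms
  proof (induction rule: mpolys_induct)
    case (mult P P')
    then obtain S p S' p' where S: "\<forall>d. hpoly {..<n} d (p d)" "P = (\<Sum>d\<in>S. p d)"
      "\<forall>d. hpoly {..<n} d (p' d)" "P' = (\<Sum>d\<in>S'. p' d)"
      by blast
    show ?case
      unfolding S(2,4) sum_product by (rule sumC, rule sumC, rule hC, rule hpoly_mult) (use S in auto)
  next
    case (mvar i)
    then have "hpoly {..<n} 1 (mvar i)" using hpoly_power[of i "{..<n}" 1] by simp
    then show ?case by (rule hC)
  next
    case (const a)
    then show ?case by (rule hC[OF hpoly.const])
  next
    case (add P P')
    then show ?case by (intro addC)
  qed
qed

text \<open>Each variable contributes one factor \<tau>; a homogeneous polynomial is therefore in
  the Rees kernel exactly if its value at \<open>g\<close> vanishes.\<close>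

lemma rees_hpoly:
  assumes "hpoly U d P"
  shows "geval (\<lambda>a. [:a:]) (\<lambda>i. [:0, g i:]) P = Polynomial.monom (geval (\<lambda>x. x) g P) d"
  using assms
proof (induction rule: hpoly.induct)
  case (var d P i)
  have "[:0, g i:] = Polynomial.monom (g i) 1" by (simp add: Polynomial.monom_Suc monom_0)
  then show ?case using var
    by (simp only: rhom.geval_mult[OF rhom_pconst] rhom.geval_mvar[OF rhom_pconst]
      rhom.geval_mult[OF rhom_id] rhom.geval_mvar[OF rhom_id] mult_monom plus_1_eq_Suc)
qed (simp_all add: rhom.zero[OF rhom.rhom_geval[OF rhom_pconst]] rhom.zero[OF rhom.rhom_geval[OF rhom_id]]
    rhom.geval_const[OF rhom_pconst] rhom.geval_const[OF rhom_id] monom_0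
    rhom.geval_add[OF rhom_pconst] rhom.geval_add[OF rhom_id] add_monom)

end

text \<open>
  \<open>Q B\<close> stands for the ideal generated by the \<open>y i\<close> with \<open>i \<in> B\<close>. The forms \<open>gen i j\<close> are the
  expected linear relations, and \<open>rel U B d\<close> is the degree \<open>d\<close> part of the ideal that they generate
  together with \<open>Q B\<close> in the polynomial ring with variables \<open>U\<close>.
\<close>

locale prime_sequence = type_subring A for A :: "'a::idom set" +
  fixes N :: "nat set" and y :: "nat \<Rightarrow> 'a" and Q :: "nat set \<Rightarrow> 'a set"
  assumes y_mem: "i \<in> N \<Longrightarrow> y i \<in> A"
    and Q_ideal: "B \<subseteq> N \<Longrightarrow> ideal (Q B) (subring_of A)"
    and Q_empty: "Q {} = {0}"
    and Q_mono: "insert u B \<subseteq> N \<Longrightarrow> Q B \<subseteq> Q (insert u B)"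
    and y_in_Q: "insert u B \<subseteq> N \<Longrightarrow> y u \<in> Q (insert u B)"
    and Q_insertE: "insert u B \<subseteq> N \<Longrightarrow> q \<in> Q (insert u B) \<Longrightarrow> \<exists>a\<in>A. q - y u * a \<in> Q B"
    and Q_cancel: "insert u B \<subseteq> N \<Longrightarrow> u \<notin> B \<Longrightarrow> a \<in> A \<Longrightarrow> y u * a \<in> Q B \<Longrightarrow> a \<in> Q B"

locale linear_relations = prime_sequence A N y Q for A :: "'a::idom set" and N y Q +
  fixes gen :: "nat \<Rightarrow> nat \<Rightarrow> 'a mpoly"
begin

inductive rel :: "nat set \<Rightarrow> nat set \<Rightarrow> nat \<Rightarrow> 'a mpoly \<Rightarrow> bool" for U B where
  zero: "rel U B d 0"
| gen: "hpoly U d G \<Longrightarrow> i \<in> U \<Longrightarrow> j \<in> U \<Longrightarrow> rel U B (Suc d) (G * gen i j)"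
| coeff: "hpoly U d G \<Longrightarrow> q \<in> Q B \<Longrightarrow> rel U B d (const q * G)"
| add: "rel U B d P \<Longrightarrow> rel U B d P' \<Longrightarrow> rel U B d (P + P')"

lemma rel_mono: "rel U B d P \<Longrightarrow> U \<subseteq> V \<Longrightarrow> rel V B d P"
proof (induction rule: rel.induct)
  case (gen d G i j)
  then show ?case using hpoly_mono[of U d G V] by (intro rel.gen) auto
next
  case (coeff d G q)
  then show ?case using hpoly_mono[of U d G V] by (intro rel.coeff) auto
qed (auto intro: rel.zero rel.add)

lemma rel_mvar_mult:
  assumes "rel U B d P" "u \<in> U"
  shows "rel U B (Suc d) (mvar u * P)"
  using assms(1)
proof (induction rule: rel.induct)
  case (gen d G i j)
  then show ?case using rel.gen[OF hpoly.var[OF gen(1) assms(2)] gen(2,3)] by (simp add: mult.assoc)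
next
  case (coeff d G q)
  then show ?case using rel.coeff[OF hpoly.var[OF coeff(1) assms(2)] coeff(2)] by (simp add: mult.left_commute)
qed (auto intro: rel.zero rel.add simp: distrib_left)

lemma rel_mvar_power_mult: "rel U B d P \<Longrightarrow> u \<in> U \<Longrightarrow> rel U B (k + d) (mvar u ^ k * P)"
  by (induction k) (auto dest: rel_mvar_mult simp: mult.assoc)

text \<open>Undoes the passage to the quotient by \<open>y u\<close>: coefficients in
  \<open>Q (insert u B)\<close> are multiples of \<open>y u\<close> up to \<open>Q B\<close>, and
  these multiples are collected in \<open>G\<close>.\<close>

lemma rel_insertE:
  assumes "rel U (insert u B) d P" "insert u B \<subseteq> N"
  shows "\<exists>G. hpoly U d G \<and> rel U B d (P - const (y u) * G)"
  using assms(1)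
proof (induction rule: rel.induct)
  case (zero d)
  then show ?case by (intro exI[of _ 0]) (auto intro: hpoly.zero rel.zero)
next
  case (gen d G i j)
  then show ?case by (intro exI[of _ 0]) (auto intro: hpoly.zero rel.gen)
next
  case (coeff d G q)
  obtain a where a: "a \<in> A" "q - y u * a \<in> Q B" using Q_insertE[OF assms(2) coeff(2)] by blast
  have "const q * G - const (y u) * (const a * G) = const (q - y u * a) * G"
    by (simp add: algebra_simps)
  then show ?case
    using rel.coeff[OF coeff(1) a(2)] hpoly_const_mult[OF coeff(1) a(1)] by metis
next
  case (add d P P')
  then obtain G G' where G: "hpoly U d G" "rel U B d (P - const (y u) * G)"
    "hpoly U d G'" "rel U B d (P' - const (y u) * G')" by blast
  have "(P + P') - const (y u) * (G + G') = (P - const (y u) * G) + (P' - const (y u) * G')"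
    by (simp add: algebra_simps)
  then show ?case using hpoly.add[OF G(1,3)] rel.add[OF G(2,4)] by metis
qed

lemma hpoly_eval_mem:
  assumes "hpoly U d P" "\<And>i. i \<in> U \<Longrightarrow> x i \<in> A"
  shows "geval (\<lambda>a. a) x P \<in> A"
  using assms(1)
  by (induction rule: hpoly.induct)
    (auto simp: rhom.zero[OF rhom.rhom_geval[OF rhom_id]] rhom.geval_const[OF rhom_id] rhom.geval_add[OF rhom_id]
      rhom.geval_mult[OF rhom_id] rhom.geval_mvar[OF rhom_id] assms(2) intro: mult_mem add_mem)

lemma rel_eval:
  assumes "rel U B d P" "B \<subseteq> N" "\<And>i. i \<in> U \<Longrightarrow> x i \<in> A"
    and "\<And>i j. i \<in> U \<Longrightarrow> j \<in> U \<Longrightarrow> geval (\<lambda>a. a) x (gen i j) = 0"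
  shows "geval (\<lambda>a. a) x P \<in> Q B"
  using assms(1)
  by (induction rule: rel.induct)
    (auto simp: rhom.zero[OF rhom.rhom_geval[OF rhom_id]] rhom.geval_const[OF rhom_id] rhom.geval_add[OF rhom_id]
      rhom.geval_mult[OF rhom_id] assms(4)
      intro: idealD(2,3,5)[OF Q_ideal[OF assms(2)]] hpoly_eval_mem assms(3))

lemma rel_subset_Idl:
  assumes "rel {..<n} {} d P" "\<And>i j. i < n \<Longrightarrow> j < n \<Longrightarrow> gen i j \<in> mpolys A n"
  shows "P \<in> Idl\<^bsub>mpoly_ring A n\<^esub> {gen i j | i j. i < n \<and> j < n}"
proof -
  interpret T: type_subring "mpolys A n" by (rule type_subring_mpolys)
  have L: "{gen i j | i j. i < n \<and> j < n} \<subseteq> mpolys A n" using assms(2) by auto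
  note I = T.Idl_ideal[OF L]
  show ?thesis
    using assms(1)
  proof (induction rule: rel.induct)
    case (gen d G i j)
    then show ?case
      using hpoly_mem_mpolys[OF gen(1), of n] by (intro T.idealD(4)[OF I] T.Idl_incl[OF L]) auto
  qed (auto simp: Q_empty rhom.zero[OF rhom_const] intro: T.idealD(2,3)[OF I])
qed

text \<open>The Rees map is graded, so comparing coefficients of powers of \<tau> shows that each
  homogeneous component of a kernel element is again in the kernel. It is enough to treat
  homogeneous relations.\<close>

lemma linear_typeI:
  assumes gs: "set gs \<subseteq> A" and gen: "\<And>i j. i < length gs \<Longrightarrow> j < length gs \<Longrightarrow>
      gen i j \<in> mpolys A (length gs) \<and> homogeneous 1 (gen i j) \<and> rees_map gs (gen i j) = 0"
    and rel: "\<And>d P. hpoly {..<length gs} d P \<Longrightarrow> geval (\<lambda>a. a) ((!) gs) P = 0 \<Longrightarrow> rel {..<length gs} {} d P"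
  shows "linear_type A (Idl\<^bsub>subring_of A\<^esub> (set gs))"
proof -
  define n where "n = length gs"
  interpret T: type_subring "mpolys A n" by (rule type_subring_mpolys)
  interpret rs: rhom "rees_map gs"
    unfolding rees_map_eq_geval by (rule rhom.rhom_geval[OF rhom_pconst])
  let ?L = "{gen i j | i j. i < n \<and> j < n}"
  have L: "?L \<subseteq> mpolys A n" using gen by (auto simp: n_def)
  have ker: "rees_kernel A gs = {P \<in> mpolys A n. rees_map gs P = 0}"
    by (simp add: rees_kernel_def a_kernel_def' n_def ring_of_type_algebra_def)
  have "Idl\<^bsub>mpoly_ring A n\<^esub> ?L \<subseteq> rees_kernel A gs"
    unfolding ker by (intro T.Idl_minimal rs.kernel_ideal T.type_subring_axioms) (use gen in \<open>auto simp: n_def\<close>)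
  moreover have "rees_kernel A gs \<subseteq> Idl\<^bsub>mpoly_ring A n\<^esub> ?L"
  proof
    fix P assume "P \<in> rees_kernel A gs"
    then have P: "P \<in> mpolys A n" "rees_map gs P = 0" by (auto simp: ker)
    obtain S p where S: "finite S" "\<And>d. hpoly {..<n} d (p d)" "P = (\<Sum>d\<in>S. p d)"
      using mpolys_graded[OF P(1)] by blast
    have hom: "rees_map gs (p d) = Polynomial.monom (geval (\<lambda>a. a) ((!) gs) (p d)) d" for d
      unfolding rees_map_eq_geval by (rule rees_hpoly[OF S(2)])
    have "geval (\<lambda>a. a) ((!) gs) (p d) = 0" if "d \<in> S" for d
    proof -
      have "0 = poly.coeff (rees_map gs P) d" using P(2) by simp
      also have "\<dots> = (\<Sum>e\<in>S. if e = d then geval (\<lambda>a. a) ((!) gs) (p e) else 0)"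
        unfolding S(3) rs.sum hom coeff_sum by (rule sum.cong) auto
      finally show ?thesis using S(1) that by simp
    qed
    then have "rel {..<n} {} d (p d)" if "d \<in> S" for d
      using rel[of d "p d"] S(2) that by (simp add: n_def)
    then have "p d \<in> Idl\<^bsub>mpoly_ring A n\<^esub> ?L" if "d \<in> S" for d
      using that gen by (intro rel_subset_Idl) (auto simp: n_def)
    then show "P \<in> Idl\<^bsub>mpoly_ring A n\<^esub> ?L"
      unfolding S(3) by (rule T.ideal_sum[OF T.Idl_ideal[OF L]])
  qed
  ultimately have "rees_kernel A gs = Idl\<^bsub>mpoly_ring A n\<^esub> ?L" by blast
  moreover have "?L \<subseteq> {P \<in> mpolys A (length gs). homogeneous 1 P}"
    using gen by (auto simp: n_def)
  ultimately show ?thesis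
    unfolding linear_type_def n_def using gs by blast
qed

end

lemmas eval_simps = rhom.zero[OF rhom.rhom_geval[OF rhom_id]] rhom.diff[OF rhom.rhom_geval[OF rhom_id]]
  rhom.sum[OF rhom.rhom_geval[OF rhom_id]] rhom.power[OF rhom.rhom_geval[OF rhom_id]]
  rhom.geval_const[OF rhom_id] rhom.geval_add[OF rhom_id] rhom.geval_mult[OF rhom_id] rhom.geval_mvar[OF rhom_id]

lemma homogeneous_linear_diff: "homogeneous 1 (const a * mvar i - const b * mvar j)"
  using homogeneous_add[OF homogeneous_const_mult_mvar homogeneous_uminus[OF homogeneous_const_mult_mvar]]
  by fastforce

section \<open>Ideals generated by regular sequences\<close>

locale koszul_relations = linear_relations A N y Q "\<lambda>i j. const (y i) * mvar j - const (y j) * mvar i"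
  for A :: "'a::idom set" and N y Q
begin

text \<open>The relation for \<open>u\<close> and \<open>i\<close> replaces
  \<open>y u * mvar i\<close> by \<open>y i * mvar u\<close>. Each monomial needs a variable to
  trade in, hence the positive degree.\<close>

lemma swap_variable:
  assumes "hpoly U (Suc d) G" "U \<subseteq> N"
  shows "\<exists>G'. hpoly U d G' \<and> rel (insert u U) B (Suc d) (const (y u) * G - mvar u * G')"
  using assms(1)
proof (induction "Suc d" G rule: hpoly.induct)
  case zero
  then show ?case by (intro exI[of _ 0]) (auto intro: hpoly.zero rel.zero)
next
  case (var P i)
  have "rel (insert u U) B (Suc d) (P * (const (y u) * mvar i - const (y i) * mvar u))"
    by (rule rel.gen[OF hpoly_mono[OF var(1)]]) (use var(3) in auto)
  also have "P * (const (y u) * mvar i - const (y i) * mvar u) =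
      const (y u) * (mvar i * P) - mvar u * (const (y i) * P)"
    by (simp add: algebra_simps)
  finally show ?case
    using var assms(2) by (intro exI[of _ "const (y i) * P"] conjI hpoly_const_mult y_mem) auto
next
  case (add P P')
  then obtain G G' where G: "hpoly U d G" "rel (insert u U) B (Suc d) (const (y u) * P - mvar u * G)"
    "hpoly U d G'" "rel (insert u U) B (Suc d) (const (y u) * P' - mvar u * G')" by auto
  have "const (y u) * (P + P') - mvar u * (G + G') =
      (const (y u) * P - mvar u * G) + (const (y u) * P' - mvar u * G')"
    by (simp add: algebra_simps)
  then show ?case
    by (intro exI[of _ "G + G'"] conjI hpoly.add[OF G(1,3)]) (simp only: rel.add[OF G(2,4)])
qed

text \<open>
  Write \<open>P = P0 + mvar u * P1\<close> with \<open>P0\<close> free of \<open>mvar u\<close>. Modulo \<open>y u\<close>, \<open>P0\<close> is a relation for \<open>U\<close>, and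
  multiples of \<open>y u\<close> in positive degree are congruent to multiples of \<open>mvar u\<close>; so \<open>P\<close> is congruent to
  \<open>mvar u\<close> times a relation of smaller degree.
\<close>

lemma relI:
  assumes "finite U" "U \<union> B \<subseteq> N" "U \<inter> B = {}" "hpoly U d P" "geval (\<lambda>a. a) y P \<in> Q B"
  shows "rel U B d P"
  using assms
proof (induction U arbitrary: B d P rule: finite_induct)
  case empty
  show ?case
  proof (cases d)
    case 0
    then obtain a where a: "a \<in> A" "P = const a" using hpoly_0E empty by blast
    have "rel {} B 0 (const a * const 1)"
      by (rule rel.coeff[OF hpoly.const]) (use empty a in \<open>auto simp: eval_simps\<close>)
    then show ?thesis using a 0 by (simp add: rhom.one[OF rhom_const])
  next
    case (Suc e)
    then show ?thesis using empty(3) hpoly_emptyE rel.zero by blast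
  qed
next
  case (insert u U)
  have N: "insert u B \<subseteq> N" "B \<subseteq> N" "U \<subseteq> N" "u \<in> N" and uB: "u \<notin> B"
    using insert.prems by auto
  note QB = Q_ideal[OF N(2)] and QuB = Q_ideal[OF N(1)]
  have ymem: "\<And>i. i \<in> insert u U \<Longrightarrow> y i \<in> A" using N y_mem by blast
  show ?case
    using insert.prems(3,4)
  proof (induction d arbitrary: P)
    case 0
    then obtain a where a: "a \<in> A" "P = const a" using hpoly_0E by blast
    have "rel (insert u U) B 0 (const a * const 1)"
      by (rule rel.coeff[OF hpoly.const]) (use 0 a in \<open>auto simp: eval_simps\<close>)
    then show ?case using a by (simp add: rhom.one[OF rhom_const])
  next
    case (Suc d)
    obtain P0 P1 where P: "hpoly U (Suc d) P0" "hpoly (insert u U) d P1" "P = P0 + mvar u * P1"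
      using hpoly_split[OF Suc.prems(1)] by blast
    let ?E = "geval (\<lambda>a. a) y"
    have E1: "?E P1 \<in> A" by (rule hpoly_eval_mem[OF P(2) ymem])
    have "?E P0 = ?E P - y u * ?E P1" by (simp add: P(3) eval_simps)
    also have "\<dots> \<in> Q (insert u B)"
      using Suc.prems(2) Q_mono[OF N(1)] y_in_Q[OF N(1)] E1
      by (intro idealD(7)[OF QuB] idealD(5)[OF QuB]) auto
    finally have "rel U (insert u B) (Suc d) P0"
      using insert.prems insert.hyps by (intro insert.IH P(1)) auto
    then obtain G where G: "hpoly U (Suc d) G" "rel U B (Suc d) (P0 - const (y u) * G)"
      using rel_insertE N(1) by blast
    obtain G' where G': "hpoly U d G'" "rel (insert u U) B (Suc d) (const (y u) * G - mvar u * G')"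
      using swap_variable[OF G(1) N(3)] by blast
    have R: "rel (insert u U) B (Suc d) ((P0 - const (y u) * G) + (const (y u) * G - mvar u * G'))"
      by (rule rel.add[OF rel_mono[OF G(2)] G'(2)]) auto
    have h: "hpoly (insert u U) d (P1 + G')"
      by (rule hpoly.add[OF P(2) hpoly_mono[OF G'(1)]]) auto
    have "?E ((P0 - const (y u) * G) + (const (y u) * G - mvar u * G')) \<in> Q B"
      by (rule rel_eval[OF R N(2) ymem]) (auto simp: eval_simps)
    then have "?E P - ?E ((P0 - const (y u) * G) + (const (y u) * G - mvar u * G')) \<in> Q B"
      by (rule idealD(7)[OF QB Suc.prems(2)])
    also have "?E P - ?E ((P0 - const (y u) * G) + (const (y u) * G - mvar u * G')) = y u * ?E (P1 + G')"
      by (simp add: P(3) eval_simps algebra_simps)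
    \<comment> \<open>\<open>P1 + G'\<close> has degree \<open>d\<close>, so after cancelling
      \<open>y u\<close> modulo \<open>Q B\<close> the inner induction applies to it.\<close>
    finally have "?E (P1 + G') \<in> Q B"
      by (rule Q_cancel[OF N(1) uB hpoly_eval_mem[OF h ymem], rotated])
    then have "rel (insert u U) B (Suc d) (mvar u * (P1 + G'))"
      by (intro rel_mvar_mult Suc.IH h) auto
    from rel.add[OF R this] show ?case
      by (simp add: P(3) algebra_simps)
  qed
qed

lemma linear_type:
  assumes "N = {..<n}"
  shows "linear_type A (Idl\<^bsub>subring_of A\<^esub> (y ` {..<n}))"
proof -
  have gs: "set (map y [0..<n]) = y ` {..<n}" by auto
  have y: "y i \<in> A" if "i < n" for i using y_mem that assms by auto
  interpret T: type_subring "mpolys A n" by (rule type_subring_mpolys)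
  show ?thesis
    unfolding gs[symmetric]
  proof (rule linear_typeI)
    fix i j assume ij: "i < length (map y [0..<n])" "j < length (map y [0..<n])"
    have "rees_map (map y [0..<n]) (const (y i) * mvar j - const (y j) * mvar i) = 0"
      using ij by (simp add: rees_map_eq_geval rhom.diff[OF rhom.rhom_geval[OF rhom_pconst]]
        rhom.geval_mult[OF rhom_pconst] rhom.geval_const[OF rhom_pconst] rhom.geval_mvar[OF rhom_pconst])
    then show "const (y i) * mvar j - const (y j) * mvar i \<in> mpolys A (length (map y [0..<n])) \<and>
        homogeneous 1 (const (y i) * mvar j - const (y j) * mvar i) \<and>
        rees_map (map y [0..<n]) (const (y i) * mvar j - const (y j) * mvar i) = 0"
      using ij by (intro conjI homogeneous_linear_diff) (auto intro!: T.diff_mem T.mult_mem simp: y)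
  next
    fix d P assume P: "hpoly {..<length (map y [0..<n])} d P" "geval (\<lambda>a. a) ((!) (map y [0..<n])) P = 0"
    have "geval (\<lambda>a. a) y P = geval (\<lambda>a. a) ((!) (map y [0..<n])) P"
      by (rule geval_cong[OF rhom_id _ _ rhom_id, of _ n]) (use hpoly_mem_mpolys[OF P(1), of n] in auto)
    then show "rel {..<length (map y [0..<n])} {} d P"
      using P assms by (intro relI) (auto simp: Q_empty)
  qed (use y in auto)
qed

end

section \<open>Star configurations of height two\<close>

text \<open>Fixing \<open>i\<close> and letting \<open>j\<close> vary over the other indices, the
  coefficient vectors of these forms are the columns of a matrix whose maximal minors are, up to
  sign, the products of all \<open>y k\<close> but one. Those products are the generators considered
  here.\<close>

locale hilbert_burch_relations = linear_relations A N y Q "\<lambda>i j. const (y i) * mvar i - const (y j) * mvar j"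
  for A :: "'a::idom set" and N y Q
begin

definition cofactor :: "nat set \<Rightarrow> nat \<Rightarrow> 'a" where
  "cofactor U i = (\<Prod>j\<in>U - {i}. y j)"

lemma cofactor_mem: "U \<subseteq> N \<Longrightarrow> cofactor U i \<in> A"
  unfolding cofactor_def by (intro prod_mem y_mem) auto

lemma y_cofactor: "finite U \<Longrightarrow> i \<in> U \<Longrightarrow> y i * cofactor U i = (\<Prod>j\<in>U. y j)"
  unfolding cofactor_def by (simp add: prod.remove)

lemma Q_cancel_power:
  assumes "insert u B \<subseteq> N" "u \<notin> B" "a \<in> A" "y u ^ k * a \<in> Q B"
  shows "a \<in> Q B"
  using assms(4)
proof (induction k)
  case (Suc k)
  have "y u ^ k * a \<in> A" using assms y_mem by (intro mult_mem power_mem) auto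
  then show ?case using Q_cancel[OF assms(1,2), of "y u ^ k * a"] Suc by (simp add: mult.assoc)
qed simp

lemma Q_cancel_prod:
  assumes "finite U" "U \<union> B \<subseteq> N" "U \<inter> B = {}" "a \<in> A" "(\<Prod>j\<in>U. y j) ^ k * a \<in> Q B"
  shows "a \<in> Q B"
  using assms
proof (induction U arbitrary: a rule: finite_induct)
  case (insert u U)
  have a: "(\<Prod>j\<in>U. y j) ^ k * a \<in> A"
    using insert.prems y_mem by (intro mult_mem power_mem prod_mem) auto
  have "y u ^ k * ((\<Prod>j\<in>U. y j) ^ k * a) \<in> Q B"
    using insert.prems(4) insert.hyps by (simp add: power_mult_distrib mult.assoc)
  then have "(\<Prod>j\<in>U. y j) ^ k * a \<in> Q B"
    using insert.prems by (intro Q_cancel_power[OF _ _ a]) auto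
  then show ?case using insert by auto
qed simp

text \<open>Each cofactor with index in \<open>U\<close> gains the factor \<open>y u\<close>, once
  per variable of a monomial.\<close>

lemma eval_cofactor_insert:
  assumes "finite U" "u \<notin> U" "hpoly U d P"
  shows "geval (\<lambda>a. a) (cofactor (insert u U)) P = y u ^ d * geval (\<lambda>a. a) (cofactor U) P"
  using assms(3)
proof (induction rule: hpoly.induct)
  case (var d P i)
  have "insert u U - {i} = insert u (U - {i})" using var assms by auto
  then have "cofactor (insert u U) i = y u * cofactor U i"
    using assms by (simp add: cofactor_def)
  then show ?case using var by (simp add: eval_simps)
qed (auto simp: eval_simps algebra_simps)

text \<open>
  The coefficient of the highest power of \<open>mvar u\<close> can be removed: modulo \<open>y u\<close> it is a relation for
  \<open>U\<close>, and a multiple of \<open>y u * mvar u\<close> is congruent to one of \<open>y v * mvar v\<close>.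
\<close>

lemma relI:
  assumes "finite U" "U \<noteq> {}" "U \<union> B \<subseteq> N" "U \<inter> B = {}" "hpoly U d P" "geval (\<lambda>a. a) (cofactor U) P \<in> Q B"
  shows "rel U B d P"
  using assms
proof (induction U arbitrary: B d P rule: finite_ne_induct)
  case (singleton u)
  obtain a where a: "a \<in> A" "P = const a * mvar u ^ d" using hpoly_singletonE singleton by blast
  \<comment> \<open>An empty product: a single form gives the unit ideal, and the value of
    \<open>P\<close> is its coefficient. This is why the induction starts at one element.\<close>
  have "cofactor {u} u = 1" by (simp add: cofactor_def)
  then have "a \<in> Q B" using singleton(4) a by (simp add: eval_simps)
  then show ?case unfolding a(2) by (intro rel.coeff hpoly_power) auto
next
  case (insert u U)
  obtain v where v: "v \<in> U" using insert.hyps by auto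
  have N: "insert u B \<subseteq> N" "B \<subseteq> N" "insert u U \<subseteq> N" "u \<in> N" "U \<subseteq> N" and uB: "u \<notin> B"
    using insert.prems by auto
  note QB = Q_ideal[OF N(2)] and QuB = Q_ideal[OF N(1)]
  let ?E = "geval (\<lambda>a. a) (cofactor (insert u U))" and ?E' = "geval (\<lambda>a. a) (cofactor U)"
  define Y where "Y = (\<Prod>j\<in>U. y j)"
  have YA: "Y \<in> A" unfolding Y_def using N y_mem by (intro prod_mem) auto
  have yu: "y u \<in> A" using N y_mem by auto
  have Eu: "cofactor (insert u U) u = Y"
    using insert.hyps by (simp add: cofactor_def Y_def)
  have E'A: "?E' G \<in> A" if "hpoly U k G" for k G
    using hpoly_eval_mem[OF that] cofactor_mem N(5) by blast
  have Esum: "?E (\<Sum>k\<le>K. mvar u ^ k * p k) = (\<Sum>k\<le>K. Y ^ k * (y u ^ (d - k) * ?E' (p k)))"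
    if "\<And>k. k \<le> K \<Longrightarrow> hpoly U (d - k) (p k)" for K p
  proof -
    have "?E (p k) = y u ^ (d - k) * ?E' (p k)" if "k \<le> K" for k
      by (rule eval_cofactor_insert) (use insert.hyps \<open>\<And>k. k \<le> K \<Longrightarrow> hpoly U (d - k) (p k)\<close> that in auto)
    then show ?thesis by (simp add: eval_simps Eu)
  qed
  \<comment> \<open>\<open>K\<close> bounds the power of \<open>mvar u\<close> while the total
    degree \<open>d\<close> stays fixed. At \<open>K = 0\<close> the variable is gone and the
    hypothesis for \<open>U\<close> applies.\<close>
  have main: "rel (insert u U) B d (\<Sum>k\<le>K. mvar u ^ k * p k)"
    if "K \<le> d" "\<And>k. k \<le> K \<Longrightarrow> hpoly U (d - k) (p k)" "?E (\<Sum>k\<le>K. mvar u ^ k * p k) \<in> Q B" for K p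
    using that
  proof (induction K arbitrary: p)
    case 0
    have p: "hpoly U d (p 0)" using 0(2)[of 0] by simp
    have "y u ^ d * ?E' (p 0) \<in> Q B"
      using 0(3) eval_cofactor_insert[OF insert.hyps(1,3) p] by simp
    then have "?E' (p 0) \<in> Q B" by (rule Q_cancel_power[OF N(1) uB E'A[OF p]])
    then have "rel U B d (p 0)" using insert.prems p by (intro insert.IH) auto
    then show ?case using rel_mono[of U B d "p 0" "insert u U"] by auto
  next
    case (Suc K)
    define e where "e = d - Suc K"
    have dK: "d - K = Suc e" using Suc.prems(1) by (simp add: e_def)
    have p: "hpoly U e (p (Suc K))" using Suc.prems(2)[of "Suc K"] by (simp add: e_def)
    \<comment> \<open>The value of the sum divided by \<open>y u ^ e\<close>: the summand
      \<open>k\<close> has value \<open>Y ^ k * y u ^ (d - k) * ?E' (p k)\<close>, and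
      \<open>e = d - Suc K\<close> is the smallest of these exponents of \<open>y u\<close>.\<close>
    define W where "W = Y ^ Suc K * ?E' (p (Suc K)) + y u * (\<Sum>k\<le>K. Y ^ k * (y u ^ (K - k) * ?E' (p k)))"
    have pA: "?E' (p k) \<in> A" if "k \<le> Suc K" for k using E'A Suc.prems(2) that by blast
    have RA: "(\<Sum>k\<le>K. Y ^ k * (y u ^ (K - k) * ?E' (p k))) \<in> A"
      using pA YA yu by (intro sum_mem mult_mem power_mem) auto
    have WA: "W \<in> A"
      unfolding W_def using pA[of "Suc K"] YA yu RA by (intro add_mem mult_mem power_mem) auto
    have "y u ^ e * W = ?E (\<Sum>k\<le>Suc K. mvar u ^ k * p k)"
    proof -
      have "y u ^ e * (y u * (Y ^ k * (y u ^ (K - k) * c))) = Y ^ k * (y u ^ (d - k) * c)" if "k \<le> K" for k c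
      proof -
        have "d - k = e + 1 + (K - k)" using that Suc.prems(1) by (simp add: e_def)
        then have "y u ^ (d - k) = y u ^ e * y u * y u ^ (K - k)"
          by (simp only: power_add power_one_right)
        then show ?thesis by (simp add: mult_ac)
      qed
      then have "y u ^ e * (y u * (\<Sum>k\<le>K. Y ^ k * (y u ^ (K - k) * ?E' (p k)))) =
          (\<Sum>k\<le>K. Y ^ k * (y u ^ (d - k) * ?E' (p k)))"
        unfolding sum_distrib_left by (intro sum.cong) auto
      moreover have "?E (\<Sum>k\<le>Suc K. mvar u ^ k * p k) =
          (\<Sum>k\<le>Suc K. Y ^ k * (y u ^ (d - k) * ?E' (p k)))"
        by (rule Esum) (rule Suc.prems(2))
      ultimately show ?thesis
        unfolding W_def by (simp add: e_def algebra_simps)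
    qed
    then have "y u ^ e * W \<in> Q B" using Suc.prems(3) by simp
    then have "W \<in> Q B" by (rule Q_cancel_power[OF N(1) uB WA])
    then have "W - y u * (\<Sum>k\<le>K. Y ^ k * (y u ^ (K - k) * ?E' (p k))) \<in> Q (insert u B)"
      using Q_mono[OF N(1)] RA y_in_Q[OF N(1)] by (intro idealD(7)[OF QuB] idealD(5)[OF QuB]) auto
    \<comment> \<open>Modulo \<open>y u\<close> only the first summand of \<open>W\<close> survives;
      the factors of \<open>Y\<close> have indices outside \<open>insert u B\<close> and can be
      cancelled.\<close>
    then have top: "Y ^ Suc K * ?E' (p (Suc K)) \<in> Q (insert u B)" by (simp add: W_def)
    have "?E' (p (Suc K)) \<in> Q (insert u B)"
      by (rule Q_cancel_prod[OF insert.hyps(1) _ _ pA[OF order.refl] top[unfolded Y_def]])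
        (use insert.prems(1,2) insert.hyps(3) in auto)
    then have "rel U (insert u B) e (p (Suc K))"
      using insert.prems insert.hyps p by (intro insert.IH) auto
    then obtain G where G: "hpoly U e G" "rel U B e (p (Suc K) - const (y u) * G)"
      using rel_insertE N(1) by blast
    have d1: "Suc K + e = d" "K + Suc e = d" using Suc.prems(1) by (simp_all add: e_def)
    have R1: "rel (insert u U) B d (mvar u ^ Suc K * (p (Suc K) - const (y u) * G))"
      using rel_mvar_power_mult[OF rel_mono[OF G(2) subset_insertI] insertI1, of u "Suc K"]
      unfolding d1 .
    have "rel (insert u U) B (Suc e) (G * (const (y u) * mvar u - const (y v) * mvar v))"
      by (rule rel.gen[OF hpoly_mono[OF G(1) subset_insertI]]) (use v in auto)
    then have R2: "rel (insert u U) B d (mvar u ^ K * (G * (const (y u) * mvar u - const (y v) * mvar v)))"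
      using rel_mvar_power_mult[OF _ insertI1, of u U B "Suc e" _ K] unfolding d1 by blast
    let ?R = "mvar u ^ Suc K * (p (Suc K) - const (y u) * G) +
      mvar u ^ K * (G * (const (y u) * mvar u - const (y v) * mvar v))"
    have R: "rel (insert u U) B d ?R" by (rule rel.add[OF R1 R2])
    \<comment> \<open>The term \<open>y v * mvar v * G\<close> left by the exchange has degree
      \<open>e + 1 = d - K\<close> and does not involve \<open>mvar u\<close>, so it is absorbed
      into the coefficient of \<open>mvar u ^ K\<close>.\<close>
    define p' where "p' k = (if k = K then p K + const (y v) * (mvar v * G) else p k)" for k
    have sum_p': "(\<Sum>k\<le>K. mvar u ^ k * p' k) = (\<Sum>k\<le>K. mvar u ^ k * p k) + mvar u ^ K * (const (y v) * (mvar v * G))"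
    proof -
      have "(\<Sum>k\<le>K. mvar u ^ k * p' k) =
          (\<Sum>k\<le>K. mvar u ^ k * p k + (if k = K then mvar u ^ K * (const (y v) * (mvar v * G)) else 0))"
        by (intro sum.cong) (auto simp: p'_def algebra_simps)
      then show ?thesis by (simp add: sum.distrib)
    qed
    have eq: "(\<Sum>k\<le>Suc K. mvar u ^ k * p k) = (\<Sum>k\<le>K. mvar u ^ k * p' k) + ?R"
      unfolding sum_p' by (simp add: algebra_simps)
    have "hpoly U (Suc e) (const (y v) * (mvar v * G))"
      using G(1) v N y_mem by (intro hpoly_const_mult hpoly.var) auto
    then have hp': "hpoly U (d - k) (p' k)" if "k \<le> K" for k
      using Suc.prems(2)[of k] that dK by (auto simp: p'_def intro: hpoly.add)
    have "?E ?R \<in> Q B"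
    proof (rule rel_eval[OF R N(2)])
      fix i j assume "i \<in> insert u U" "j \<in> insert u U"
      then show "?E (const (y i) * mvar i - const (y j) * mvar j) = 0"
        using y_cofactor[of "insert u U"] insert.hyps by (simp only: eval_simps) simp
    qed (use cofactor_mem[OF N(3)] in auto)
    then have "?E (\<Sum>k\<le>Suc K. mvar u ^ k * p k) - ?E ?R \<in> Q B"
      by (rule idealD(7)[OF QB Suc.prems(3)])
    also have "?E (\<Sum>k\<le>Suc K. mvar u ^ k * p k) - ?E ?R = ?E (\<Sum>k\<le>K. mvar u ^ k * p' k)"
      unfolding eq by (subst rhom.geval_add[OF rhom_id]) simp
    finally have "rel (insert u U) B d (\<Sum>k\<le>K. mvar u ^ k * p' k)"
      using Suc.prems(1) hp' by (intro Suc.IH) auto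
    from rel.add[OF this R] show ?case unfolding eq .
  qed
  obtain p where "\<forall>k\<le>d. hpoly U (d - k) (p k)" "P = (\<Sum>k\<le>d. mvar u ^ k * p k)"
    using hpoly_decomp[OF insert.prems(3)] by blast
  then show ?case using main[of d p] insert.prems(4) by auto
qed

lemma linear_type:
  assumes "N = {..<n}" "n > 0"
  shows "linear_type A (Idl\<^bsub>subring_of A\<^esub> (cofactor {..<n} ` {..<n}))"
proof -
  let ?y = "cofactor {..<n}"
  have gs: "set (map ?y [0..<n]) = ?y ` {..<n}" by auto
  have y: "y i \<in> A" if "i < n" for i using y_mem that assms by auto
  have cy: "?y i \<in> A" for i using cofactor_mem assms by auto
  interpret T: type_subring "mpolys A n" by (rule type_subring_mpolys)
  show ?thesis
    unfolding gs[symmetric]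
  proof (rule linear_typeI)
    fix i j assume ij: "i < length (map ?y [0..<n])" "j < length (map ?y [0..<n])"
    have "y i * ?y i = y j * ?y j" using ij by (subst (1 2) y_cofactor) auto
    then have "rees_map (map ?y [0..<n]) (const (y i) * mvar i - const (y j) * mvar j) = 0"
      using ij by (simp add: mult.commute rees_map_eq_geval rhom.diff[OF rhom.rhom_geval[OF rhom_pconst]]
        rhom.geval_mult[OF rhom_pconst] rhom.geval_const[OF rhom_pconst] rhom.geval_mvar[OF rhom_pconst])
    then show "const (y i) * mvar i - const (y j) * mvar j \<in> mpolys A (length (map ?y [0..<n])) \<and>
        homogeneous 1 (const (y i) * mvar i - const (y j) * mvar j) \<and>
        rees_map (map ?y [0..<n]) (const (y i) * mvar i - const (y j) * mvar j) = 0"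
      using ij by (intro conjI homogeneous_linear_diff) (auto intro!: T.diff_mem T.mult_mem simp: y)
  next
    fix d P assume P: "hpoly {..<length (map ?y [0..<n])} d P" "geval (\<lambda>a. a) ((!) (map ?y [0..<n])) P = 0"
    have "geval (\<lambda>a. a) ?y P = geval (\<lambda>a. a) ((!) (map ?y [0..<n])) P"
      by (rule geval_cong[OF rhom_id _ _ rhom_id, of _ n]) (use hpoly_mem_mpolys[OF P(1), of n] in auto)
    then have "rel {..<n} {} d P"
      using P assms by (intro relI) (auto simp: Q_empty)
    then show "rel {..<length (map ?y [0..<n])} {} d P" by simp
  qed (use cy in auto)
qed

end

section \<open>Products in prime ideals and colon ideals\<close>

context type_subring
begin

lemma prod_mem_prime:
  assumes "primeideal P (subring_of A)" "finite S" "\<And>i. i \<in> S \<Longrightarrow> f i \<in> A" "prod f S \<in> P"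
  shows "\<exists>i\<in>S. f i \<in> P"
  using assms(2-)
proof (induction S rule: finite_induct)
  case empty
  then show ?case using assms(1) by (simp add: primeideal_iff)
next
  case (insert s S)
  then have "f s \<in> A" "prod f S \<in> A" "f s * prod f S \<in> P" by (auto intro: prod_mem)
  then have "f s \<in> P \<or> prod f S \<in> P" using assms(1) unfolding primeideal_iff by blast
  then show ?case using insert by auto
qed

lemma prod_mem_ideal:
  assumes "ideal I (subring_of A)" "finite S" "\<And>i. i \<in> S \<Longrightarrow> f i \<in> A" "s \<in> S" "f s \<in> I"
  shows "prod f S \<in> I"
  using assms by (subst prod.remove[of S s]) (auto intro!: idealD(5)[OF assms(1)] prod_mem)

lemma colon_ideal:
  assumes "ideal I (subring_of A)" "g \<in> A"
  shows "ideal {a \<in> A. a * g \<in> I} (subring_of A)"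
  unfolding ideal_iff
  by (auto simp: distrib_right mult.assoc intro: idealD(2,3,4)[OF assms(1)])

end

section \<open>Generators of star configurations\<close>

text \<open>For \<open>c > card G\<close> the intersection would be over an empty family and hence
  be the whole type.\<close>

lemma star_ideal_subset:
  assumes "c \<le> card G" "finite G" "G \<subseteq> mpolys UNIV n"
  shows "star_ideal n c G \<subseteq> mpolys UNIV n"
proof -
  obtain S where S: "S \<subseteq> G" "card S = c" using obtain_subset_with_card_n[OF assms(1)] by blast
  then have "star_ideal n c G \<subseteq> Idl\<^bsub>mpoly_ring UNIV n\<^esub> S" by (auto simp: star_ideal_def)
  also have "\<dots> \<subseteq> mpolys UNIV n" using S assms by (intro mp.idealD(1)[OF mp.Idl_ideal]) auto
  finally show ?thesis .
qed

text \<open>\<open>card G + 1 - c\<close> is the least size that forces a subset of \<open>G\<close>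
  to meet every subset with \<open>c\<close> elements; the complement has \<open>c - 1\<close>
  elements.\<close>

definition star_products :: "nat \<Rightarrow> 'k::field mpoly set \<Rightarrow> 'k mpoly set set" where
  "star_products c G = {W. W \<subseteq> G \<and> card W = card G + 1 - c}"

lemma finite_star_products: "finite G \<Longrightarrow> finite (star_products c G)"
  unfolding star_products_def by simp

lemma star_products_2:
  assumes "finite G" "2 \<le> card G"
  shows "star_products 2 G = (\<lambda>g. G - {g}) ` G"
proof
  show "(\<lambda>g. G - {g}) ` G \<subseteq> star_products 2 G"
    using assms by (auto simp: star_products_def)
  show "star_products 2 G \<subseteq> (\<lambda>g. G - {g}) ` G"
  proof
    fix W assume "W \<in> star_products 2 G"
    then have W: "W \<subseteq> G" "card W = card G - 1" by (auto simp: star_products_def)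
    then have "card (G - W) = 1"
      using assms finite_subset[OF W(1)] by (simp add: card_Diff_subset)
    then obtain g where "G - W = {g}" using card_1_singletonE by blast
    then have "W = G - {g}" "g \<in> G" using W by auto
    then show "W \<in> (\<lambda>g. G - {g}) ` G" by auto
  qed
qed

text \<open>By counting, \<open>W\<close> and \<open>S\<close> have a common element, and this
  factor puts the product into the ideal generated by \<open>S\<close>.\<close>

lemma Idl_star_products_subset:
  assumes "finite G" "G \<subseteq> mpolys UNIV n" "c \<le> card G"
  shows "Idl\<^bsub>mpoly_ring UNIV n\<^esub> (\<Prod> ` star_products c G) \<subseteq> star_ideal n c G"
  unfolding star_ideal_def
proof (rule INT_greatest)
  fix S assume S: "S \<in> {S. S \<subseteq> G \<and> card S = c}"
  then have SD: "S \<subseteq> mpolys UNIV n" using assms by auto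
  show "Idl\<^bsub>mpoly_ring UNIV n\<^esub> (\<Prod> ` star_products c G) \<subseteq> Idl\<^bsub>mpoly_ring UNIV n\<^esub> S"
  proof (intro mp.Idl_minimal mp.Idl_ideal SD image_subsetI)
    fix W assume "W \<in> star_products c G"
    then have W: "W \<subseteq> G" "card W = card G + 1 - c" by (auto simp: star_products_def)
    have "W \<inter> S \<noteq> {}"
    proof
      assume "W \<inter> S = {}"
      then have "card W + card S = card (W \<union> S)"
        using W S assms(1) finite_subset by (metis (no_types, lifting) card_Un_disjoint mem_Collect_eq)
      also have "\<dots> \<le> card G" using W S assms(1) by (intro card_mono) auto
      finally show False using W S assms(3) by simp
    qed
    then obtain s where s: "s \<in> W" "s \<in> S" by auto
    show "\<Prod>W \<in> Idl\<^bsub>mpoly_ring UNIV n\<^esub> S"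
      using W(1) assms finite_subset[OF W(1)] s
      by (intro mp.prod_mem_ideal[OF mp.Idl_ideal[OF SD], of W "\<lambda>x. x" s]) (auto intro: mp.Idl_incl[OF SD])
  qed
qed

text \<open>
  Induction on \<open>G\<close>: the coefficients of an element of the ideal for \<open>G\<close> in terms of the products of
  elements of \<open>G\<close> are controlled by reduction modulo the primes generated by \<open>y\<close> and \<open>c - 1\<close> elements
  of \<open>G\<close>, as all but one of the products vanish there.
\<close>

lemma star_ideal_subset_Idl:
  fixes G :: "'k::field mpoly set"
  assumes "finite G" "G \<subseteq> linear_forms n" "1 \<le> c" "c \<le> card G"
    and "\<And>S. S \<subseteq> G \<Longrightarrow> card S \<le> c + 1 \<Longrightarrow> \<not> vdependent S"
  shows "star_ideal n c G \<subseteq> Idl\<^bsub>mpoly_ring UNIV n\<^esub> (\<Prod> ` star_products c G)"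
  using assms
proof (induction G rule: finite_induct)
  case (insert y G)
  let ?G = "insert y G"
  have D: "?G \<subseteq> mpolys UNIV n" using insert.prems(1) linear_forms_subset by blast
  have prodsD: "\<Prod> ` star_products c ?G \<subseteq> mpolys UNIV n"
    using D by (auto simp: star_products_def intro!: mp.prod_mem)
  note T = mp.Idl_ideal[OF prodsD]
  show ?case
  proof (cases "card ?G = c")
    case True
    have "star_ideal n c ?G \<subseteq> Idl\<^bsub>mpoly_ring UNIV n\<^esub> ?G"
      using True by (auto simp: star_ideal_def)
    also have "?G \<subseteq> \<Prod> ` star_products c ?G"
    proof
      fix g assume "g \<in> ?G"
      then have "{g} \<in> star_products c ?G" using True by (auto simp: star_products_def)
      then show "g \<in> \<Prod> ` star_products c ?G" by (intro image_eqI[of _ _ "{g}"]) auto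
    qed
    then have "Idl\<^bsub>mpoly_ring UNIV n\<^esub> ?G \<subseteq> Idl\<^bsub>mpoly_ring UNIV n\<^esub> (\<Prod> ` star_products c ?G)"
      by (rule mp.Idl_mono[OF prodsD])
    finally show ?thesis .
  next
    case False
    then have cG: "c \<le> card G" using insert by simp
    show ?thesis
    proof
      fix f assume f: "f \<in> star_ideal n c ?G"
      then have "f \<in> star_ideal n c G" by (auto simp: star_ideal_def)
      then have "f \<in> Idl\<^bsub>mpoly_ring UNIV n\<^esub> (\<Prod> ` star_products c G)"
        using insert.IH insert.prems cG by (meson subsetD subset_insertI2 insert_subset)
      also have "Idl\<^bsub>mpoly_ring UNIV n\<^esub> (\<Prod> ` star_products c G) =
          {\<Sum>W\<in>star_products c G. a W * \<Prod>W | a. \<forall>W\<in>star_products c G. a W \<in> mpolys UNIV n}"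
        using D insert.hyps
        by (intro mp.Idl_image_eq finite_star_products) (auto simp: star_products_def intro!: mp.prod_mem)
      finally obtain a where a: "f = (\<Sum>W\<in>star_products c G. a W * \<Prod>W)"
        "\<And>W. W \<in> star_products c G \<Longrightarrow> a W \<in> mpolys UNIV n" by auto
      have "a W * \<Prod>W \<in> Idl\<^bsub>mpoly_ring UNIV n\<^esub> (\<Prod> ` star_products c ?G)" if W: "W \<in> star_products c G" for W
      proof -
        have WG: "W \<subseteq> G" "card W = card G + 1 - c" "finite W"
          using W insert.hyps finite_subset by (auto simp: star_products_def)
        \<comment> \<open>With \<open>y\<close> these are \<open>c\<close> elements of the enlarged
          set, so \<open>f\<close> lies in the ideal they generate. Any other \<open>W'\<close> of
          the same size meets \<open>V\<close>, so only the summand for \<open>W\<close>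
          remains.\<close>
        define V where "V = G - W"
        have cV: "card V = c - 1" using WG insert.hyps cG insert.prems(2) by (simp add: V_def card_Diff_subset)
        let ?S = "insert y V"
        have S: "?S \<subseteq> ?G" "card ?S = c" "finite ?S" "?S \<subseteq> linear_forms n" "?S \<subseteq> mpolys UNIV n"
          using insert.hyps insert.prems cV D by (auto simp: V_def)
        note I = mp.Idl_ideal[OF S(5)] and P = primeideal_Idl_linear_forms[OF S(3,4)]
        have prodW: "\<Prod>W' \<in> mpolys UNIV n" if "W' \<in> star_products c G" for W'
          using that D by (auto simp: star_products_def intro!: mp.prod_mem)
        have aW: "a W * \<Prod>W \<in> Idl\<^bsub>mpoly_ring UNIV n\<^esub> ?S"
        proof (rule mp.ideal_sum_diff[OF I finite_star_products[OF insert.hyps(1), of c] W, where f = "\<lambda>W. a W * \<Prod>W"])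
          show "(\<Sum>W\<in>star_products c G. a W * \<Prod>W) \<in> Idl\<^bsub>mpoly_ring UNIV n\<^esub> ?S"
            using f S by (auto simp: star_ideal_def a(1))
          fix W' assume W': "W' \<in> star_products c G" "W' \<noteq> W"
          then have W'G: "W' \<subseteq> G" "card W' = card W" "finite W'"
            using WG insert.hyps finite_subset by (auto simp: star_products_def)
          then have "\<not> W' \<subseteq> W" using W'(2) WG card_subset_eq by blast
          then obtain v where "v \<in> W'" "v \<in> V" using W'G by (auto simp: V_def)
          then have "\<Prod>W' \<in> Idl\<^bsub>mpoly_ring UNIV n\<^esub> ?S"
            using W'G D by (intro mp.prod_mem_ideal[OF I, of W' "\<lambda>x. x" v]) (auto intro: mp.Idl_incl[OF S(5)])
          then show "a W' * \<Prod>W' \<in> Idl\<^bsub>mpoly_ring UNIV n\<^esub> ?S"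
            using a(2)[OF W'(1)] by (rule mp.idealD(4)[OF I, rotated])
        qed
        have "\<Prod>W \<notin> Idl\<^bsub>mpoly_ring UNIV n\<^esub> ?S"
        proof
          assume "\<Prod>W \<in> Idl\<^bsub>mpoly_ring UNIV n\<^esub> ?S"
          then obtain w where w: "w \<in> W" "w \<in> Idl\<^bsub>mpoly_ring UNIV n\<^esub> ?S"
            using mp.prod_mem_prime[OF P WG(3), of "\<lambda>x. x"] D WG(1) by auto
          have "w \<notin> ?S" using w(1) WG(1) insert.hyps by (auto simp: V_def)
          then have "card (insert w ?S) = c + 1" using S by simp
          then have "\<not> vdependent (insert w ?S)"
            using w(1) WG(1) S by (intro insert.prems(4)) auto
          then have "w \<notin> Idl\<^bsub>mpoly_ring UNIV n\<^esub> ?S"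
            by (rule independent_not_in_Idl[rotated 2, where n = n]) (use S w WG insert.prems \<open>w \<notin> ?S\<close> in auto)
          then show False using w(2) by blast
        qed
        then have "a W \<in> Idl\<^bsub>mpoly_ring UNIV n\<^esub> ?S"
          using aW P a(2)[OF W] prodW[OF W] unfolding mp.primeideal_iff by blast
        \<comment> \<open>For a generator \<open>s\<close> of this prime,
          \<open>s * \<Prod>W\<close> is the product over \<open>insert s W\<close>, one of the
          products for the enlarged set.\<close>
        also have "\<dots> \<subseteq> {b \<in> mpolys UNIV n. b * \<Prod>W \<in> Idl\<^bsub>mpoly_ring UNIV n\<^esub> (\<Prod> ` star_products c ?G)}"
        proof (intro mp.Idl_minimal mp.colon_ideal[OF T] prodW[OF W] subsetI CollectI conjI)
          fix s assume s: "s \<in> ?S"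
          then show "s \<in> mpolys UNIV n" using S by blast
          have "s \<notin> W" using s WG(1) insert.hyps by (auto simp: V_def)
          then have "s * \<Prod>W = \<Prod>(insert s W)" using WG by simp
          moreover have "insert s W \<in> star_products c ?G"
            using s S(1) WG insert.hyps cG \<open>s \<notin> W\<close> by (auto simp: star_products_def)
          ultimately show "s * \<Prod>W \<in> Idl\<^bsub>mpoly_ring UNIV n\<^esub> (\<Prod> ` star_products c ?G)"
            by (auto intro!: mp.Idl_incl[OF prodsD])
        qed
        finally show ?thesis by blast
      qed
      then show "f \<in> Idl\<^bsub>mpoly_ring UNIV n\<^esub> (\<Prod> ` star_products c ?G)"
        unfolding a(1) by (rule mp.ideal_sum[OF T])
    qed
  qed
qed simp

section \<open>Localization\<close>

lemma rhom_to_fract: "rhom to_fract"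
  by standard auto

locale localization = type_subring D for D :: "'a::idom set" +
  fixes p :: "'a set"
  assumes prime: "primeideal p (subring_of D)"
begin

abbreviation "loc \<equiv> localize D p"

lemma p_ideal: "ideal p (subring_of D)" and one_not_in_p: "1 \<notin> p"
  and p_prime: "a \<in> D \<Longrightarrow> b \<in> D \<Longrightarrow> a * b \<in> p \<Longrightarrow> a \<in> p \<or> b \<in> p"
  using prime unfolding primeideal_iff by blast+

lemma denominator: "b \<in> D - p \<Longrightarrow> b \<noteq> 0"
  using idealD(2)[OF p_ideal] by blast

lemma denominator_mult: "a \<in> D - p \<Longrightarrow> b \<in> D - p \<Longrightarrow> a * b \<in> D - p"
  using p_prime[of a b] by auto

lemma one_denominator: "1 \<in> D - p"
  using one_not_in_p by simp

lemma locI: "a \<in> M \<Longrightarrow> b \<in> D - p \<Longrightarrow> Fract a b \<in> loc M"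
  by (auto simp: localize_def)

lemma locE:
  assumes "x \<in> loc M"
  obtains a b where "a \<in> M" "b \<in> D - p" "b \<noteq> 0" "x = Fract a b"
  using assms denominator by (auto simp: localize_def)

lemma to_fract_in_loc: "a \<in> M \<Longrightarrow> to_fract a \<in> loc M"
  unfolding to_fract_def by (rule locI[OF _ one_denominator])

lemma loc_mono: "M \<subseteq> M' \<Longrightarrow> loc M \<subseteq> loc M'"
  by (auto simp: localize_def)

lemma loc_add:
  assumes "ideal I (subring_of D)" "x \<in> loc I" "y \<in> loc I"
  shows "x + y \<in> loc I"
proof -
  obtain a b where "a \<in> I" "b \<in> D - p" "b \<noteq> 0" "x = Fract a b"
    using assms(2) by (rule locE)
  moreover obtain a' b' where "a' \<in> I" "b' \<in> D - p" "b' \<noteq> 0" "y = Fract a' b'"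
    using assms(3) by (rule locE)
  ultimately show ?thesis
    using denominator_mult[of b b'] by (auto intro!: locI idealD(3,5)[OF assms(1)])
qed

lemma loc_mult:
  assumes "ideal I (subring_of D)" "x \<in> loc D" "y \<in> loc I"
  shows "x * y \<in> loc I"
proof -
  obtain a b where "a \<in> D" "b \<in> D - p" "b \<noteq> 0" "x = Fract a b"
    using assms(2) by (rule locE)
  moreover obtain a' b' where "a' \<in> I" "b' \<in> D - p" "b' \<noteq> 0" "y = Fract a' b'"
    using assms(3) by (rule locE)
  ultimately show ?thesis
    using denominator_mult[of b b'] by (auto intro!: locI idealD(4)[OF assms(1)])
qed

lemma ideal_carrier: "ideal D (subring_of D)"
  by (simp add: ideal_iff)

sublocale loc: type_subring "loc D"
proof
  show "1 \<in> loc D" using to_fract_in_loc[OF one_mem] by (simp add: to_fract_def One_fract_def)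
  fix x y assume x: "x \<in> loc D" and y: "y \<in> loc D"
  show "x + y \<in> loc D" "x * y \<in> loc D"
    using loc_add[OF ideal_carrier x y] loc_mult[OF ideal_carrier x y] .
  have "to_fract (-1) \<in> loc D" by (intro to_fract_in_loc uminus_mem one_mem)
  from loc_mult[OF ideal_carrier this x] show "- x \<in> loc D"
    by (simp add: rhom.uminus[OF rhom_to_fract] rhom.one[OF rhom_to_fract])
qed

lemma ideal_loc:
  assumes "ideal I (subring_of D)"
  shows "ideal (loc I) (subring_of (loc D))"
  unfolding loc.ideal_iff
  using loc_mono[OF idealD(1)[OF assms]] loc_add[OF assms] loc_mult[OF assms]
    to_fract_in_loc[OF idealD(2)[OF assms]]
  by (auto simp: rhom.zero[OF rhom_to_fract])

text \<open>As \<open>q \<subseteq> p\<close>, denominators lie outside \<open>q\<close>; clearing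
  them reduces the claim to primality of \<open>q\<close>.\<close>

lemma loc_cancel:
  assumes q: "primeideal q (subring_of D)" "q \<subseteq> p" and f: "f \<in> D" "f \<notin> q"
    and x: "x \<in> loc D" "to_fract f * x \<in> loc q"
  shows "x \<in> loc q"
proof -
  have q_ideal: "ideal q (subring_of D)" and q_prime: "\<And>a b. a \<in> D \<Longrightarrow> b \<in> D \<Longrightarrow> a * b \<in> q \<Longrightarrow> a \<in> q \<or> b \<in> q"
    using q unfolding primeideal_iff by blast+
  obtain a b where ab: "a \<in> D" "b \<in> D - p" "b \<noteq> 0" "x = Fract a b" using x(1) by (rule locE)
  obtain a' b' where ab': "a' \<in> q" "b' \<in> D - p" "b' \<noteq> 0" "to_fract f * x = Fract a' b'" using x(2) by (rule locE)
  have "f * a * b' = a' * b"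
    using ab'(4) ab(3) ab'(3) by (simp add: ab(4) to_fract_def eq_fract)
  then have "f * a * b' \<in> q" using ab ab' idealD(5)[OF q_ideal] by auto
  then have "f * a \<in> q" using q_prime[of "f * a" b'] ab' ab q(2) f by auto
  then have "a \<in> q" using q_prime f ab by blast
  then show ?thesis using ab locI by blast
qed

text \<open>If \<open>f\<close> were outside \<open>q\<close>, cancelling it would put
  \<open>1\<close> into the localized ideal, and hence a denominator into \<open>q\<close>.\<close>

lemma to_fract_in_loc_iff:
  assumes "primeideal q (subring_of D)" "q \<subseteq> p" "f \<in> D"
  shows "to_fract f \<in> loc q \<longleftrightarrow> f \<in> q"
proof
  assume f: "to_fract f \<in> loc q"
  show "f \<in> q"
  proof (rule ccontr)
    assume "f \<notin> q"
    then have "1 \<in> loc q" using loc_cancel[OF assms(1-3)] f by simp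
    then obtain a b where "a \<in> q" "b \<in> D - p" "b \<noteq> 0" "1 = Fract a b" by (rule locE)
    then have "b \<in> q" by (simp add: One_fract_def eq_fract)
    then show False using \<open>b \<in> D - p\<close> assms(2) by blast
  qed
qed (rule to_fract_in_loc)

text \<open>\<open>u\<close> is a unit of the local ring, so multiplying by it loses
  nothing.\<close>

lemma loc_eqI:
  assumes "I \<subseteq> I'" "u \<in> D - p" "\<And>f. f \<in> I' \<Longrightarrow> u * f \<in> I"
  shows "loc I = loc I'"
proof
  show "loc I \<subseteq> loc I'" by (rule loc_mono[OF assms(1)])
  show "loc I' \<subseteq> loc I"
  proof
    fix x assume "x \<in> loc I'"
    then obtain a b where ab: "a \<in> I'" "b \<in> D - p" "b \<noteq> 0" "x = Fract a b" by (rule locE)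
    then have "x = Fract (u * a) (u * b)"
      using denominator[OF assms(2)] by (simp add: eq_fract mult_ac)
    then show "x \<in> loc I" using assms(3)[OF ab(1)] denominator_mult[OF assms(2) ab(2)] locI by blast
  qed
qed

lemma loc_Idl_insertE:
  assumes "S \<subseteq> D" "g \<in> D" "x \<in> loc (Idl\<^bsub>subring_of D\<^esub> (insert g S))"
  shows "\<exists>a\<in>loc D. x - to_fract g * a \<in> loc (Idl\<^bsub>subring_of D\<^esub> S)"
proof -
  obtain f b where fb: "f \<in> Idl\<^bsub>subring_of D\<^esub> (insert g S)" "b \<in> D - p" "b \<noteq> 0" "x = Fract f b"
    using assms(3) by (rule locE)
  obtain a where a: "a \<in> D" "f - g * a \<in> Idl\<^bsub>subring_of D\<^esub> S"
    using Idl_insertE[OF assms(1,2) fb(1)] .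
  have "x - to_fract g * Fract a b = Fract (f - g * a) b"
    using fb(3) by (simp add: fb(4) to_fract_def eq_fract algebra_simps)
  then show ?thesis using a fb(2) locI by metis
qed

lemma loc_Idl:
  assumes "S \<subseteq> D"
  shows "loc (Idl\<^bsub>subring_of D\<^esub> S) = Idl\<^bsub>subring_of (loc D)\<^esub> (to_fract ` S)"
proof
  have SD: "to_fract ` S \<subseteq> loc D" using assms by (auto intro: to_fract_in_loc)
  note I = loc.Idl_ideal[OF SD]
  have "Idl\<^bsub>subring_of D\<^esub> S \<subseteq> {f \<in> D. to_fract f \<in> Idl\<^bsub>subring_of (loc D)\<^esub> (to_fract ` S)}"
  proof (intro Idl_minimal subsetI)
    show "ideal {f \<in> D. to_fract f \<in> Idl\<^bsub>subring_of (loc D)\<^esub> (to_fract ` S)} (subring_of D)"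
      unfolding ideal_iff
      by (auto simp: rhom.zero[OF rhom_to_fract] rhom.add[OF rhom_to_fract] rhom.mult[OF rhom_to_fract]
        intro!: loc.idealD(2,3,4)[OF I] to_fract_in_loc)
  qed (use assms loc.Idl_incl[OF SD] in auto)
  then show "loc (Idl\<^bsub>subring_of D\<^esub> S) \<subseteq> Idl\<^bsub>subring_of (loc D)\<^esub> (to_fract ` S)"
  proof (intro subsetI)
    fix x assume "x \<in> loc (Idl\<^bsub>subring_of D\<^esub> S)"
    then obtain a b where ab: "a \<in> Idl\<^bsub>subring_of D\<^esub> S" "b \<in> D - p" "b \<noteq> 0" "x = Fract a b" by (rule locE)
    have "x = Fract 1 b * to_fract a" by (simp add: ab(4) to_fract_def)
    moreover have "Fract 1 b \<in> loc D" using ab by (intro locI) auto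
    ultimately show "x \<in> Idl\<^bsub>subring_of (loc D)\<^esub> (to_fract ` S)"
      using loc.idealD(4)[OF I] ab(1) \<open>Idl\<^bsub>subring_of D\<^esub> S \<subseteq> _\<close> by auto
  qed
  show "Idl\<^bsub>subring_of (loc D)\<^esub> (to_fract ` S) \<subseteq> loc (Idl\<^bsub>subring_of D\<^esub> S)"
    by (intro loc.Idl_minimal ideal_loc Idl_ideal assms) (auto intro: to_fract_in_loc Idl_incl[OF assms])
qed

text \<open>The unit ideal is generated by the one-term sequence \<open>1\<close>. Its length-one
  case of the Koszul argument applies, with \<open>Q\<close> the zero ideal for no element and the
  whole ring otherwise.\<close>

lemma linear_type_unit: "linear_type (loc D) (loc D)"
proof -
  interpret koszul_relations "loc D" "{..<1}" "\<lambda>_. 1" "\<lambda>B. if B = {} then {0} else loc D"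
    by (intro koszul_relations.intro linear_relations.intro prime_sequence.intro
        prime_sequence_axioms.intro loc.type_subring_axioms)
      (auto simp: loc.ideal_iff split: if_splits)
  have "Idl\<^bsub>subring_of (loc D)\<^esub> ((\<lambda>_. 1) ` {..<1::nat}) = loc D"
    by (rule iffD2[OF loc.ideal_eq_iff_one_mem[OF loc.Idl_ideal]]) (auto intro!: loc.Idl_incl)
  then show ?thesis using linear_type[of 1] by simp
qed

end

section \<open>Linear type locus of star configurations\<close>

locale localized_star =
  fixes n c :: nat and G p :: "'k::field mpoly set"
  assumes fin: "finite G" and lin: "G \<subseteq> linear_forms n" and c: "1 \<le> c" "c \<le> card G"
    and ind: "\<And>S. S \<subseteq> G \<Longrightarrow> card S \<le> c + 1 \<Longrightarrow> \<not> vdependent S"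
    and p: "primeideal p (mpoly_ring UNIV n)" and Gp: "G \<subseteq> p"
begin

sublocale L: localization "mpolys UNIV n" p
  by (rule localization.intro[OF mp.type_subring_axioms localization_axioms.intro[OF p]])

abbreviation "A \<equiv> localize (mpolys UNIV n) p (mpolys UNIV n)"

lemma GD: "G \<subseteq> mpolys UNIV n"
  using lin linear_forms_subset by blast

lemma star_products_mem:
  assumes "W \<in> star_products c G"
  shows "W \<subseteq> G" "finite W" "\<Prod>W \<in> mpolys UNIV n"
  using assms fin finite_subset GD by (auto simp: star_products_def intro!: mp.prod_mem)

lemma Idl_subset_p: "V \<subseteq> G \<Longrightarrow> Idl\<^bsub>mpoly_ring UNIV n\<^esub> V \<subseteq> p"
  using Gp by (intro mp.Idl_minimal L.p_ideal) auto

lemma primeideal_Idl: "V \<subseteq> G \<Longrightarrow> primeideal (Idl\<^bsub>mpoly_ring UNIV n\<^esub> V) (mpoly_ring UNIV n)"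
  using fin lin finite_subset by (intro primeideal_Idl_linear_forms) blast+

lemma loc_star_ideal:
  "L.loc (star_ideal n c G) = Idl\<^bsub>subring_of A\<^esub> ((\<lambda>W. to_fract (\<Prod>W)) ` star_products c G)"
proof -
  have "star_ideal n c G = Idl\<^bsub>mpoly_ring UNIV n\<^esub> (\<Prod> ` star_products c G)"
    using star_ideal_subset_Idl[OF fin lin c ind] Idl_star_products_subset[OF fin GD c(2)] by blast
  then show ?thesis
    using L.loc_Idl[of "\<Prod> ` star_products c G"] star_products_mem(3) by (simp add: image_image image_subset_iff)
qed

text \<open>Reduce modulo the prime generated by the \<open>c - 1\<close> elements of
  \<open>V = G - W\<close>. Every other product has a factor in \<open>V\<close>, whereas
  \<open>\<Prod>W\<close> is nonzero there because \<open>V\<close> and one more element are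
  independent. So the coefficient of \<open>\<Prod>W\<close> lies in this prime, which is contained
  in \<open>p\<close>.\<close>

lemma syzygy_coefficients:
  assumes \<alpha>: "\<And>W. W \<in> star_products c G \<Longrightarrow> \<alpha> W \<in> A"
    and sum0: "(\<Sum>W\<in>star_products c G. \<alpha> W * to_fract (\<Prod>W)) = 0" and W: "W \<in> star_products c G"
  shows "\<alpha> W \<in> L.loc p"
proof -
  note WG = star_products_mem[OF W]
  define V where "V = G - W"
  have VG: "V \<subseteq> G" "finite V" "V \<subseteq> linear_forms n" "V \<subseteq> mpolys UNIV n"
    using fin lin GD by (auto simp: V_def)
  have cV: "card V = c - 1"
    using W WG c fin by (simp add: V_def card_Diff_subset star_products_def)
  let ?q = "Idl\<^bsub>mpoly_ring UNIV n\<^esub> V"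
  have q: "ideal ?q (mpoly_ring UNIV n)" by (rule mp.Idl_ideal[OF VG(4)])
  note Iq = L.ideal_loc[OF q]
  have "\<Prod>W \<notin> ?q"
  proof
    assume "\<Prod>W \<in> ?q"
    then obtain w where w: "w \<in> W" "w \<in> ?q"
      using mp.prod_mem_prime[OF primeideal_Idl[OF VG(1)] WG(2), of "\<lambda>x. x"] GD WG(1) by auto
    have "w \<notin> V" using w(1) by (auto simp: V_def)
    then have "card (insert w V) \<le> c + 1" using VG cV by simp
    then have "\<not> vdependent (insert w V)"
      using w(1) WG(1) VG by (intro ind) auto
    then have "w \<notin> ?q"
      by (rule independent_not_in_Idl[rotated 2, where n = n]) (use VG w WG lin \<open>w \<notin> V\<close> in auto)
    then show False using w(2) by blast
  qed
  moreover have "\<alpha> W * to_fract (\<Prod>W) \<in> L.loc ?q"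
  proof (rule L.loc.ideal_sum_diff[OF Iq finite_star_products[OF fin] W, where f = "\<lambda>W. \<alpha> W * to_fract (\<Prod>W)"])
    show "(\<Sum>W\<in>star_products c G. \<alpha> W * to_fract (\<Prod>W)) \<in> L.loc ?q"
      unfolding sum0 by (rule L.loc.idealD(2)[OF Iq])
    fix W' assume W': "W' \<in> star_products c G" "W' \<noteq> W"
    note W'G = star_products_mem[OF W'(1)]
    have "\<not> W' \<subseteq> W"
      using W' W WG card_subset_eq[of W W'] by (auto simp: star_products_def)
    then obtain v where "v \<in> W'" "v \<in> V" using W'G by (auto simp: V_def)
    then have "\<Prod>W' \<in> ?q"
      using W'G GD by (intro mp.prod_mem_ideal[OF q, of W' "\<lambda>x. x" v]) (auto intro: mp.Idl_incl[OF VG(4)])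
    then show "\<alpha> W' * to_fract (\<Prod>W') \<in> L.loc ?q"
      by (rule L.loc.idealD(4)[OF Iq \<alpha>[OF W'(1)] L.to_fract_in_loc])
  qed
  ultimately have "\<alpha> W \<in> L.loc ?q"
    using L.loc_cancel[OF primeideal_Idl[OF VG(1)] Idl_subset_p[OF VG(1)] WG(3)] \<alpha>[OF W]
    by (simp add: mult.commute)
  then show ?thesis using L.loc_mono[OF Idl_subset_p[OF VG(1)]] by blast
qed

text \<open>The obstruction to linear type: both negative results exhibit a relation
  \<open>P\<close> and a point \<open>t\<close> at which its value is a unit.\<close>

lemma relation_value:
  assumes lt: "linear_type A (L.loc (star_ideal n c G))"
    and e: "bij_betw e {..<m} (star_products c G)"
    and P: "P \<in> mpolys A m" "geval (\<lambda>a. [:a:]) (\<lambda>j. [:0, to_fract (\<Prod>(e j)):]) P = 0"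
    and t: "\<And>j. j < m \<Longrightarrow> t j \<in> A"
  shows "geval (\<lambda>a. a) t P \<in> L.loc p"
proof (rule L.loc.linear_type_relation[OF L.ideal_loc[OF L.p_ideal] _ _ _ P t])
  have img: "(\<lambda>j. to_fract (\<Prod>(e j))) ` {..<m} = (\<lambda>W. to_fract (\<Prod>W)) ` star_products c G"
    using e unfolding bij_betw_def by (metis image_image)
  show "linear_type A (Idl\<^bsub>subring_of A\<^esub> ((\<lambda>j. to_fract (\<Prod>(e j))) ` {..<m}))"
    unfolding img using lt loc_star_ideal by simp
  have eW: "e j \<in> star_products c G" if "j < m" for j
    using e that by (auto simp: bij_betw_def)
  then show "\<And>j. j < m \<Longrightarrow> to_fract (\<Prod>(e j)) \<in> A"
    using star_products_mem L.to_fract_in_loc by blast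
  fix \<alpha> j
  assume \<alpha>: "\<And>j. j < m \<Longrightarrow> \<alpha> j \<in> A" "(\<Sum>j<m. \<alpha> j * to_fract (\<Prod>(e j))) = 0" and j: "j < m"
  let ?i = "the_inv_into {..<m} e"
  have i: "?i (e j) = j" if "j < m" for j
    using e that by (intro the_inv_into_f_f) (auto simp: bij_betw_def)
  have im: "?i W < m" if W: "W \<in> star_products c G" for W
  proof -
    obtain k where "k < m" "W = e k" using e W by (auto simp: bij_betw_def)
    then show ?thesis using i by simp
  qed
  have "(\<Sum>W\<in>star_products c G. \<alpha> (?i W) * to_fract (\<Prod>W)) = (\<Sum>j<m. \<alpha> j * to_fract (\<Prod>(e j)))"
    by (subst sum.reindex_bij_betw[OF e, symmetric]) (auto simp: i)
  then have "\<alpha> (?i (e j)) \<in> L.loc p"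
    using \<alpha> im eW[OF j] by (intro syzygy_coefficients[where \<alpha> = "\<lambda>W. \<alpha> (?i W)"]) auto
  then show "\<alpha> j \<in> L.loc p" by (simp add: i[OF j])
qed

section \<open>Failure of linear type\<close>

lemma ex_enumeration: "\<exists>e. bij_betw e {..<card S} S" if "finite S" for S :: "'b set"
  using ex_bij_betw_nat_finite[OF that] by (simp add: atLeast0LessThan)

text \<open>
  Two of the products may exchange one of their factors: \<open>(s a) (t b) = (s b) (t a)\<close> up to a common
  factor is a quadratic relation.
\<close>

lemma not_linear_type_exchange:
  assumes "3 \<le> c" "c < card G"
  shows "\<not> linear_type A (L.loc (star_ideal n c G))"
proof
  assume lt: "linear_type A (L.loc (star_ideal n c G))"
  have "4 \<le> card G" using assms by simp
  then obtain T where T: "T \<subseteq> G" "card T = 4" "finite T" by (rule obtain_subset_with_card_n)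
  then obtain xs where xs: "set xs = T" "distinct xs" "length xs = 4"
    using finite_distinct_list distinct_card by metis
  then obtain s s' a b where "xs = [s, s', a, b]"
    by (auto simp: eval_nat_numeral length_Suc_conv)
  then have ab: "{s, s', a, b} = T" "s \<noteq> s'" "s \<noteq> a" "s \<noteq> b" "s' \<noteq> a" "s' \<noteq> b" "a \<noteq> b"
    using xs by auto
  \<comment> \<open>Here \<open>c \<ge> 3\<close> is used: outside the four chosen elements there
    must be room for the common factors \<open>C\<close>, of which there are two fewer than factors
    in a product.\<close>
  have "card G - c - 1 \<le> card (G - T)"
    using T fin assms by (simp add: card_Diff_subset)
  then obtain C where C: "C \<subseteq> G - T" "card C = card G - c - 1" "finite C"
    by (rule obtain_subset_with_card_n)
  have disj: "s \<notin> C" "s' \<notin> C" "a \<notin> C" "b \<notin> C" using C ab by auto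
  have W: "insert x (insert y C) \<in> star_products c G" if "x \<in> T" "y \<in> T" "x \<noteq> y" for x y
  proof -
    have "x \<notin> C" "y \<notin> C" using that C by auto
    then show ?thesis using that C T assms by (auto simp: star_products_def)
  qed
  define m where "m = card (star_products c G)"
  obtain e where e: "bij_betw e {..<m} (star_products c G)"
    using ex_enumeration[OF finite_star_products[OF fin, of c]] m_def by metis
  then have "\<forall>W\<in>star_products c G. \<exists>j<m. e j = W"
    unfolding bij_betw_def by (metis imageE lessThan_iff)
  then have "\<exists>j<m. e j = insert x (insert y C)" if "x \<in> T" "y \<in> T" "x \<noteq> y" for x y
    using W that by blast
  then obtain j1 j2 j3 j4 where j: "j1 < m" "j2 < m" "j3 < m" "j4 < m"
    "e j1 = insert s (insert a C)" "e j2 = insert s' (insert b C)"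
    "e j3 = insert s (insert b C)" "e j4 = insert s' (insert a C)"
    using ab by (metis insertI1 insertI2)
  have "e j3 \<noteq> e j1" "e j3 \<noteq> e j2" unfolding j using ab disj by auto
  then have ne: "j3 \<noteq> j1" "j3 \<noteq> j2" by auto
  define P where "P = mvar j1 * mvar j2 - mvar j3 * (mvar j4 :: 'k mpoly fract mpoly)"
  interpret T: type_subring "mpolys A m" by (rule L.loc.type_subring_mpolys)
  have PA: "P \<in> mpolys A m"
    unfolding P_def using j by (intro T.diff_mem T.mult_mem L.loc.mvar_mem_mpolys)
  have "\<Prod>(e j1) * \<Prod>(e j2) = \<Prod>(e j3) * \<Prod>(e j4)"
    using ab disj C by (simp add: j mult_ac)
  then have "to_fract (\<Prod>(e j1)) * to_fract (\<Prod>(e j2)) = to_fract (\<Prod>(e j3)) * to_fract (\<Prod>(e j4))"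
    by (metis rhom.mult[OF rhom_to_fract])
  then have "geval (\<lambda>a. [:a:]) (\<lambda>j. [:0, to_fract (\<Prod>(e j)):]) P = 0"
    by (simp add: P_def rhom.diff[OF rhom.rhom_geval[OF rhom_pconst]]
        rhom.geval_mult[OF rhom_pconst] rhom.geval_mvar[OF rhom_pconst] mult.commute)
  \<comment> \<open>At this point the first monomial of \<open>P\<close> is \<open>1\<close> and the
    second vanishes, because \<open>j3\<close> differs from \<open>j1\<close> and
    \<open>j2\<close>.\<close>
  from relation_value[OF lt e PA this, of "\<lambda>j. if j = j1 \<or> j = j2 then 1 else 0"]
  have "1 \<in> L.loc p"
    using ne by (simp add: P_def eval_simps)
  then have "to_fract 1 \<in> L.loc p" by (simp add: rhom.one[OF rhom_to_fract])
  then show False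
    using L.to_fract_in_loc_iff[OF p order.refl mp.one_mem] L.one_not_in_p by simp
qed

text \<open>
  For \<open>c = 2\<close> the products are \<open>h g = \<Prod>(G - {g}) = \<Prod>G / g\<close>, so that a linear dependency
  \<open>\<Sum> r g * g = 0\<close> becomes the relation \<open>\<Sum> r g / h g = 0\<close>.
\<close>

lemma not_linear_type_dependent:
  assumes "c = 2" "vdependent G"
  shows "\<not> linear_type A (L.loc (star_ideal n c G))"
proof
  assume lt: "linear_type A (L.loc (star_ideal n c G))"
  obtain r g0 where r: "g0 \<in> G" "r g0 \<noteq> 0" "(\<Sum>g\<in>G. const (r g) * g) = 0"
    using assms(2) vs.dependent_finite[OF fin] by blast
  define m where "m = card G"
  obtain y where y: "bij_betw y {..<m} G"
    using ex_enumeration[OF fin] m_def by metis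
  have yG: "y j \<in> G" if "j < m" for j using y that by (auto simp: bij_betw_def)
  define e where "e j = G - {y j}" for j
  have inj_rem: "inj_on (\<lambda>g. G - {g}) G" by (auto simp: inj_on_def)
  have "star_products c G = (\<lambda>g. G - {g}) ` G"
    using star_products_2[OF fin] c assms(1) by simp
  then have "bij_betw (\<lambda>g. G - {g}) G (star_products c G)"
    using inj_rem by (simp add: bij_betw_def)
  from bij_betw_trans[OF y this] have e: "bij_betw e {..<m} (star_products c G)"
    by (simp add: e_def[abs_def] comp_def)
  define \<rho> where "\<rho> j = to_fract (const (r (y j)))" for j
  have \<rho>A: "\<rho> j \<in> A" for j unfolding \<rho>_def by (intro L.to_fract_in_loc) simp
  \<comment> \<open>The relation between reciprocals with its denominators cleared by the product of
    all variables.\<close>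
  define P where "P = (\<Sum>j<m. const (\<rho> j) * (\<Prod>i\<in>{..<m} - {j}. mvar i))"
  interpret T: type_subring "mpolys A m" by (rule L.loc.type_subring_mpolys)
  have PA: "P \<in> mpolys A m"
    unfolding P_def by (intro T.sum_mem T.mult_mem T.prod_mem L.loc.mvar_mem_mpolys L.loc.const_mem_mpolys \<rho>A) auto
  define h where "h j = to_fract (\<Prod>(e j))" for j
  have hy: "h j * to_fract (y j) = to_fract (\<Prod>G)" if "j < m" for j
  proof -
    have "\<Prod>(e j) * y j = \<Prod>G"
      using yG[OF that] fin by (simp add: e_def prod.remove[of G "y j"] mult.commute)
    then show ?thesis by (metis h_def rhom.mult[OF rhom_to_fract])
  qed
  have "\<Prod>G \<noteq> 0"
    using ind[of "{_}"] fin c by (auto simp: prod_zero_iff)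
  then have nz: "[:0, to_fract (\<Prod>G):] \<noteq> 0"
    by (simp add: to_fract_eq_0_iff)
  \<comment> \<open>Writing the extra factor as \<open>h j * y j\<close> in summand \<open>j\<close>
    completes the product of all \<open>[:0, h i:]\<close>, which becomes common to all summands;
    the dependency remains as the other factor.\<close>
  have "[:0, to_fract (\<Prod>G):] * geval (\<lambda>a. [:a:]) (\<lambda>j. [:0, h j:]) P =
      (\<Sum>j<m. [:0, to_fract (\<Prod>G):] * ([:\<rho> j:] * (\<Prod>i\<in>{..<m} - {j}. [:0, h i:])))"
    by (simp only: P_def rhom.sum[OF rhom.rhom_geval[OF rhom_pconst]] rhom.geval_mult[OF rhom_pconst]
      rhom.geval_const[OF rhom_pconst] rhom.prod[OF rhom.rhom_geval[OF rhom_pconst]]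
      rhom.geval_mvar[OF rhom_pconst] sum_distrib_left)
  also have "\<dots> = (\<Sum>j<m. (\<Prod>i<m. [:0, h i:]) * [:\<rho> j * to_fract (y j):])"
  proof (rule sum.cong[OF refl])
    fix j assume "j \<in> {..<m}"
    then have j: "j < m" by simp
    have 1: "[:0, to_fract (\<Prod>G):] = [:0, h j:] * [:to_fract (y j):]"
      using hy[OF j] by (simp add: mult.commute)
    have 2: "(\<Prod>i<m. [:0, h i:]) = [:0, h j:] * (\<Prod>i\<in>{..<m} - {j}. [:0, h i:])"
      using j by (simp add: prod.remove)
    have 3: "[:\<rho> j * to_fract (y j):] = [:\<rho> j:] * [:to_fract (y j):]" by simp
    show "[:0, to_fract (\<Prod>G):] * ([:\<rho> j:] * (\<Prod>i\<in>{..<m} - {j}. [:0, h i:])) =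
        (\<Prod>i<m. [:0, h i:]) * [:\<rho> j * to_fract (y j):]"
      unfolding 1 2 3 by (simp only: mult_ac)
  qed
  also have "\<dots> = (\<Prod>i<m. [:0, h i:]) * [:\<Sum>j<m. \<rho> j * to_fract (y j):]"
    by (simp only: sum_distrib_left[symmetric] rhom.sum[OF rhom_pconst])
  also have "(\<Sum>j<m. \<rho> j * to_fract (y j)) = to_fract (\<Sum>j<m. const (r (y j)) * y j)"
    by (simp only: \<rho>_def rhom.sum[OF rhom_to_fract] rhom.mult[OF rhom_to_fract])
  also have "(\<Sum>j<m. const (r (y j)) * y j) = 0"
    using sum.reindex_bij_betw[OF y, of "\<lambda>g. const (r g) * g"] r(3) by simp
  finally have "geval (\<lambda>a. [:a:]) (\<lambda>j. [:0, h j:]) P = 0"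
    using nz by (simp add: rhom.zero[OF rhom_to_fract])
  then have rel0: "geval (\<lambda>a. [:a:]) (\<lambda>j. [:0, to_fract (\<Prod>(e j)):]) P = 0"
    by (simp add: h_def)
  obtain j0 where j0: "j0 < m" "y j0 = g0" using y r(1) by (auto simp: bij_betw_def)
  \<comment> \<open>Every summand of \<open>P\<close> except the one for \<open>j0\<close> contains
    the variable \<open>mvar j0\<close>. The value at \<open>t\<close> is thus the nonzero scalar
    \<open>r g0\<close>, a unit.\<close>
  define t where "t i = (if i = j0 then 0 else 1 :: 'k mpoly fract)" for i
  have "geval (\<lambda>a. a) t P \<in> L.loc p"
    by (rule relation_value[OF lt e PA rel0]) (simp add: t_def)
  also have "geval (\<lambda>a. a) t P = (\<Sum>j<m. \<rho> j * (\<Prod>i\<in>{..<m} - {j}. t i))"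
    by (simp add: P_def eval_simps rhom.prod[OF rhom.rhom_geval[OF rhom_id]])
  also have "\<dots> = (\<Sum>j<m. if j = j0 then \<rho> j else 0)"
  proof (rule sum.cong[OF refl])
    fix j assume "j \<in> {..<m}"
    show "\<rho> j * (\<Prod>i\<in>{..<m} - {j}. t i) = (if j = j0 then \<rho> j else 0)"
    proof (cases "j = j0")
      case True
      then show ?thesis by (simp add: t_def prod.neutral)
    next
      case False
      then have "(\<Prod>i\<in>{..<m} - {j}. t i) = 0"
        using j0(1) by (intro prod_zero) (auto simp: t_def)
      then show ?thesis using False by simp
    qed
  qed
  also have "\<dots> = \<rho> j0" using j0(1) by simp
  finally have "const (r g0) \<in> p"
    using L.to_fract_in_loc_iff[OF p order.refl, of "const (r g0)"] j0(2) by (simp add: \<rho>_def)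
  then have "const (inverse (r g0)) * const (r g0) \<in> p"
    by (intro mp.idealD(4)[OF L.p_ideal]) simp
  then show False
    using r(2) L.one_not_in_p by (simp flip: rc.mult)
qed

text \<open>Any subset of \<open>G\<close> generates a prime inside \<open>p\<close>, and by
  independence this prime contains none of the remaining forms; so they can be cancelled modulo its
  localization.\<close>

lemma prime_sequence:
  assumes ind': "\<not> vdependent G" and y: "bij_betw y {..<m} G"
  shows "prime_sequence A {..<m} (\<lambda>i. to_fract (y i)) (\<lambda>B. L.loc (Idl\<^bsub>mpoly_ring UNIV n\<^esub> (y ` B)))"
proof (rule prime_sequence.intro[OF L.loc.type_subring_axioms], rule prime_sequence_axioms.intro)
  have sub: "y ` B \<subseteq> G" if "B \<subseteq> {..<m}" for B using y that by (auto simp: bij_betw_def)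
  then have subD: "y ` B \<subseteq> mpolys UNIV n" if "B \<subseteq> {..<m}" for B using GD that by blast
  show "to_fract (y i) \<in> A" if "i \<in> {..<m}" for i
    using subD[of "{i}"] that by (intro L.to_fract_in_loc) auto
  show "ideal (L.loc (Idl\<^bsub>mpoly_ring UNIV n\<^esub> (y ` B))) (subring_of A)" if "B \<subseteq> {..<m}" for B
    by (intro L.ideal_loc mp.Idl_ideal subD that)
  show "L.loc (Idl\<^bsub>mpoly_ring UNIV n\<^esub> (y ` {})) = {0}"
    by (simp add: L.loc_Idl L.loc.Idl_empty)
  fix u B assume uB: "insert u B \<subseteq> {..<m}"
  show "L.loc (Idl\<^bsub>mpoly_ring UNIV n\<^esub> (y ` B)) \<subseteq> L.loc (Idl\<^bsub>mpoly_ring UNIV n\<^esub> (y ` insert u B))"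
    by (intro L.loc_mono mp.Idl_mono subD uB) auto
  show "to_fract (y u) \<in> L.loc (Idl\<^bsub>mpoly_ring UNIV n\<^esub> (y ` insert u B))"
    by (intro L.to_fract_in_loc mp.Idl_incl subD uB) auto
  show "\<exists>a\<in>A. q - to_fract (y u) * a \<in> L.loc (Idl\<^bsub>mpoly_ring UNIV n\<^esub> (y ` B))"
    if "q \<in> L.loc (Idl\<^bsub>mpoly_ring UNIV n\<^esub> (y ` insert u B))" for q
    using that subD[OF uB] by (intro L.loc_Idl_insertE) auto
  show "a \<in> L.loc (Idl\<^bsub>mpoly_ring UNIV n\<^esub> (y ` B))"
    if "u \<notin> B" "a \<in> A" "to_fract (y u) * a \<in> L.loc (Idl\<^bsub>mpoly_ring UNIV n\<^esub> (y ` B))" for a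
  proof (rule L.loc_cancel[OF primeideal_Idl Idl_subset_p _ _ that(2,3)])
    show "y ` B \<subseteq> G" "y ` B \<subseteq> G" "y u \<in> mpolys UNIV n" using sub uB subD[of "{u}"] by auto
    have "y u \<notin> y ` B"
      using y that(1) uB by (auto simp: bij_betw_def inj_on_def)
    then show "y u \<notin> Idl\<^bsub>mpoly_ring UNIV n\<^esub> (y ` B)"
      using sub uB by (intro independent_not_in_Idl[OF fin lin ind']) auto
  qed
qed

lemma linear_type_complete_intersection:
  assumes "card G = c"
  shows "linear_type A (L.loc (star_ideal n c G))"
proof -
  obtain y where y: "bij_betw y {..<c} G" using ex_enumeration[OF fin] assms by metis
  have "\<not> vdependent G" using ind[of G] assms by simp
  then interpret koszul_relations A "{..<c}" "\<lambda>i. to_fract (y i)" "\<lambda>B. L.loc (Idl\<^bsub>mpoly_ring UNIV n\<^esub> (y ` B))"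
    by (intro koszul_relations.intro linear_relations.intro prime_sequence y)
  have "{S. S \<subseteq> G \<and> card S = c} = {G}"
    using assms card_subset_eq[OF fin] by auto
  then have "star_ideal n c G = Idl\<^bsub>mpoly_ring UNIV n\<^esub> G"
    by (simp add: star_ideal_def)
  then have "L.loc (star_ideal n c G) = Idl\<^bsub>subring_of A\<^esub> (to_fract ` G)"
    using L.loc_Idl[OF GD] by simp
  also have "to_fract ` G = (\<lambda>i. to_fract (y i)) ` {..<c}"
    using y by (simp add: bij_betw_def flip: image_image)
  finally show ?thesis using linear_type[of c] by simp
qed

lemma linear_type_height_2:
  assumes "c = 2" "\<not> vdependent G"
  shows "linear_type A (L.loc (star_ideal n c G))"
proof -
  define m where "m = card G"
  obtain y where y: "bij_betw y {..<m} G" using ex_enumeration[OF fin] m_def by metis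
  interpret hilbert_burch_relations A "{..<m}" "\<lambda>i. to_fract (y i)" "\<lambda>B. L.loc (Idl\<^bsub>mpoly_ring UNIV n\<^esub> (y ` B))"
    by (intro hilbert_burch_relations.intro linear_relations.intro prime_sequence y assms)
  have "star_products c G = (\<lambda>g. G - {g}) ` y ` {..<m}"
    using star_products_2[OF fin] c assms(1) y by (simp add: bij_betw_def)
  then have prods: "star_products c G = (\<lambda>i. G - {y i}) ` {..<m}"
    by (simp add: image_image)
  have "to_fract (\<Prod>(G - {y i})) = cofactor {..<m} i" if "i < m" for i
  proof -
    have inj: "inj_on y ({..<m} - {i})" using y by (auto simp: bij_betw_def inj_on_def)
    have "G - {y i} = y ` ({..<m} - {i})"
      using y that by (auto simp: bij_betw_def inj_on_def)
    then have "\<Prod>(G - {y i}) = (\<Prod>j\<in>{..<m} - {i}. y j)"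
      using prod.reindex[OF inj, of "\<lambda>x. x"] by simp
    then show ?thesis
      by (simp add: cofactor_def rhom.prod[OF rhom_to_fract])
  qed
  then have "(\<lambda>W. to_fract (\<Prod>W)) ` star_products c G = cofactor {..<m} ` {..<m}"
    unfolding prods image_image by (intro image_cong) auto
  then show ?thesis
    using linear_type[of m] loc_star_ideal c assms(1) by (simp add: m_def)
qed

end

text \<open>Modulo the variables every polynomial is congruent to a constant. An ideal properly
  containing \<open>p\<close> therefore contains a nonzero constant.\<close>

lemma maximalideal_if_mvars:
  fixes p :: "'k::field mpoly set"
  assumes p: "primeideal p (mpoly_ring UNIV n)" and mvars: "mvar ` {..<n} \<subseteq> p"
  shows "maximalideal p (mpoly_ring UNIV n)"
proof (rule maximalidealI)
  have I: "ideal p (mpoly_ring UNIV n)" and one: "1 \<notin> p"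
    using p unfolding mp.primeideal_iff by blast+
  show "ideal p (mpoly_ring UNIV n)" by fact
  show "carrier (mpoly_ring UNIV n) \<noteq> p" using one mp.one_mem by auto
  have const: "\<exists>a. f - const a \<in> p" if "f \<in> mpolys UNIV n" for f
    using that
  proof (induction rule: type_subring.mpolys_induct[OF type_subring_UNIV, consumes 1, case_names const mvar add mult])
    case (const a)
    then show ?case using mp.idealD(2)[OF I] by (intro exI[of _ a]) simp
  next
    case (mvar i)
    then show ?case using mvars by (intro exI[of _ 0]) auto
  next
    case (add P P')
    then obtain a b where "P - const a \<in> p" "P' - const b \<in> p" by blast
    from mp.idealD(3)[OF I this] show ?case by (intro exI[of _ "a + b"]) (simp add: algebra_simps)
  next
    case (mult P P')
    then obtain a b where ab: "P - const a \<in> p" "P' - const b \<in> p" by blast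
    have "P' * (P - const a) + const a * (P' - const b) \<in> p"
      using mult(2) by (intro mp.idealD(3)[OF I] mp.idealD(4)[OF I] ab) auto
    then show ?case by (intro exI[of _ "a * b"]) (simp add: algebra_simps)
  qed
  fix J assume J: "ideal J (mpoly_ring UNIV n)" "p \<subseteq> J" "J \<subseteq> carrier (mpoly_ring UNIV n)"
  show "J = p \<or> J = carrier (mpoly_ring UNIV n)"
  proof (cases "J \<subseteq> p")
    case False
    then obtain f where f: "f \<in> J" "f \<notin> p" by blast
    then obtain a where a: "f - const a \<in> p" using const J(3) by auto
    then have "a \<noteq> 0" using f(2) by auto
    have "f - (f - const a) \<in> J" by (rule mp.idealD(7)[OF J(1) f(1)]) (use a J(2) in blast)
    then have "const a \<in> J" by simp
    then have "const (inverse a) * const a \<in> J" by (intro mp.idealD(4)[OF J(1)]) auto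
    then have "1 \<in> J" using \<open>a \<noteq> 0\<close> by (simp flip: rc.mult)
    then show ?thesis using mp.ideal_eq_iff_one_mem[OF J(1)] by simp
  qed (use J(2) in blast)
qed

section \<open>The non-linear type locus\<close>

locale linear_star =
  fixes n c :: nat and F :: "'k::field mpoly set"
  assumes star: "linear_star_configuration n c F"
begin

lemma finite_F: "finite F" and F_linear: "F \<subseteq> linear_forms n" and c1: "1 \<le> c" and c_le: "c \<le> card F"
  using star by (auto simp: linear_star_configuration_def star_configuration_def linear_forms_def)

lemma F_mem: "F \<subseteq> mpolys UNIV n"
  using F_linear linear_forms_subset by blast

text \<open>The definition tests only subsets of one cardinality; a smaller set is extended to one
  of these, and independence passes to subsets.\<close>

lemma independent:
  assumes "S \<subseteq> F" "card S \<le> c + 1"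
  shows "\<not> vdependent S"
proof -
  have "card S \<le> min (c + 1) (card F)" using assms finite_F by (simp add: card_mono)
  then obtain S' where S': "S \<subseteq> S'" "S' \<subseteq> F" "card S' = min (c + 1) (card F)"
    using exists_subset_between[of S "min (c + 1) (card F)" F] assms finite_F by auto
  then have "is_regular_sequence_set (mpoly_ring UNIV n) S'"
    using star by (auto simp: linear_star_configuration_def star_configuration_def)
  then have "\<not> vdependent S'"
    using regular_sequence_set_iff_independent[of S' n] S' finite_F F_linear finite_subset by blast
  then show ?thesis using vs.independent_mono S'(1) by blast
qed

lemma localized_star:
  assumes "primeideal p (mpoly_ring UNIV n)" "c \<le> card (F \<inter> p)"
  shows "localized_star n c (F \<inter> p) p"
  by (rule localized_star.intro) (use assms finite_F F_linear c1 independent in auto)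

text \<open>The product \<open>u\<close> of the forms outside \<open>p\<close> is a unit at
  \<open>p\<close>. It lies in the ideal of every \<open>S\<close> not contained in
  \<open>p\<close>, so multiplying by \<open>u\<close> takes care of the additional ideals in the
  intersection for \<open>F\<close>.\<close>

lemma localize_star_ideal:
  assumes p: "primeideal p (mpoly_ring UNIV n)" and card: "c \<le> card (F \<inter> p)"
  shows "localize (mpolys UNIV n) p (star_ideal n c F) = localize (mpolys UNIV n) p (star_ideal n c (F \<inter> p))"
proof -
  interpret L: localization "mpolys UNIV n" p
    by (rule localization.intro[OF mp.type_subring_axioms localization_axioms.intro[OF p]])
  define u where "u = \<Prod>(F - p)"
  have uD: "u \<in> mpolys UNIV n" unfolding u_def using F_mem by (intro mp.prod_mem) auto
  show ?thesis
  proof (rule L.loc_eqI)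
    show "star_ideal n c F \<subseteq> star_ideal n c (F \<inter> p)" by (auto simp: star_ideal_def)
    have "u \<notin> p"
      using mp.prod_mem_prime[OF p, of "F - p" "\<lambda>x. x"] finite_F F_mem by (auto simp: u_def)
    then show "u \<in> mpolys UNIV n - p" using uD by simp
    fix f assume f: "f \<in> star_ideal n c (F \<inter> p)"
    have fD: "f \<in> mpolys UNIV n"
      using f star_ideal_subset[OF card] finite_F F_mem by blast
    show "u * f \<in> star_ideal n c F"
      unfolding star_ideal_def
    proof (rule INT_I)
      fix S assume S: "S \<in> {S. S \<subseteq> F \<and> card S = c}"
      then have SD: "S \<subseteq> mpolys UNIV n" using F_mem by blast
      note I = mp.Idl_ideal[OF SD]
      show "u * f \<in> Idl\<^bsub>mpoly_ring UNIV n\<^esub> S"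
      proof (cases "S \<subseteq> p")
        case True
        then have "f \<in> Idl\<^bsub>mpoly_ring UNIV n\<^esub> S" using f S by (auto simp: star_ideal_def)
        then show ?thesis by (rule mp.idealD(4)[OF I uD])
      next
        case False
        then obtain s where s: "s \<in> S" "s \<notin> p" by blast
        have "u \<in> Idl\<^bsub>mpoly_ring UNIV n\<^esub> S"
          unfolding u_def using s S finite_F F_mem
          by (intro mp.prod_mem_ideal[OF I, of _ "\<lambda>x. x" s]) (auto intro: mp.Idl_incl[OF SD])
        then show ?thesis by (rule mp.idealD(5)[OF I fD])
      qed
    qed
  qed
qed

text \<open>No \<open>c\<close> of the forms lie in \<open>p\<close>, so the unit \<open>u\<close>
  lies in every ideal of the intersection.\<close>

lemma linear_type_unit:
  assumes p: "primeideal p (mpoly_ring UNIV n)" and card: "card (F \<inter> p) < c"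
  shows "linear_type (localize (mpolys UNIV n) p (mpolys UNIV n)) (localize (mpolys UNIV n) p (star_ideal n c F))"
proof -
  interpret L: localization "mpolys UNIV n" p
    by (rule localization.intro[OF mp.type_subring_axioms localization_axioms.intro[OF p]])
  define u where "u = \<Prod>(F - p)"
  have uD: "u \<in> mpolys UNIV n" unfolding u_def using F_mem by (intro mp.prod_mem) auto
  have "u \<notin> p"
    using mp.prod_mem_prime[OF p, of "F - p" "\<lambda>x. x"] finite_F F_mem by (auto simp: u_def)
  have "L.loc (star_ideal n c F) = L.loc (mpolys UNIV n)"
  proof (rule L.loc_eqI)
    show "star_ideal n c F \<subseteq> mpolys UNIV n" by (rule star_ideal_subset[OF c_le finite_F F_mem])
    show "u \<in> mpolys UNIV n - p" using uD \<open>u \<notin> p\<close> by simp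
    fix f :: "'k mpoly" assume f: "f \<in> mpolys UNIV n"
    show "u * f \<in> star_ideal n c F"
      unfolding star_ideal_def
    proof (rule INT_I)
      fix S assume S: "S \<in> {S. S \<subseteq> F \<and> card S = c}"
      then have SD: "S \<subseteq> mpolys UNIV n" using F_mem by blast
      note I = mp.Idl_ideal[OF SD]
      have "\<not> S \<subseteq> F \<inter> p" using card S finite_F card_mono[of "F \<inter> p" S] by auto
      then obtain s where s: "s \<in> S" "s \<notin> p" using S by blast
      have "u \<in> Idl\<^bsub>mpoly_ring UNIV n\<^esub> S"
        unfolding u_def using s S finite_F F_mem
        by (intro mp.prod_mem_ideal[OF I, of _ "\<lambda>x. x" s]) (auto intro: mp.Idl_incl[OF SD])
      then show "u * f \<in> Idl\<^bsub>mpoly_ring UNIV n\<^esub> S" by (rule mp.idealD(5)[OF I f])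
    qed
  qed
  then show ?thesis using L.linear_type_unit by simp
qed

lemma NLT_iff_height_ge_3:
  assumes "3 \<le> c" "primeideal p (mpoly_ring UNIV n)"
  shows "p \<in> NLT (mpolys UNIV n) (star_ideal n c F) \<longleftrightarrow> c < card (F \<inter> p)"
proof (cases "c \<le> card (F \<inter> p)")
  case True
  interpret localized_star n c "F \<inter> p" p by (rule localized_star[OF assms(2) True])
  show ?thesis
    using localize_star_ideal[OF assms(2) True] assms not_linear_type_exchange
      linear_type_complete_intersection le_neq_implies_less[OF True]
    by (auto simp: NLT_def Spec_def)
next
  case False
  then show ?thesis using linear_type_unit[OF assms(2)] by (auto simp: NLT_def)
qed

lemma NLT_iff_height_2:
  assumes "c = 2" "primeideal p (mpoly_ring UNIV n)"
  shows "p \<in> NLT (mpolys UNIV n) (star_ideal n c F) \<longleftrightarrow> vdependent (F \<inter> p)"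
proof (cases "c \<le> card (F \<inter> p)")
  case True
  interpret localized_star n c "F \<inter> p" p by (rule localized_star[OF assms(2) True])
  show ?thesis
    using localize_star_ideal[OF assms(2) True] assms not_linear_type_dependent linear_type_height_2
    by (auto simp: NLT_def Spec_def)
next
  case False
  then show ?thesis
    using linear_type_unit[OF assms(2)] independent[of "F \<inter> p"] by (auto simp: NLT_def)
qed

text \<open>A dependent subset of \<open>F\<close> has more than \<open>c + 1\<close> elements,
  which meets the criterion for \<open>c \<ge> 3\<close>; for \<open>c = 2\<close> dependence itself
  is the criterion. If \<open>H\<close> generated the ideal of all variables, it would span all
  linear forms, and a dependent set needs more than \<open>n\<close> elements for that.\<close>

lemma dependent_subset_Idl:
  assumes c: "2 \<le> c" and H: "H \<subseteq> F" "card H \<le> n" "\<not> is_regular_sequence_set (mpoly_ring UNIV n) H"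
  shows "primeideal (Idl\<^bsub>mpoly_ring UNIV n\<^esub> H) (mpoly_ring UNIV n)"
    and "Idl\<^bsub>mpoly_ring UNIV n\<^esub> H \<in> NLT (mpolys UNIV n) (star_ideal n c F)"
    and "Idl\<^bsub>mpoly_ring UNIV n\<^esub> H \<noteq> Idl\<^bsub>mpoly_ring UNIV n\<^esub> (mvar ` {..<n})"
proof -
  have H': "finite H" "H \<subseteq> linear_forms n" "H \<subseteq> mpolys UNIV n"
    using H finite_F F_linear F_mem finite_subset by blast+
  have dep: "vdependent H"
    using regular_sequence_set_iff_independent[OF H'(1,2)] H(3) by blast
  let ?q = "Idl\<^bsub>mpoly_ring UNIV n\<^esub> H"
  show q: "primeideal ?q (mpoly_ring UNIV n)" by (rule primeideal_Idl_linear_forms[OF H'(1,2)])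
  have sub: "H \<subseteq> F \<inter> ?q" using H(1) mp.Idl_incl[OF H'(3)] by blast
  have dep': "vdependent (F \<inter> ?q)" using vs.dependent_mono[OF dep sub] .
  show "?q \<in> NLT (mpolys UNIV n) (star_ideal n c F)"
  proof (cases "c = 2")
    case True
    then show ?thesis using NLT_iff_height_2[OF _ q] dep' by simp
  next
    case False
    have "\<not> card (F \<inter> ?q) \<le> c + 1" using independent[of "F \<inter> ?q"] dep' by blast
    then show ?thesis using NLT_iff_height_ge_3[OF _ q] False c by simp
  qed
  show "?q \<noteq> Idl\<^bsub>mpoly_ring UNIV n\<^esub> (mvar ` {..<n})"
  proof
    assume eq: "?q = Idl\<^bsub>mpoly_ring UNIV n\<^esub> (mvar ` {..<n})"
    have "mvar ` {..<n} \<subseteq> vspan H"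
    proof
      fix x :: "'k mpoly" assume x: "x \<in> mvar ` {..<n}"
      then have "x \<in> ?q" unfolding eq by (intro mp.Idl_incl) auto
      then show "x \<in> vspan H"
        using linear_form_in_Idl_iff[OF H'(1,2)] x mvar_linear_form by blast
    qed
    then have "n < card H" by (rule card_spanning_gt[OF H'(1) dep])
    then show False using H(2) by simp
  qed
qed

text \<open>
  If \<open>F \<inter> p\<close> is dependent, a circuit in it has at most \<open>n\<close> elements unless it spans all linear forms.
\<close>

lemma minimal_NLT_height_2:
  assumes c: "c = 2" and p: "p \<in> NLT (mpolys UNIV n) (star_ideal n c F)"
    and min: "\<And>p'. p' \<in> NLT (mpolys UNIV n) (star_ideal n c F) \<Longrightarrow> p' \<subseteq> p \<Longrightarrow> p' = p"
    and notmax: "\<not> maximalideal p (mpoly_ring UNIV n)"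
  shows "\<exists>H\<subseteq>F. card H \<le> n \<and> \<not> is_regular_sequence_set (mpoly_ring UNIV n) H \<and> p = Idl\<^bsub>mpoly_ring UNIV n\<^esub> H"
proof -
  have prime: "primeideal p (mpoly_ring UNIV n)" using p by (auto simp: NLT_def Spec_def)
  have I: "ideal p (mpoly_ring UNIV n)" using prime unfolding mp.primeideal_iff by blast
  have "vdependent (F \<inter> p)" using NLT_iff_height_2[OF c prime] p by blast
  then have "\<exists>H. H \<subseteq> F \<inter> p \<and> vdependent H \<and> (\<forall>H'. H' \<subseteq> F \<inter> p \<and> vdependent H' \<longrightarrow> card H \<le> card H')"
    using ex_has_least_nat[of "\<lambda>H. H \<subseteq> F \<inter> p \<and> vdependent H" "F \<inter> p" card] by blast
  then obtain H where H: "H \<subseteq> F \<inter> p" "vdependent H"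
    and least: "\<And>H'. H' \<subseteq> F \<inter> p \<Longrightarrow> vdependent H' \<Longrightarrow> card H \<le> card H'" by blast
  have H': "finite H" "H \<subseteq> linear_forms n" "H \<subseteq> mpolys UNIV n"
    using H finite_F F_linear F_mem finite_subset by blast+
  have nreg: "\<not> is_regular_sequence_set (mpoly_ring UNIV n) H"
    using regular_sequence_set_iff_independent[OF H'(1,2)] H(2) by blast
  have "card H \<le> n"
  proof (rule ccontr)
    assume "\<not> card H \<le> n"
    \<comment> \<open>By the choice of \<open>H\<close>, removing one element leaves an independent
      set, which has at most \<open>n\<close> elements and hence exactly \<open>n\<close>. All
      variables are then in its span, and \<open>p\<close> would be maximal.\<close>
    obtain h where h: "h \<in> H" using H(2) by (auto simp: vs.dependent_def)
    let ?H = "H - {h}"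
    have "card ?H < card H" using h H'(1) by (rule card_Diff1_less[rotated])
    then have ind: "\<not> vdependent ?H" using least[of ?H] H(1) by auto
    have HL: "?H \<subseteq> linear_forms n" using H'(2) by blast
    have "card ?H = n"
      using card_independent_le(2)[OF HL ind] \<open>\<not> card H \<le> n\<close> h H'(1) by simp
    then have "mvar ` {..<n} \<subseteq> vspan ?H" by (rule mvars_in_span[OF HL ind])
    also have "\<dots> \<subseteq> Idl\<^bsub>mpoly_ring UNIV n\<^esub> ?H" using H'(3) by (intro span_subset_Idl) auto
    also have "\<dots> \<subseteq> p" using H(1) by (intro mp.Idl_minimal I) auto
    finally show False using maximalideal_if_mvars[OF prime] notmax by blast
  qed
  have "Idl\<^bsub>mpoly_ring UNIV n\<^esub> H \<in> NLT (mpolys UNIV n) (star_ideal n c F)"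
    by (rule dependent_subset_Idl) (use c H \<open>card H \<le> n\<close> nreg in auto)
  moreover have "Idl\<^bsub>mpoly_ring UNIV n\<^esub> H \<subseteq> p" using H(1) by (intro mp.Idl_minimal I) auto
  ultimately have "p = Idl\<^bsub>mpoly_ring UNIV n\<^esub> H" using min by blast
  then show ?thesis using H(1) \<open>card H \<le> n\<close> nreg by blast
qed

end

text \<open>The first part is stated for \<open>2 \<le> c\<close>: for \<open>c = 1\<close> the
  ideal is principal, generated by the product of all forms, and so of linear type at every
  prime.\<close>

theorem proposition4p5:
  fixes n c :: nat and F :: "'k::field mpoly set"
  assumes "linear_star_configuration n c F"
  shows "(2 \<le> c \<longrightarrow>
           (\<forall>H\<subseteq>F. card H \<le> n \<and> \<not> is_regular_sequence_set (mpoly_ring UNIV n) H \<longrightarrow>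
              primeideal (Idl\<^bsub>mpoly_ring UNIV n\<^esub> H) (mpoly_ring UNIV n) \<and>
              Idl\<^bsub>mpoly_ring UNIV n\<^esub> H \<in>
                NLT (mpolys UNIV n) (star_ideal n c F) - {Idl\<^bsub>mpoly_ring UNIV n\<^esub> (mvar ` {..<n})})) \<and>
         (c = 2 \<longrightarrow>
           (\<forall>p\<in>NLT (mpolys UNIV n) (star_ideal n 2 F).
              (\<forall>p'\<in>NLT (mpolys UNIV n) (star_ideal n 2 F). p' \<subseteq> p \<longrightarrow> p' = p) \<and>
              \<not> maximalideal p (mpoly_ring UNIV n) \<longrightarrow>
              (\<exists>H\<subseteq>F. card H \<le> n \<and> \<not> is_regular_sequence_set (mpoly_ring UNIV n) H \<and>
                 p = Idl\<^bsub>mpoly_ring UNIV n\<^esub> H))) \<and>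
         (3 \<le> c \<longrightarrow>
           NLT (mpolys UNIV n) (star_ideal n c F) =
             {p \<in> Spec (mpoly_ring UNIV n). card (F \<inter> p) > c})"
proof -
  interpret linear_star n c F by (rule linear_star.intro[OF assms])
  have NLT3: "NLT (mpolys UNIV n) (star_ideal n c F) = {p \<in> Spec (mpoly_ring UNIV n). card (F \<inter> p) > c}"
    if "3 \<le> c"
    using NLT_iff_height_ge_3[OF that] by (auto simp: NLT_def Spec_def)
  show ?thesis
    using dependent_subset_Idl minimal_NLT_height_2 NLT3 by (intro conjI impI allI ballI) auto
qed

end
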